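(* Let $n\ge2$ be an integer and let $\boldsymbol{X}=(X_1,\dots,X_n)$ be an exchangeable random vector in $\mathbb{R}^n$ which satisfies $\mathbb{E}[X_1]=0$, $\mathbb{E}[X_1^2]=1$ and $\mathbb{E}[|X_1|^3]<\infty$. Then for every vector $\boldsymbol{\theta}=(\theta_1,\dots,\theta_n)\in\mathbb{R}^n$ with $\theta_1^2+\dots+\theta_n^2=1$, setting $\sigma^2:=\mathrm{Var}(\theta_1X_1+\dots+\theta_nX_n)$ and $\delta_0:=\mathbb{E}[X_1X_2]$, we have $$d_K\Big(\sum_{i=1}^n\theta_iX_i,\mathcal{N}(0,\sigma^2)\Big)\le5\,\mathrm{osc}(\boldsymbol{X})+6|\delta_0|+\frac{\kappa_1}{n}+\Big(|\delta_0|+\frac1n\Big)\cdot\Big(\sum_{i=1}^n\theta_i\Big)^2+\kappa_1\,\mathbb{E}\big[|X_1|^3\big]\sum_{i=1}^n|\theta_i|^3,$$ where $\kappa_1\ge1$ is an absolute constant; in fact, one can take $\kappa_1=4320$.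
   Context: A random vector $(X_1,\dots,X_n)$ is exchangeable if its distribution is invariant under permutations of the coordinates. Here $\mathrm{osc}(\boldsymbol{X}):=\mathbb{E}\big|\frac1n\sum_{j=1}^nX_j^2-1\big|$ (the oscillation of $\boldsymbol X$, as $\mathbb{E}[X_1^2]=1$). $d_K(X,Y):=\sup_{x\in\mathbb{R}}|\mathbb{P}(X\le x)-\mathbb{P}(Y\le x)|$ is the Kolmogorov distance, and $\mathcal{N}(0,\sigma^2)$ is a normal random variable with mean $0$ and variance $\sigma^2$ (constant $0$ if $\sigma=0$). *)

theory Defs
  imports "HOL-Probability.Probability" "HOL-Combinatorics.Combinatorics"
begin

definition exchangeable :: "'a measure \<Rightarrow> nat \<Rightarrow> (nat \<Rightarrow> 'a \<Rightarrow> real) \<Rightarrow> bool" where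
  "exchangeable M n X \<longleftrightarrow>
     (\<forall>p. p permutes {1..n} \<longrightarrow>
        distr M (\<Pi>\<^sub>M i\<in>{1..n}. borel) (\<lambda>\<omega>. \<lambda>i\<in>{1..n}. X (p i) \<omega>) =
        distr M (\<Pi>\<^sub>M i\<in>{1..n}. borel) (\<lambda>\<omega>. \<lambda>i\<in>{1..n}. X i \<omega>))"

definition osc :: "'a measure \<Rightarrow> nat \<Rightarrow> (nat \<Rightarrow> 'a \<Rightarrow> real) \<Rightarrow> real" where
  "osc M n X = prob_space.expectation M (\<lambda>\<omega>. \<bar>(\<Sum>j=1..n. (X j \<omega>)\<^sup>2) / real n - 1\<bar>)"

(* The Kolmogorov distance depends only on the laws of the two random variables (which may
   live on different probability spaces), so it is defined on laws; cdf \<mu> x is \<mu> (-\<infinity>, x]. *)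
definition kolmogorov_dist :: "real measure \<Rightarrow> real measure \<Rightarrow> real" where
  "kolmogorov_dist \<mu> \<nu> = (SUP x. \<bar>cdf \<mu> x - cdf \<nu> x\<bar>)"

(* The second argument is the variance, whereas normal_density takes the standard deviation. *)
definition normal_law :: "real \<Rightarrow> real \<Rightarrow> real measure" where
  "normal_law m v =
     (if v = 0 then return borel m
      else density lborel (\<lambda>x. ennreal (normal_density m (sqrt v) x)))"

end

theory Submission
  imports Defs "HOL-Real_Asymp.Real_Asymp"
begin

text \<open>
  Given the values \<open>x\<^sub>1, \<dots>, x\<^sub>n\<close> of \<open>X\<close> up to order, the linear form is the permutation statistic
  \<open>\<Sum> \<theta>\<^sub>i x\<^bsub>\<pi>(i)\<^esub>\<close> with \<open>\<pi>\<close> uniform. After centering \<open>\<theta>\<close> and \<open>x\<close> it is compared with a normal law by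
  Stein's method. Swapping \<open>\<pi>(i)\<close> and \<open>\<pi>(j)\<close> changes the statistic by
  \<open>D\<^sub>i\<^sub>j = (a\<^sub>i - a\<^sub>j)(b\<^bsub>\<pi>(i)\<^esub> - b\<^bsub>\<pi>(j)\<^esub>)\<close>, and the random \<open>D\<^sub>i\<^sub>j\<^sup>2\<close> is
  decoupled from the derivative of Stein's solution by using that
  \<open>\<Sum>\<^sub>k\<^sub>l (b\<^bsub>\<pi>(k)\<^esub> - b\<^bsub>\<pi>(l)\<^esub>)\<^sup>2\<close> does not depend on \<open>\<pi>\<close>: a permutation of
  \<open>{i, j, k, l}\<close> moves this factor to \<open>D\<^sub>i\<^sub>j\<^sup>2\<close> and alters the statistic at no more than four indices. The
  jump of the derivative is controlled by a concentration inequality that holds conditionally on the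
  values of \<open>\<pi>\<close> at those indices; it follows by testing a clipped identity function against the
  antisymmetric sum of the truncated \<open>D\<^sub>i\<^sub>j\<close>, whose square sum concentrates by Chebyshev's
  inequality.

  Integrating over the values of \<open>X\<close>, the shift \<open>(\<Sum> \<theta>\<^sub>i)(\<Sum> X\<^sub>i) / n\<close> has mean zero and enters only through
  its second moment, and the random variance differs from 1 by the oscillation up to terms of order
  \<open>|\<delta>\<^sub>0| + 1/n\<close>.
\<close>

section \<open>The standard normal distribution and Stein's equation\<close>

text \<open>Testing with the indicator of a half-line makes Stein's derivative jump at
  \<open>z\<close>, and smoothness alone does not show how rarely the statistic is near
  \<open>z\<close>. Hence the concentration inequality. It must hold given the values of
  \<open>\<pi>\<close> at up to four indices, because it meets the factor
  \<open>(D i j \<pi>)\<^sup>2\<close>, which depends on them. Nonnegative weights that depend on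
  those values only express this conditioning. Only third moments are available. The variance of the
  sum of the \<open>(D i j \<pi>)\<^sup>2\<close> would need fourth ones, so the squares are
  truncated at a level proportional to the third-moment ratio \<open>\<beta>\<close>. The error for
  fixed values of the vector must moreover be integrable, so it is kept affine in
  \<open>\<bar>v - 1\<bar>\<close> and in the mean of the cubes. The constant: a normalized array
  gives \<open>400 * \<beta>\<close>, and undoing the normalization costs a factor 9, so the third
  moments get 3600 and 4320 leaves room. Unless the bound is trivial, \<open>4320 / n\<close> also
  forces \<open>n\<close> to be so large that the loss of four indices is minor.\<close>

abbreviation Phi :: "real \<Rightarrow> real" where
  "Phi \<equiv> cdf std_normal_distribution"

lemma std_normal_density_continuous_on: "continuous_on A std_normal_density"
  unfolding std_normal_density_def by (intro continuous_intros) auto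

lemma std_normal_density_deriv:
  "(std_normal_density has_real_derivative - (x * std_normal_density x)) (at x)"
  unfolding std_normal_density_def
  by (auto intro!: derivative_eq_intros simp: field_simps power2_eq_square)

lemma std_normal_density_minus [simp]: "std_normal_density (- x) = std_normal_density x"
  by (simp add: std_normal_density_def)

lemma std_normal_density_bound:
  assumes "x\<^sup>2 \<ge> y\<^sup>2"
  shows "std_normal_density x \<le> std_normal_density y"
  using assms unfolding std_normal_density_def by (intro mult_left_mono) auto

lemma Phi_nonneg [simp]: "0 \<le> Phi x"
  and Phi_le_one [simp]: "Phi x \<le> 1"
proof -
  interpret real_distribution std_normal_distribution
    by (rule real_dist_normal_dist)
  show "0 \<le> Phi x" "Phi x \<le> 1"
    by (rule cdf_nonneg, rule cdf_bounded_prob)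
qed

lemma Phi_mono: "x \<le> y \<Longrightarrow> Phi x \<le> Phi y"
proof -
  interpret real_distribution std_normal_distribution
    by (rule real_dist_normal_dist)
  show "x \<le> y \<Longrightarrow> Phi x \<le> Phi y" by (rule cdf_nondecreasing)
qed

lemma Phi_diff:
  assumes "x \<le> y"
  shows "Phi y - Phi x = integral {x..y} std_normal_density"
proof (cases "x = y")
  case False
  interpret real_distribution std_normal_distribution
    by (rule real_dist_normal_dist)
  have lt: "x < y" using False assms by simp
  have "Phi y - Phi x = measure std_normal_distribution {x<..y}"
    using cdf_diff_eq[OF lt] .
  also have "\<dots> = (LINT t|std_normal_distribution. indicator {x<..y} t)"
    by simp
  also have "\<dots> = (LINT t|lborel. std_normal_density t * indicator {x<..y} t)"
    by (subst integral_density) (auto simp: normal_density_nonneg)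
  also have "\<dots> = set_lebesgue_integral lborel {x<..y} std_normal_density"
    by (simp add: set_lebesgue_integral_def mult.commute)
  also have "\<dots> = integral {x<..y} std_normal_density"
  proof (rule set_borel_integral_eq_integral(2))
    have "integrable lborel (\<lambda>t. std_normal_density t * indicator {x<..y} t)"
      by (rule integrable_real_mult_indicator) auto
    thus "set_integrable lborel {x<..y} std_normal_density"
      by (simp add: set_integrable_def mult.commute)
  qed
  also have "\<dots> = integral {x..y} std_normal_density"
  proof (rule integral_subset_negligible)
    show "negligible ({x..y} - {x<..y})"
      by (rule negligible_subset[of "{x}"]) auto
  qed auto
  finally show ?thesis .
qed simp

lemma Phi_deriv: "(Phi has_real_derivative std_normal_density x) (at x)"
proof -
  have "((\<lambda>t. integral {x - 1..t} std_normal_density) has_real_derivative std_normal_density x)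
          (at x within {x - 1..x + 1})"
    by (rule integral_has_real_derivative) (auto intro: std_normal_density_continuous_on)
  hence "((\<lambda>t. integral {x - 1..t} std_normal_density) has_real_derivative std_normal_density x) (at x)"
    by (simp add: at_within_Icc_at)
  hence "((\<lambda>t. Phi (x - 1) + integral {x - 1..t} std_normal_density) has_real_derivative
           std_normal_density x) (at x)"
    by (auto intro!: derivative_eq_intros)
  thus ?thesis
  proof (rule has_field_derivative_transform_within_open[of _ _ _ "{x - 1<..}"])
    show "\<And>t. t \<in> {x - 1<..} \<Longrightarrow> Phi (x - 1) + integral {x - 1..t} std_normal_density = Phi t"
      by (simp add: Phi_diff[symmetric])
  qed auto
qed

lemma Phi_at_bot: "(Phi \<longlongrightarrow> 0) at_bot" and Phi_at_top: "(Phi \<longlongrightarrow> 1) at_top"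
proof -
  interpret real_distribution std_normal_distribution
    by (rule real_dist_normal_dist)
  show "(Phi \<longlongrightarrow> 0) at_bot" "(Phi \<longlongrightarrow> 1) at_top"
    by (rule cdf_lim_at_bot, rule cdf_lim_at_top_prob)
qed

lemma Phi_minus: "Phi (- x) = 1 - Phi x"
proof -
  let ?h = "\<lambda>t. Phi t + Phi (- t)"
  have "(?h has_real_derivative 0) (at t)" for t
    using DERIV_add[OF Phi_deriv[of t] DERIV_mirror[THEN iffD1, OF Phi_deriv[of "-t"]]] by simp
  hence c: "?h t = ?h x" for t
    by (intro DERIV_isconst_all[of ?h]) simp
  have "(?h \<longlongrightarrow> 1 + 0) at_top"
    by (rule tendsto_add[OF Phi_at_top filterlim_compose[OF Phi_at_bot filterlim_uminus_at_bot_at_top]])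
  moreover have "(?h \<longlongrightarrow> ?h x) at_top"
    by (intro tendsto_eventually always_eventually allI c)
  ultimately have "?h x = 1 + 0"
    by (intro tendsto_unique[OF trivial_limit_at_top_linorder])
  thus ?thesis by simp
qed

lemma Phi_zero: "Phi 0 = 1 / 2"
  using Phi_minus[of 0] by simp

text \<open>Division by \<open>x < 0\<close> turns the claim into
  \<open>Phi x + std_normal_density x / x \<le> 0\<close>. The left side decreases on the negative
  axis and tends to 0 at minus infinity.\<close>

lemma Mills_ratio:
  assumes "x \<le> 0"
  shows "0 \<le> std_normal_density x + x * Phi x"
proof (cases "x = 0")
  case True thus ?thesis by simp
next
  case False
  hence x: "x < 0" using assms by simp
  let ?h = "\<lambda>t. Phi t + std_normal_density t / t"
  have d: "(?h has_real_derivative - (std_normal_density t / t\<^sup>2)) (at t)" if "t < 0" for t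
    using that by (auto intro!: derivative_eq_intros Phi_deriv std_normal_density_deriv
      simp: field_simps power2_eq_square)
  have "\<forall>\<^sub>F t in at_bot. ?h x \<le> ?h t"
    using eventually_le_at_bot[of x]
  proof eventually_elim
    case (elim t)
    show ?case
    proof (rule DERIV_nonpos_imp_nonincreasing[OF elim])
      fix s assume "t \<le> s" "s \<le> x"
      thus "\<exists>y. (?h has_real_derivative y) (at s) \<and> y \<le> 0"
        using d[of s] x by (intro exI[of _ "- (std_normal_density s / s\<^sup>2)"]) auto
    qed
  qed
  moreover have "(?h \<longlongrightarrow> 0 + 0) at_bot"
  proof (intro tendsto_add Phi_at_bot)
    show "((\<lambda>t. std_normal_density t / t) \<longlongrightarrow> 0) at_bot"
      unfolding std_normal_density_def by real_asymp
  qed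
  ultimately have "?h x \<le> 0 + 0"
    by (intro tendsto_lowerbound[of _ _ at_bot]) auto
  thus ?thesis using x by (simp add: field_simps)
qed

lemma Mills_ratio':
  "0 \<le> std_normal_density x + x * Phi x"
  by (cases "x \<le> 0") (auto intro: Mills_ratio add_nonneg_nonneg)

text \<open>The Mills ratio \<open>(1 - Phi y) / std_normal_density y\<close> at
  \<open>y = - x\<close>. It solves \<open>f' = 1 + x * f\<close>, so multiples of it and of its
  reflection form the two branches of Stein's solution.\<close>

definition Phi_ratio :: "real \<Rightarrow> real" where
  "Phi_ratio x = Phi x / std_normal_density x"

lemma std_normal_density_pos [simp]: "std_normal_density x > 0" "std_normal_density x \<noteq> 0"
  using normal_density_pos[of 1 0 x] by auto

lemma Phi_ratio_deriv:
  "(Phi_ratio has_real_derivative 1 + x * Phi_ratio x) (at x)"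
  unfolding Phi_ratio_def
  by (rule derivative_eq_intros Phi_deriv std_normal_density_deriv refl)+
     (auto simp: field_simps power2_eq_square)

lemma Phi_ratio_nonneg: "0 \<le> Phi_ratio x"
  by (simp add: Phi_ratio_def less_imp_le)

lemma Phi_ratio_slope_nonneg: "0 \<le> 1 + x * Phi_ratio x"
  using Mills_ratio'[of x] unfolding Phi_ratio_def by (simp add: field_simps)

lemma Phi_ratio_mono: "x \<le> y \<Longrightarrow> Phi_ratio x \<le> Phi_ratio y"
  by (rule DERIV_nonneg_imp_nondecreasing[of x y]) (auto intro: Phi_ratio_deriv Phi_ratio_slope_nonneg)

text \<open>The value at 0 is \<open>sqrt (pi / 2)\<close>, about 1.253; \<open>4 / 3\<close> is a
  convenient rational above it.\<close>

lemma Phi_ratio_le: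
  assumes "x \<le> 0"
  shows "Phi_ratio x \<le> 4 / 3"
proof -
  have "Phi_ratio x \<le> Phi_ratio 0" by (rule Phi_ratio_mono[OF assms])
  also have "\<dots> = (1 / 2) / std_normal_density 0"
    by (simp only: Phi_ratio_def Phi_zero)
  also have "\<dots> = sqrt (2 * pi) / 2"
    by (simp add: std_normal_density_def)
  also have "\<dots> \<le> 4 / 3"
  proof -
    have "sqrt (2 * pi) \<le> 8 / 3"
      using pi_less_4 pi_approx by (intro real_le_lsqrt) (auto simp: power2_eq_square)
    thus ?thesis by simp
  qed
  finally show ?thesis .
qed

text \<open>For \<open>x \<le> 0\<close> the second factor is already small. For
  \<open>0 < x \<le> z\<close> the density at \<open>x\<close> is at least the one at
  \<open>z\<close>, and \<open>1 - Phi z\<close> over the density at \<open>z\<close> is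
  \<open>Phi_ratio (- z)\<close>, so both bounds reduce to the negative half-line.\<close>

lemma Phi_ratio_tail_bound:
  assumes "x \<le> z"
  shows "(1 - Phi z) * Phi_ratio x \<le> 4 / 3" and "(1 - Phi z) * (1 + x * Phi_ratio x) \<le> 1"
proof -
  have *: "(1 - Phi z) * Phi_ratio x \<le> Phi_ratio (- z)" if "0 < x"
  proof -
    have "Phi_ratio x \<le> 1 / std_normal_density z"
      unfolding Phi_ratio_def using that assms
      by (intro frac_le std_normal_density_bound) (auto intro: power_mono)
    hence "(1 - Phi z) * Phi_ratio x \<le> (1 - Phi z) * (1 / std_normal_density z)"
      by (intro mult_left_mono) auto
    thus ?thesis by (simp add: Phi_ratio_def Phi_minus)
  qed
  show "(1 - Phi z) * Phi_ratio x \<le> 4 / 3"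
  proof (cases "x \<le> 0")
    case True
    have "(1 - Phi z) * Phi_ratio x \<le> 1 * Phi_ratio x"
      using Phi_ratio_nonneg[of x] by (intro mult_right_mono) auto
    thus ?thesis using Phi_ratio_le[OF True] by simp
  next
    case False
    thus ?thesis using * Phi_ratio_le[of "- z"] assms by force
  qed
  show "(1 - Phi z) * (1 + x * Phi_ratio x) \<le> 1"
  proof (cases "x \<le> 0")
    case True
    have "1 + x * Phi_ratio x \<le> 1"
      using True Phi_ratio_nonneg[of x] by (simp add: mult_nonpos_nonneg)
    hence "(1 - Phi z) * (1 + x * Phi_ratio x) \<le> (1 - Phi z) * 1"
      by (intro mult_left_mono) auto
    also have "\<dots> \<le> 1" by simp
    finally show ?thesis .
  next
    case False
    have z: "0 < z" using False assms by simp
    have "x * Phi_ratio x \<le> z * (Phi z / std_normal_density z)"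
    proof (rule mult_mono)
      show "Phi_ratio x \<le> Phi z / std_normal_density z"
        unfolding Phi_ratio_def using False assms
        by (intro frac_le std_normal_density_bound Phi_mono) (auto intro: power_mono)
    qed (use False assms Phi_ratio_nonneg in auto)
    hence "(1 - Phi z) * (1 + x * Phi_ratio x) \<le> (1 - Phi z) * (1 + z * (Phi z / std_normal_density z))"
      by (intro mult_left_mono) auto
    also have "\<dots> = (1 - Phi z) + Phi z * (z * Phi_ratio (- z))"
      by (simp add: Phi_ratio_def Phi_minus field_simps)
    also have "\<dots> \<le> (1 - Phi z) + Phi z * 1"
      using Phi_ratio_slope_nonneg[of "- z"] by (intro add_left_mono mult_left_mono) auto
    finally show ?thesis by simp
  qed
qed

section \<open>The bounded solution of Stein's equation for a half-line\<close>

definition stein_sol :: "real \<Rightarrow> real \<Rightarrow> real" where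
  "stein_sol z x = (if x \<le> z then (1 - Phi z) * Phi_ratio x else Phi z * Phi_ratio (- x))"

text \<open>Stein's equation \<open>f' x - x * f x = of_bool (x \<le> z) - Phi z\<close>, solved for
  \<open>f' x\<close>. Defined in this way, it keeps the equation true at the kink
  \<open>x = z\<close>, where only one-sided derivatives exist and the value is the left
  one.\<close>

definition stein_der :: "real \<Rightarrow> real \<Rightarrow> real" where
  "stein_der z x = x * stein_sol z x + of_bool (x \<le> z) - Phi z"

text \<open>Reflecting both \<open>x\<close> and \<open>z\<close> in 0 exchanges the two branches,
  so the bound to the left of \<open>z\<close> yields the one to the right. The derivative has the
  same symmetry up to sign.\<close>

lemma stein_sol_bound: "\<bar>stein_sol z x\<bar> \<le> 4 / 3"
proof (cases "x \<le> z")
  case True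
  thus ?thesis using Phi_ratio_tail_bound(1)[OF True] Phi_ratio_nonneg[of x]
    by (simp add: stein_sol_def abs_mult)
next
  case False
  thus ?thesis using Phi_ratio_tail_bound(1)[of "-x" "-z"] Phi_ratio_nonneg[of "-x"]
    by (simp add: stein_sol_def abs_mult Phi_minus)
qed

lemma stein_der_bound: "\<bar>stein_der z x\<bar> \<le> 1"
proof (cases "x \<le> z")
  case True
  have "stein_der z x = (1 - Phi z) * (1 + x * Phi_ratio x)"
    using True by (simp add: stein_der_def stein_sol_def algebra_simps)
  thus ?thesis using Phi_ratio_tail_bound(2)[OF True] Phi_ratio_slope_nonneg[of x]
    by (simp add: abs_mult)
next
  case False
  have "stein_der z x = - ((1 - Phi (- z)) * (1 + (- x) * Phi_ratio (- x)))"
    using False by (simp add: stein_der_def stein_sol_def Phi_minus algebra_simps)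
  thus ?thesis using Phi_ratio_tail_bound(2)[of "-x" "-z"] Phi_ratio_slope_nonneg[of "-x"] False
    by (simp add: abs_mult)
qed

lemma stein_sol_deriv:
  assumes "x \<noteq> z"
  shows "(stein_sol z has_real_derivative stein_der z x) (at x)"
proof (cases "x < z")
  case True
  have "((\<lambda>x. (1 - Phi z) * Phi_ratio x) has_real_derivative stein_der z x) (at x)"
    using True by (auto intro!: derivative_eq_intros Phi_ratio_deriv
      simp: stein_der_def stein_sol_def algebra_simps)
  thus ?thesis
  proof (rule has_field_derivative_transform_within_open[of _ _ _ "{..<z}"])
    show "\<And>y. y \<in> {..<z} \<Longrightarrow> (1 - Phi z) * Phi_ratio y = stein_sol z y"
      by (auto simp: stein_sol_def)
  qed (use True in auto)
next
  case False
  hence x: "x > z" using assms by simp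
  have "((\<lambda>x. Phi_ratio (- x)) has_real_derivative - (1 + (- x) * Phi_ratio (- x))) (at x)"
    using DERIV_mirror[THEN iffD1, OF Phi_ratio_deriv[of "- x"]] by simp
  from DERIV_cmult[OF this, of "Phi z"]
  have "((\<lambda>x. Phi z * Phi_ratio (- x)) has_real_derivative stein_der z x) (at x)"
    using x by (simp add: stein_der_def stein_sol_def algebra_simps)
  thus ?thesis
  proof (rule has_field_derivative_transform_within_open[of _ _ _ "{z<..}"])
    show "\<And>y. y \<in> {z<..} \<Longrightarrow> Phi z * Phi_ratio (- y) = stein_sol z y"
      by (auto simp: stein_sol_def)
  qed (use x in auto)
qed

lemma Phi_ratio_continuous: "continuous_on A Phi_ratio"
  by (meson DERIV_continuous_on Phi_ratio_deriv has_field_derivative_at_within)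

lemma stein_sol_continuous: "continuous_on A (stein_sol z)"
  unfolding stein_sol_def
proof (rule continuous_on_cases_le)
  show "continuous_on {t \<in> A. z \<le> t} (\<lambda>x. Phi z * Phi_ratio (- x))"
    by (intro continuous_on_mult_left continuous_on_compose2[OF Phi_ratio_continuous[of UNIV]]
          continuous_intros) auto
  show "(1 - Phi z) * Phi_ratio t = Phi z * Phi_ratio (- t)" if "t = z" for t
    using that by (simp add: Phi_ratio_def Phi_minus)
qed (auto intro!: continuous_on_mult_left Phi_ratio_continuous)

text \<open>The mean value theorem cannot be applied across \<open>z\<close>, where Stein's solution
  has its kink, so the interval is cut there and the two increments are added.\<close>

lemma real_increment_bound_except:
  fixes F :: "real \<Rightarrow> real"
  assumes cont: "\<And>A. continuous_on A F" and "\<alpha> \<le> \<beta>"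
    and der: "\<And>x. x \<in> {\<alpha><..<\<beta>} \<Longrightarrow> x \<noteq> z \<Longrightarrow> \<exists>D. (F has_real_derivative D) (at x) \<and> \<bar>D\<bar> \<le> B"
  shows "\<bar>F \<beta> - F \<alpha>\<bar> \<le> B * (\<beta> - \<alpha>)"
proof -
  have *: "\<bar>F d - F c\<bar> \<le> B * (d - c)" if "\<alpha> \<le> c" "c \<le> d" "d \<le> \<beta>" "z \<notin> {c<..<d}" for c d
  proof (cases "c = d")
    case False
    hence cd: "c < d" using that by simp
    have "\<exists>l x. c < x \<and> x < d \<and> (F has_real_derivative l) (at x) \<and> F d - F c = (d - c) * l"
    proof (rule MVT[OF cd cont])
      fix x assume "c < x" "x < d"
      thus "F differentiable (at x)"
        using der[of x] that by (force simp: real_differentiable_def)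
    qed
    then obtain l x where x: "c < x" "x < d" "(F has_real_derivative l) (at x)" "F d - F c = (d - c) * l"
      by blast
    have "x \<in> {\<alpha><..<\<beta>}" "x \<noteq> z" using x that by auto
    then obtain D where "(F has_real_derivative D) (at x)" "\<bar>D\<bar> \<le> B" using der by blast
    with DERIV_unique[OF x(3)] have "\<bar>l\<bar> \<le> B" by simp
    thus ?thesis using x cd by (simp add: abs_mult mult.commute mult_left_mono)
  qed simp
  show ?thesis
  proof (cases "z \<in> {\<alpha><..<\<beta>}")
    case True
    from *[of \<alpha> z] *[of z \<beta>] True show ?thesis by (simp add: algebra_simps)
  next
    case False
    thus ?thesis using *[of \<alpha> \<beta>] assms(2) by simp
  qed
qed

lemma stein_sol_lipschitz: "\<bar>stein_sol z x - stein_sol z y\<bar> \<le> \<bar>x - y\<bar>"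
proof (induction x y rule: linorder_wlog)
  case (le x y)
  have "\<bar>stein_sol z y - stein_sol z x\<bar> \<le> 1 * (y - x)"
  proof (rule real_increment_bound_except[where z = z, OF stein_sol_continuous le])
    fix t assume "t \<noteq> z"
    from stein_sol_deriv[OF this] stein_der_bound[of z t]
    show "\<exists>D. (stein_sol z has_real_derivative D) (at t) \<and> \<bar>D\<bar> \<le> 1" by (intro exI conjI)
  qed
  thus ?case using le by (simp add: abs_minus_commute)
next
  case (sym x y)
  thus ?case by (simp add: abs_minus_commute)
qed

text \<open>The reference point \<open>w\<close> will be the statistic without a few indices, whose
  size and closeness to \<open>z\<close> can be bounded conditionally. The smooth part of the
  derivative varies by a multiple of \<open>N\<close>; a jump requires \<open>z\<close> between
  \<open>x\<close> and \<open>y\<close>, hence within \<open>N\<close> of \<open>w\<close>.\<close>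

lemma stein_der_diff:
  assumes "\<bar>x - w\<bar> \<le> N" "\<bar>y - w\<bar> \<le> N"
  shows "\<bar>stein_der z x - stein_der z y\<bar> \<le> 2 * N * (\<bar>w\<bar> + 4 / 3) + of_bool (\<bar>w - z\<bar> \<le> N)"
proof -
  let ?f = "stein_sol z"
  have 1: "\<bar>w * (?f x - ?f y)\<bar> \<le> \<bar>w\<bar> * (2 * N)"
    unfolding abs_mult using assms stein_sol_lipschitz[of z x y] by (intro mult_left_mono) linarith+
  have 2: "\<bar>t * ?f s\<bar> \<le> N * (4 / 3)" if "\<bar>t\<bar> \<le> N" for s t
    unfolding abs_mult using that by (intro mult_mono stein_sol_bound) auto
  note 1
  moreover from 2[OF assms(1), of x] 2[OF assms(2), of y]
  have "\<bar>(x - w) * ?f x\<bar> \<le> N * (4 / 3)" "\<bar>(y - w) * ?f y\<bar> \<le> N * (4 / 3)" .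
  moreover have "\<bar>of_bool (x \<le> z) - of_bool (y \<le> z)\<bar> \<le> (of_bool (\<bar>w - z\<bar> \<le> N) :: real)"
    using assms by (auto simp: abs_le_iff)
  moreover have "stein_der z x - stein_der z y =
     w * (?f x - ?f y) + (x - w) * ?f x - (y - w) * ?f y + (of_bool (x \<le> z) - of_bool (y \<le> z))"
    by (simp add: stein_der_def algebra_simps)
  moreover have "2 * N * (\<bar>w\<bar> + 4 / 3) = \<bar>w\<bar> * (2 * N) + N * (4 / 3) + N * (4 / 3)"
    by (simp add: algebra_simps)
  ultimately show ?thesis by linarith
qed

text \<open>Subtracting the line of slope \<open>stein_der z y\<close> from Stein's solution leaves
  a function with derivative \<open>stein_der z x - stein_der z y\<close>. The slope is taken at a
  third point because decoupling evaluates it at a rearranged permutation.\<close>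

lemma stein_sol_increment:
  assumes "\<bar>x1 - w\<bar> \<le> N" "\<bar>x2 - w\<bar> \<le> N" "\<bar>y - w\<bar> \<le> N"
  shows "\<bar>stein_sol z x1 - stein_sol z x2 - (x1 - x2) * stein_der z y\<bar>
    \<le> \<bar>x1 - x2\<bar> * (2 * N * (\<bar>w\<bar> + 4 / 3) + of_bool (\<bar>w - z\<bar> \<le> N))"
  using assms(1,2)
proof (induction x1 x2 rule: linorder_wlog)
  case (le x1 x2)
  let ?B = "2 * N * (\<bar>w\<bar> + 4 / 3) + of_bool (\<bar>w - z\<bar> \<le> N)"
  let ?F = "\<lambda>x. stein_sol z x - x * stein_der z y"
  have "\<bar>?F x2 - ?F x1\<bar> \<le> ?B * (x2 - x1)"
  proof (rule real_increment_bound_except[where z = z, OF _ le(1)])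
    fix x assume x: "x \<in> {x1<..<x2}" "x \<noteq> z"
    have "(?F has_real_derivative (stein_der z x - stein_der z y)) (at x)"
      by (auto intro!: derivative_eq_intros stein_sol_deriv x)
    moreover have "\<bar>stein_der z x - stein_der z y\<bar> \<le> ?B"
      using le x assms(3) by (intro stein_der_diff) (auto simp: abs_le_iff)
    ultimately show "\<exists>D. (?F has_real_derivative D) (at x) \<and> \<bar>D\<bar> \<le> ?B" by (intro exI conjI)
  qed (intro continuous_intros stein_sol_continuous)
  moreover have "stein_sol z x1 - stein_sol z x2 - (x1 - x2) * stein_der z y = - (?F x2 - ?F x1)"
    by (simp add: algebra_simps)
  ultimately show ?case using le(1)
    by (metis abs_minus_cancel abs_minus_commute abs_of_nonneg diff_ge_0_iff_ge mult.commute)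
next
  case (sym x1 x2)
  have "stein_sol z x1 - stein_sol z x2 - (x1 - x2) * stein_der z y =
     - (stein_sol z x2 - stein_sol z x1 - (x2 - x1) * stein_der z y)" by (simp add: algebra_simps)
  thus ?case using sym by (metis abs_minus_cancel abs_minus_commute)
qed

section \<open>Averages over permutations\<close>

definition perm_avg :: "'i set \<Rightarrow> (('i \<Rightarrow> 'i) \<Rightarrow> real) \<Rightarrow> real" where
  "perm_avg S F = (\<Sum>\<pi> | \<pi> permutes S. F \<pi>) / fact (card S)"

text \<open>For \<open>K \<subseteq> S\<close> this says that \<open>F \<pi>\<close> depends only on
  the values of \<open>\<pi>\<close> on \<open>K\<close>: the permutations agreeing with
  \<open>\<pi>\<close> there are exactly the \<open>\<pi> \<circ> \<tau>\<close>. Averages with such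
  a weight stand in for conditional expectations.\<close>

definition stable_off :: "'i set \<Rightarrow> 'i set \<Rightarrow> (('i \<Rightarrow> 'i) \<Rightarrow> 'b) \<Rightarrow> bool" where
  "stable_off S K F \<longleftrightarrow> (\<forall>\<pi> \<tau>. \<pi> permutes S \<longrightarrow> \<tau> permutes (S - K) \<longrightarrow> F (\<pi> \<circ> \<tau>) = F \<pi>)"

lemma stable_offD:
  "stable_off S K F \<Longrightarrow> \<pi> permutes S \<Longrightarrow> \<tau> permutes (S - K) \<Longrightarrow> F (\<pi> \<circ> \<tau>) = F \<pi>"
  by (simp add: stable_off_def)

lemma stable_off_const: "stable_off S K (\<lambda>\<pi>. c)"
  by (simp add: stable_off_def)

lemma stable_off_eval: "k \<in> K \<Longrightarrow> stable_off S K (\<lambda>\<pi>. f (\<pi> k))"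
  unfolding stable_off_def by (metis DiffD2 comp_apply permutes_not_in)

lemma stable_off_comp2:
  "stable_off S K F \<Longrightarrow> stable_off S K G \<Longrightarrow> stable_off S K (\<lambda>\<pi>. h (F \<pi>) (G \<pi>))"
  by (simp add: stable_off_def)

lemma stable_off_comp: "stable_off S K F \<Longrightarrow> stable_off S K (\<lambda>\<pi>. h (F \<pi>))"
  by (simp add: stable_off_def)

lemma stable_off_mono: "stable_off S K F \<Longrightarrow> K \<subseteq> K' \<Longrightarrow> stable_off S K' F"
  unfolding stable_off_def by (meson Diff_mono permutes_subset subset_refl)

lemma exists_perm_two_points:
  assumes "i \<in> A" "j \<in> A" "k \<in> A" "l \<in> A" "i \<noteq> j" "k \<noteq> l"
  obtains \<tau> where "\<tau> permutes A" "\<tau> k = i" "\<tau> l = j"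
proof
  let ?s = "Transposition.transpose k i"
  have *: "?s l \<in> A" "?s l \<noteq> i"
    using assms by (auto simp: Transposition.transpose_def)
  show "(Transposition.transpose (?s l) j \<circ> ?s) permutes A"
    using assms * by (intro permutes_compose permutes_swap_id)
  show "(Transposition.transpose (?s l) j \<circ> ?s) k = i"
    using assms * by simp
  show "(Transposition.transpose (?s l) j \<circ> ?s) l = j"
    by simp
qed

text \<open>A degree bound for a graph on \<open>P\<close>: each \<open>x p\<close> is counted once
  per neighbour of \<open>p\<close>, half from either end of the edge.\<close>

lemma sum_symmetric_relation_le:
  fixes x :: "'p \<Rightarrow> real"
  assumes "finite P" "\<And>p. p \<in> P \<Longrightarrow> 0 \<le> x p"
    and sym: "\<And>p q. R p q \<longleftrightarrow> R q p"
    and card: "\<And>p. p \<in> P \<Longrightarrow> real (card {q \<in> P. R p q}) \<le> c"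
  shows "(\<Sum>p\<in>P. \<Sum>q\<in>P. of_bool (R p q) * ((x p + x q) / 2)) \<le> c * (\<Sum>p\<in>P. x p)"
proof -
  let ?s = "\<Sum>p\<in>P. \<Sum>q\<in>P. of_bool (R p q) * x p"
  have "(\<Sum>p\<in>P. \<Sum>q\<in>P. of_bool (R p q) * x q) = (\<Sum>q\<in>P. \<Sum>p\<in>P. of_bool (R p q) * x q)"
    by (rule sum.swap)
  also have "\<dots> = ?s"
    by (intro sum.cong refl) (simp add: sym)
  finally have "(\<Sum>p\<in>P. \<Sum>q\<in>P. of_bool (R p q) * ((x p + x q) / 2)) = ?s"
    by (simp add: distrib_left add_divide_distrib sum.distrib flip: sum_divide_distrib)
  also have "\<dots> = (\<Sum>p\<in>P. real (card {q \<in> P. R p q}) * x p)"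
    using assms(1) by (intro sum.cong refl) (simp add: sum_distrib_right[symmetric] Int_def)
  also have "\<dots> \<le> (\<Sum>p\<in>P. c * x p)"
    by (intro sum_mono mult_right_mono card assms(2))
  finally show ?thesis by (simp add: sum_distrib_left)
qed

locale perm_array =
  fixes S :: "'i set" and a b :: "'i \<Rightarrow> real"
  assumes fin: "finite S"
begin

abbreviation E :: "(('i \<Rightarrow> 'i) \<Rightarrow> real) \<Rightarrow> real" where "E \<equiv> perm_avg S"

lemma E_const [simp]: "E (\<lambda>_. c) = c"
  using card_permutations[OF refl fin] by (simp add: perm_avg_def)

lemma E_add: "E (\<lambda>\<pi>. F \<pi> + G \<pi>) = E F + E G"
  by (simp add: perm_avg_def sum.distrib add_divide_distrib)

lemma E_diff: "E (\<lambda>\<pi>. F \<pi> - G \<pi>) = E F - E G"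
  by (simp add: perm_avg_def sum_subtractf diff_divide_distrib)

lemma E_cmult: "E (\<lambda>\<pi>. c * F \<pi>) = c * E F"
  by (simp add: perm_avg_def sum_distrib_left)

lemma E_minus: "E (\<lambda>\<pi>. - F \<pi>) = - E F"
  using E_cmult[of "-1" F] by simp

lemma E_sum: "E (\<lambda>\<pi>. \<Sum>x\<in>A. F x \<pi>) = (\<Sum>x\<in>A. E (F x))"
  unfolding perm_avg_def by (subst sum.swap) (simp add: sum_divide_distrib)

lemma E_cong: "(\<And>\<pi>. \<pi> permutes S \<Longrightarrow> F \<pi> = G \<pi>) \<Longrightarrow> E F = E G"
  by (simp add: perm_avg_def)

lemma E_mono: "(\<And>\<pi>. \<pi> permutes S \<Longrightarrow> F \<pi> \<le> G \<pi>) \<Longrightarrow> E F \<le> E G"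
  by (auto simp: perm_avg_def intro!: divide_right_mono sum_mono)

lemma E_nonneg: "(\<And>\<pi>. \<pi> permutes S \<Longrightarrow> 0 \<le> F \<pi>) \<Longrightarrow> 0 \<le> E F"
  using E_mono[of "\<lambda>_. 0" F] by simp

lemma E_abs: "\<bar>E F\<bar> \<le> E (\<lambda>\<pi>. \<bar>F \<pi>\<bar>)"
  by (auto simp: perm_avg_def abs_divide intro!: divide_right_mono sum_abs)

lemma E_comp: "\<tau> permutes S \<Longrightarrow> E (\<lambda>\<pi>. F (\<pi> \<circ> \<tau>)) = E F"
  unfolding perm_avg_def by (subst sum_permutations_compose_right[of \<tau> S F]) auto

section \<open>Averages with a weight that is stable off \<open>K\<close>\<close>

lemma sum_over_perm: "\<pi> permutes S \<Longrightarrow> (\<Sum>i\<in>S. f (\<pi> i)) = (\<Sum>i\<in>S. f i)"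
  using sum.permute[of \<pi> S f] by simp

lemma sum2_over_perm:
  "\<pi> permutes S \<Longrightarrow> (\<Sum>i\<in>S. \<Sum>j\<in>S. h (\<pi> i) (\<pi> j)) = (\<Sum>i\<in>S. \<Sum>j\<in>S. h i j)"
  using sum_over_perm[of \<pi> "\<lambda>p. \<Sum>j\<in>S. h p (\<pi> j)"] sum_over_perm[of \<pi> "h _"] by simp

text \<open>Permutations of \<open>S - K\<close> fix the weight and carry \<open>(i, j)\<close> to
  any other pair of distinct indices outside \<open>K\<close>, so all \<open>r * (r - 1)\<close>
  ordered pairs have the same weighted average; diagonal pairs contribute 0.\<close>

lemma E_stable_pair:
  fixes h :: "'i \<Rightarrow> 'i \<Rightarrow> real"
  assumes "stable_off S K w" "i \<in> S - K" "j \<in> S - K" "i \<noteq> j" "\<And>p. h p p = 0"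
  defines "r \<equiv> real (card (S - K))"
  shows "r * (r - 1) * E (\<lambda>\<pi>. w \<pi> * h (\<pi> i) (\<pi> j)) =
    E (\<lambda>\<pi>. w \<pi> * (\<Sum>k\<in>S - K. \<Sum>l\<in>S - K. h (\<pi> k) (\<pi> l)))"
proof -
  let ?A = "S - K" and ?c = "E (\<lambda>\<pi>. w \<pi> * h (\<pi> i) (\<pi> j))"
  have *: "E (\<lambda>\<pi>. w \<pi> * h (\<pi> k) (\<pi> l)) = (if k = l then 0 else ?c)" if kl: "k \<in> ?A" "l \<in> ?A" for k l
  proof (cases "k = l")
    case False
    obtain \<tau> where \<tau>: "\<tau> permutes ?A" "\<tau> k = i" "\<tau> l = j"
      using exists_perm_two_points[OF assms(2,3) kl assms(4) False] .
    have \<tau>S: "\<tau> permutes S" using \<tau>(1) by (rule permutes_subset) auto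
    have "?c = E (\<lambda>\<pi>. w \<pi> * h ((\<pi> \<circ> \<tau>) k) ((\<pi> \<circ> \<tau>) l))"
      by (simp add: \<tau>)
    also have "\<dots> = E (\<lambda>\<pi>. w (\<pi> \<circ> \<tau>) * h ((\<pi> \<circ> \<tau>) k) ((\<pi> \<circ> \<tau>) l))"
      by (intro E_cong) (simp only: stable_offD[OF assms(1) _ \<tau>(1)])
    also have "\<dots> = E (\<lambda>\<pi>. w \<pi> * h (\<pi> k) (\<pi> l))"
      by (rule E_comp[OF \<tau>S])
    finally show ?thesis using False by simp
  qed (simp add: assms(5))
  have "E (\<lambda>\<pi>. w \<pi> * (\<Sum>k\<in>?A. \<Sum>l\<in>?A. h (\<pi> k) (\<pi> l))) = (\<Sum>k\<in>?A. \<Sum>l\<in>?A. E (\<lambda>\<pi>. w \<pi> * h (\<pi> k) (\<pi> l)))"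
    by (simp add: sum_distrib_left E_sum)
  also have "\<dots> = (\<Sum>k\<in>?A. \<Sum>l\<in>?A. if k = l then 0 else ?c)"
    by (intro sum.cong refl *)
  also have "\<dots> = (\<Sum>k\<in>?A. (r - 1) * ?c)"
  proof (intro sum.cong refl)
    fix k assume k: "k \<in> ?A"
    have "(\<Sum>l\<in>?A. if k = l then 0 else ?c) = (\<Sum>l\<in>?A. ?c - (if k = l then ?c else 0))"
      by (intro sum.cong) auto
    also have "\<dots> = (r - 1) * ?c"
      using k fin by (simp add: sum_subtractf r_def algebra_simps)
    finally show "(\<Sum>l\<in>?A. if k = l then 0 else ?c) = (r - 1) * ?c" .
  qed
  also have "\<dots> = r * (r - 1) * ?c" by (simp add: r_def)
  finally show ?thesis by simp
qed

text \<open>Once the double sum is enlarged from \<open>S - K\<close> to \<open>S\<close>, it no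
  longer depends on \<open>\<pi>\<close> and leaves the average.\<close>

lemma E_stable_pair_le:
  fixes h :: "'i \<Rightarrow> 'i \<Rightarrow> real"
  assumes "stable_off S K w" "\<And>\<pi>. \<pi> permutes S \<Longrightarrow> 0 \<le> w \<pi>"
    and "i \<in> S - K" "j \<in> S - K" "i \<noteq> j" "\<And>p. h p p = 0" "\<And>p q. 0 \<le> h p q"
  defines "r \<equiv> real (card (S - K))"
  shows "r * (r - 1) * E (\<lambda>\<pi>. w \<pi> * h (\<pi> i) (\<pi> j)) \<le> (\<Sum>p\<in>S. \<Sum>q\<in>S. h p q) * E w"
proof -
  have "E (\<lambda>\<pi>. w \<pi> * (\<Sum>k\<in>S - K. \<Sum>l\<in>S - K. h (\<pi> k) (\<pi> l))) \<le>
        E (\<lambda>\<pi>. (\<Sum>p\<in>S. \<Sum>q\<in>S. h p q) * w \<pi>)"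
  proof (rule E_mono)
    fix \<pi> assume \<pi>: "\<pi> permutes S"
    have "(\<Sum>k\<in>S - K. \<Sum>l\<in>S - K. h (\<pi> k) (\<pi> l)) \<le> (\<Sum>k\<in>S. \<Sum>l\<in>S. h (\<pi> k) (\<pi> l))"
      using fin assms(7) by (intro order.trans[OF sum_mono sum_mono2] sum_mono2 sum_nonneg) auto
    also have "\<dots> = (\<Sum>p\<in>S. \<Sum>q\<in>S. h p q)" by (rule sum2_over_perm[OF \<pi>])
    finally show "w \<pi> * (\<Sum>k\<in>S - K. \<Sum>l\<in>S - K. h (\<pi> k) (\<pi> l)) \<le> (\<Sum>p\<in>S. \<Sum>q\<in>S. h p q) * w \<pi>"
      using assms(2)[OF \<pi>] by (simp add: mult.commute mult_left_mono)
  qed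
  thus ?thesis
    using E_stable_pair[where h = h, OF assms(1,3-6)] by (simp add: r_def E_cmult)
qed

text \<open>The full double sum exceeds the one over \<open>S - K\<close> by the pairs that meet
  \<open>K\<close>: at most \<open>2 * card K * card S\<close> terms, each at most
  \<open>B\<close>.\<close>

lemma E_stable_pair_ge:
  fixes h :: "'i \<Rightarrow> 'i \<Rightarrow> real"
  assumes "stable_off S K w" "\<And>\<pi>. \<pi> permutes S \<Longrightarrow> 0 \<le> w \<pi>" "K \<subseteq> S"
    and "i \<in> S - K" "j \<in> S - K" "i \<noteq> j" "\<And>p. h p p = 0" "\<And>p q. 0 \<le> h p q" "\<And>p q. h p q \<le> B"
  defines "r \<equiv> real (card (S - K))"
  shows "((\<Sum>p\<in>S. \<Sum>q\<in>S. h p q) - 2 * real (card K) * real (card S) * B) * E w \<le>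
    r * (r - 1) * E (\<lambda>\<pi>. w \<pi> * h (\<pi> i) (\<pi> j))"
proof -
  let ?C = "(\<Sum>p\<in>S. \<Sum>q\<in>S. h p q) - 2 * real (card K) * real (card S) * B"
  have finK: "finite K" using assms(3) fin by (rule finite_subset)
  have "E (\<lambda>\<pi>. ?C * w \<pi>) \<le> E (\<lambda>\<pi>. w \<pi> * (\<Sum>k\<in>S - K. \<Sum>l\<in>S - K. h (\<pi> k) (\<pi> l)))"
  proof (rule E_mono)
    fix \<pi> assume \<pi>: "\<pi> permutes S"
    let ?g = "\<lambda>k l. h (\<pi> k) (\<pi> l)"
    have "(\<Sum>k\<in>S. \<Sum>l\<in>S. ?g k l) = (\<Sum>k\<in>S - K. \<Sum>l\<in>S. ?g k l) + (\<Sum>k\<in>K. \<Sum>l\<in>S. ?g k l)"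
      using sum.subset_diff[OF assms(3) fin] .
    also have "(\<Sum>k\<in>S - K. \<Sum>l\<in>S. ?g k l) = (\<Sum>k\<in>S - K. \<Sum>l\<in>S - K. ?g k l) + (\<Sum>k\<in>S - K. \<Sum>l\<in>K. ?g k l)"
      by (simp add: sum.subset_diff[OF assms(3) fin] sum.distrib)
    also have "(\<Sum>k\<in>S - K. \<Sum>l\<in>K. ?g k l) \<le> (\<Sum>k\<in>S. \<Sum>l\<in>K. ?g k l)"
      using fin assms(8) by (intro sum_mono2 sum_nonneg) auto
    also have "\<dots> \<le> (\<Sum>k\<in>S. \<Sum>l\<in>K. B)" by (intro sum_mono assms(9))
    also have "(\<Sum>k\<in>K. \<Sum>l\<in>S. ?g k l) \<le> (\<Sum>k\<in>K. \<Sum>l\<in>S. B)" by (intro sum_mono assms(9))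
    finally have "?C \<le> (\<Sum>k\<in>S - K. \<Sum>l\<in>S - K. ?g k l)"
      unfolding sum2_over_perm[OF \<pi>] by (simp add: algebra_simps)
    thus "?C * w \<pi> \<le> w \<pi> * (\<Sum>k\<in>S - K. \<Sum>l\<in>S - K. ?g k l)"
      using assms(2)[OF \<pi>] by (simp add: mult.commute[of ?C] mult_left_mono)
  qed
  thus ?thesis
    using E_stable_pair[where h = h, OF assms(1,4-7)] by (simp add: r_def E_cmult)
qed

section \<open>Swaps of two values and antisymmetric sums\<close>

definition D :: "'i \<Rightarrow> 'i \<Rightarrow> ('i \<Rightarrow> 'i) \<Rightarrow> real" where
  "D i j \<pi> = (a i - a j) * (b (\<pi> i) - b (\<pi> j))"

definition W :: "'i set \<Rightarrow> ('i \<Rightarrow> 'i) \<Rightarrow> real" where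
  "W A \<pi> = (\<Sum>m\<in>A. a m * b (\<pi> m))"

lemma D_refl [simp]: "D i i \<pi> = 0"
  by (simp add: D_def)

lemma W_transpose:
  assumes "finite A" "i \<in> A" "j \<in> A"
  shows "W A (\<pi> \<circ> Transposition.transpose i j) = W A \<pi> - D i j \<pi>"
proof (cases "i = j")
  case False
  let ?t = "Transposition.transpose i j"
  have "W A (\<pi> \<circ> ?t) - W A \<pi> = (\<Sum>m\<in>A. a m * (b (\<pi> (?t m)) - b (\<pi> m)))"
    by (simp add: W_def sum_subtractf algebra_simps)
  also have "\<dots> = (\<Sum>m\<in>{i, j}. a m * (b (\<pi> (?t m)) - b (\<pi> m)))"
    using assms by (intro sum.mono_neutral_right) auto
  also have "\<dots> = - D i j \<pi>"
    using False by (simp add: D_def algebra_simps)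
  finally show ?thesis by simp
qed simp

lemma D_transpose: "D i j (\<pi> \<circ> Transposition.transpose i j) = - D i j \<pi>"
  by (simp add: D_def algebra_simps)

lemma D_transpose_other:
  "k \<notin> {i, j} \<Longrightarrow> l \<notin> {i, j} \<Longrightarrow> D k l (\<pi> \<circ> Transposition.transpose i j) = D k l \<pi>"
  by (simp add: D_def)

lemma stable_off_D: "i \<in> K \<Longrightarrow> j \<in> K \<Longrightarrow> stable_off S K (D i j)"
  unfolding D_def by (intro stable_off_comp2[where h = "\<lambda>x y. c * (x - y)" for c] stable_off_eval)

definition overlap :: "'i \<times> 'i \<Rightarrow> 'i \<times> 'i \<Rightarrow> bool" where
  "overlap p q \<longleftrightarrow> {fst p, snd p} \<inter> {fst q, snd q} \<noteq> {}"

lemma card_overlap: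
  assumes "finite A"
  shows "card {q \<in> A \<times> A. overlap p q} \<le> 4 * card A"
proof -
  let ?P = "{fst p, snd p}"
  have "{q \<in> A \<times> A. overlap p q} \<subseteq> ?P \<times> A \<union> A \<times> ?P"
    by (auto simp: overlap_def)
  hence "card {q \<in> A \<times> A. overlap p q} \<le> card (?P \<times> A \<union> A \<times> ?P)"
    using assms by (intro card_mono) auto
  also have "\<dots> \<le> card (?P \<times> A) + card (A \<times> ?P)" by (rule card_Un_le)
  also have "\<dots> \<le> 4 * card A"
    using card_insert_le_m1[of 2 "{snd p}" "fst p"] by (simp add: card_cartesian_product card_insert_if)
  finally show ?thesis .
qed

text \<open>For pairs without a common index, swapping the indices of the first pair negates its
  factor and fixes both the other factor and the weight, so the mixed average vanishes. Each pair
  overlaps at most \<open>4 * card A\<close> others, and there the product is bounded by half the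
  sum of squares.\<close>

lemma E_antisym_sum_sq:
  assumes "stable_off S K w" "\<And>\<pi>. \<pi> permutes S \<Longrightarrow> 0 \<le> w \<pi>"
    and odd: "\<And>x. \<phi> (- x) = - \<phi> x"
  defines "A \<equiv> S - K"
  shows "E (\<lambda>\<pi>. w \<pi> * (\<Sum>i\<in>A. \<Sum>j\<in>A. \<phi> (D i j \<pi>))\<^sup>2) \<le>
    4 * real (card A) * (\<Sum>i\<in>A. \<Sum>j\<in>A. E (\<lambda>\<pi>. w \<pi> * (\<phi> (D i j \<pi>))\<^sup>2))"
proof -
  have finA: "finite A" using fin by (simp add: A_def)
  let ?f = "\<lambda>p \<pi>. \<phi> (D (fst p) (snd p) \<pi>)"
  let ?e = "\<lambda>p. E (\<lambda>\<pi>. w \<pi> * (?f p \<pi>)\<^sup>2)"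
  have pq: "E (\<lambda>\<pi>. w \<pi> * (?f p \<pi> * ?f q \<pi>)) \<le> of_bool (overlap p q) * ((?e p + ?e q) / 2)"
    if "p \<in> A \<times> A" "q \<in> A \<times> A" for p q
  proof (cases "overlap p q")
    case True
    have "E (\<lambda>\<pi>. w \<pi> * (?f p \<pi> * ?f q \<pi>)) \<le> E (\<lambda>\<pi>. (1/2) * (w \<pi> * (?f p \<pi>)\<^sup>2 + w \<pi> * (?f q \<pi>)\<^sup>2))"
    proof (rule E_mono)
      fix \<pi> assume "\<pi> permutes S"
      hence "w \<pi> * (?f p \<pi> * ?f q \<pi>) \<le> w \<pi> * ((1/2) * ((?f p \<pi>)\<^sup>2 + (?f q \<pi>)\<^sup>2))"
        using sum_squares_bound[of "?f p \<pi>" "?f q \<pi>"] by (intro mult_left_mono assms(2)) auto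
      thus "w \<pi> * (?f p \<pi> * ?f q \<pi>) \<le> (1/2) * (w \<pi> * (?f p \<pi>)\<^sup>2 + w \<pi> * (?f q \<pi>)\<^sup>2)"
        by (simp add: algebra_simps)
    qed
    thus ?thesis using True unfolding E_cmult E_add by simp
  next
    case False
    obtain i j where p: "p = (i, j)" by (cases p)
    obtain k l where q: "q = (k, l)" by (cases q)
    let ?t = "Transposition.transpose i j"
    have t: "?t permutes S - K" using that p by (intro permutes_swap_id) (auto simp: A_def)
    have tS: "?t permutes S" using t by (rule permutes_subset) auto
    have "E (\<lambda>\<pi>. w \<pi> * (?f p \<pi> * ?f q \<pi>)) = E (\<lambda>\<pi>. w (\<pi> \<circ> ?t) * (?f p (\<pi> \<circ> ?t) * ?f q (\<pi> \<circ> ?t)))"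
      by (rule E_comp[OF tS, symmetric])
    also have "\<dots> = E (\<lambda>\<pi>. - (w \<pi> * (?f p \<pi> * ?f q \<pi>)))"
    proof (rule E_cong)
      fix \<pi> assume \<pi>: "\<pi> permutes S"
      have 1: "w (\<pi> \<circ> ?t) = w \<pi>" by (rule stable_offD[OF assms(1) \<pi> t])
      have 2: "?f p (\<pi> \<circ> ?t) = - ?f p \<pi>" by (simp only: p fst_conv snd_conv D_transpose odd)
      have 3: "?f q (\<pi> \<circ> ?t) = ?f q \<pi>"
        using False by (subst D_transpose_other) (auto simp: overlap_def p q)
      show "w (\<pi> \<circ> ?t) * (?f p (\<pi> \<circ> ?t) * ?f q (\<pi> \<circ> ?t)) = - (w \<pi> * (?f p \<pi> * ?f q \<pi>))"
        unfolding 1 2 3 by simp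
    qed
    also have "\<dots> = - E (\<lambda>\<pi>. w \<pi> * (?f p \<pi> * ?f q \<pi>))" by (rule E_minus)
    finally show ?thesis using False by simp
  qed
  have "E (\<lambda>\<pi>. w \<pi> * (\<Sum>i\<in>A. \<Sum>j\<in>A. \<phi> (D i j \<pi>))\<^sup>2) = E (\<lambda>\<pi>. w \<pi> * (\<Sum>p\<in>A \<times> A. ?f p \<pi>)\<^sup>2)"
    by (simp add: sum.cartesian_product case_prod_beta)
  also have "\<dots> = (\<Sum>p\<in>A \<times> A. \<Sum>q\<in>A \<times> A. E (\<lambda>\<pi>. w \<pi> * (?f p \<pi> * ?f q \<pi>)))"
    unfolding power2_eq_square sum_product by (simp add: sum_distrib_left E_sum)
  also have "\<dots> \<le> (\<Sum>p\<in>A \<times> A. \<Sum>q\<in>A \<times> A. of_bool (overlap p q) * ((?e p + ?e q) / 2))"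
    by (intro sum_mono pq)
  also have "\<dots> \<le> (4 * real (card A)) * (\<Sum>p\<in>A \<times> A. ?e p)"
  proof (rule sum_symmetric_relation_le)
    show "overlap p q \<longleftrightarrow> overlap q p" for p q by (auto simp: overlap_def)
    show "real (card {q \<in> A \<times> A. overlap p q}) \<le> 4 * real (card A)" for p
      using card_overlap[OF finA, of p] by linarith
  qed (use finA assms(2) in \<open>auto intro!: E_nonneg\<close>)
  also have "(\<Sum>p\<in>A \<times> A. ?e p) = (\<Sum>i\<in>A. \<Sum>j\<in>A. E (\<lambda>\<pi>. w \<pi> * (\<phi> (D i j \<pi>))\<^sup>2))"
    by (simp add: sum.cartesian_product case_prod_beta)
  finally show ?thesis .
qed

end

section \<open>Normalized arrays\<close>

definition clip :: "real \<Rightarrow> real \<Rightarrow> real" where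
  "clip c x = max (- c) (min c x)"

lemma clip_minus: "0 \<le> c \<Longrightarrow> clip c (- x) = - clip c x"
  by (auto simp: clip_def max_def min_def)

lemma abs_clip_le: "0 \<le> c \<Longrightarrow> \<bar>clip c x\<bar> \<le> c"
  by (auto simp: clip_def max_def min_def)

lemma clip_sq: "0 \<le> c \<Longrightarrow> (clip c x)\<^sup>2 = min (x\<^sup>2) (c\<^sup>2)"
proof -
  assume c: "0 \<le> c"
  have "\<bar>clip c x\<bar> = min \<bar>x\<bar> c" using c by (auto simp: clip_def max_def min_def)
  hence "(clip c x)\<^sup>2 = (min \<bar>x\<bar> c)\<^sup>2" by (metis power2_abs)
  also have "\<dots> = min (x\<^sup>2) (c\<^sup>2)"
    using c by (auto simp: min_def abs_le_square_iff[symmetric])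
  finally show ?thesis .
qed

lemma clip_mono: "x \<le> y \<Longrightarrow> clip c x \<le> clip c y"
  by (auto simp: clip_def max_def min_def)

lemma clip_increment_nonneg:
  assumes "0 \<le> l"
  shows "0 \<le> clip l d * (clip c x - clip c (x - d))"
proof (cases "0 \<le> d")
  case True
  thus ?thesis using assms clip_mono[of "x - d" x c]
    by (intro mult_nonneg_nonneg) (auto simp: clip_def)
next
  case False
  thus ?thesis using assms clip_mono[of x "x - d" c]
    by (intro mult_nonpos_nonpos) (auto simp: clip_def)
qed

text \<open>From \<open>x\<close> in \<open>[- L, L]\<close> a step of length at most
  \<open>l\<close> stays where \<open>clip (L + l)\<close> is the identity, and a longer step still
  moves the clipped value by at least \<open>l\<close> in the same direction. So the increment
  dominates \<open>clip l d\<close>.\<close>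

lemma clip_increment_ge:
  assumes "0 \<le> l" "\<bar>x\<bar> \<le> L"
  shows "min (d\<^sup>2) (l\<^sup>2) \<le> clip l d * (clip (L + l) x - clip (L + l) (x - d))"
proof -
  have "clip l d * clip l d \<le> clip l d * (clip (L + l) x - clip (L + l) (x - d))"
  proof (cases "0 \<le> d")
    case True
    hence "clip l d \<le> clip (L + l) x - clip (L + l) (x - d)" "0 \<le> clip l d"
      using assms by (auto simp: clip_def max_def min_def)
    thus ?thesis by (intro mult_left_mono)
  next
    case False
    hence "clip (L + l) x - clip (L + l) (x - d) \<le> clip l d" "clip l d \<le> 0"
      using assms by (auto simp: clip_def max_def min_def)
    thus ?thesis by (intro mult_left_mono_neg)
  qed
  thus ?thesis using clip_sq[OF assms(1), of d] by (simp add: power2_eq_square)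
qed

lemma min_sq_ge:
  assumes "0 < (l::real)"
  shows "x\<^sup>2 - 2 / 5 * \<bar>x\<bar> ^ 3 / l \<le> min (x\<^sup>2) (l\<^sup>2)"
proof -
  define y where "y = \<bar>x\<bar>"
  \<comment> \<open>With \<open>c\<close> in place of \<open>2 / 5\<close>, the maximum of
    \<open>y\<^sup>2 - c * y ^ 3 / l\<close> over \<open>y \<ge> 0\<close> is
    \<open>4 * l\<^sup>2 / (27 * c\<^sup>2)\<close>, attained at \<open>2 * l / (3 * c)\<close>. It
    is at most \<open>l\<^sup>2\<close> from \<open>c = 2 / (3 * sqrt 3)\<close> on, and
    \<open>2 / 5\<close> lies just above that; its maximiser is the double root
    \<open>5 * l / 3\<close>.\<close>
  have "0 \<le> 2 / 5 * ((y - 5 * l / 3)\<^sup>2 * (y + 5 * l / 6))"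
    using assms by (intro mult_nonneg_nonneg) (auto simp: y_def)
  also have "\<dots> = 2 / 5 * y ^ 3 - l * y\<^sup>2 + 25 / 27 * l ^ 3"
    by (simp add: power2_eq_square power3_eq_cube field_simps)
  also have "\<dots> \<le> 2 / 5 * y ^ 3 - l * y\<^sup>2 + l ^ 3"
    using assms by simp
  finally have "l * (y\<^sup>2 - 2 / 5 * y ^ 3 / l) \<le> l * l\<^sup>2"
    using assms by (simp add: power2_eq_square power3_eq_cube algebra_simps)
  hence "y\<^sup>2 - 2 / 5 * y ^ 3 / l \<le> l\<^sup>2" using assms by simp
  thus ?thesis using assms by (simp add: y_def)
qed

section \<open>Double sums of differences\<close>

lemma sum_product_differences:
  fixes x y :: "'i \<Rightarrow> real"
  shows "(\<Sum>i\<in>A. \<Sum>j\<in>A. (x i - x j) * (y i - y j)) =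
    2 * real (card A) * (\<Sum>i\<in>A. x i * y i) - 2 * ((\<Sum>i\<in>A. x i) * (\<Sum>i\<in>A. y i))"
proof -
  have "(\<Sum>i\<in>A. \<Sum>j\<in>A. (x i - x j) * (y i - y j)) =
     (\<Sum>i\<in>A. \<Sum>j\<in>A. x i * y i) + (\<Sum>i\<in>A. \<Sum>j\<in>A. x j * y j)
     - (\<Sum>i\<in>A. \<Sum>j\<in>A. x i * y j) - (\<Sum>i\<in>A. \<Sum>j\<in>A. x j * y i)"
    unfolding sum.distrib[symmetric] sum_subtractf[symmetric]
    by (intro sum.cong refl) (simp add: algebra_simps)
  also have "(\<Sum>i\<in>A. \<Sum>j\<in>A. x j * y i) = (\<Sum>i\<in>A. \<Sum>j\<in>A. x i * y j)"
    by (rule sum.swap)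
  also have "(\<Sum>i\<in>A. \<Sum>j\<in>A. x i * y j) = (\<Sum>i\<in>A. x i) * (\<Sum>i\<in>A. y i)"
    by (simp only: sum_product)
  also have "(\<Sum>i\<in>A. \<Sum>j\<in>A. x i * y i) = real (card A) * (\<Sum>i\<in>A. x i * y i)"
    by (simp add: sum_distrib_left)
  finally show ?thesis by simp
qed

lemma sum_sq_differences:
  fixes x :: "'i \<Rightarrow> real"
  assumes "(\<Sum>i\<in>S. x i) = 0"
  shows "(\<Sum>i\<in>S. \<Sum>j\<in>S. (x i - x j)\<^sup>2) = 2 * real (card S) * (\<Sum>i\<in>S. (x i)\<^sup>2)"
  using sum_product_differences[of x x S] assms by (simp add: power2_eq_square)

text \<open>Each mixed term is linear in one of the variables and therefore cancels in the double
  sum over a centered family. This leads to the factor \<open>4 * card S\<close> below, where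
  convexity alone would give twice as much.\<close>

lemma abs_diff_cubed_le:
  "\<bar>x - y :: real\<bar> ^ 3 \<le> 2 * \<bar>x\<bar> ^ 3 + 2 * \<bar>y\<bar> ^ 3 - 2 * (x * \<bar>x\<bar>) * y - 2 * x * (y * \<bar>y\<bar>)"
proof -
  have "\<bar>x - y\<bar> ^ 3 = \<bar>x - y\<bar> * (x - y)\<^sup>2" by (simp add: power3_eq_cube power2_eq_square)
  also have "\<dots> \<le> (\<bar>x\<bar> + \<bar>y\<bar>) * (x - y)\<^sup>2" by (intro mult_right_mono) auto
  also have "\<dots> = \<bar>x\<bar> ^ 3 + \<bar>y\<bar> ^ 3 + (\<bar>x\<bar> * \<bar>y\<bar>\<^sup>2 + \<bar>y\<bar> * \<bar>x\<bar>\<^sup>2) - 2 * (x * \<bar>x\<bar>) * y - 2 * x * (y * \<bar>y\<bar>)"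
    by (simp add: power2_eq_square power3_eq_cube algebra_simps abs_mult_self_eq)
  also have "\<bar>x\<bar> * \<bar>y\<bar>\<^sup>2 + \<bar>y\<bar> * \<bar>x\<bar>\<^sup>2 \<le> \<bar>x\<bar> ^ 3 + \<bar>y\<bar> ^ 3"
  proof -
    have "c * d\<^sup>2 + d * c\<^sup>2 \<le> c ^ 3 + d ^ 3" if "0 \<le> c" "0 \<le> d" for c d :: real
    proof -
      have "0 \<le> (c + d) * (c - d)\<^sup>2" using that by simp
      thus ?thesis by (simp add: power2_eq_square power3_eq_cube algebra_simps)
    qed
    from this[of "\<bar>x\<bar>" "\<bar>y\<bar>"] show ?thesis by simp
  qed
  finally show ?thesis by simp
qed

lemma sum_cubed_differences:
  fixes x :: "'i \<Rightarrow> real"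
  assumes "(\<Sum>i\<in>S. x i) = 0"
  shows "(\<Sum>i\<in>S. \<Sum>j\<in>S. \<bar>x i - x j\<bar> ^ 3) \<le> 4 * real (card S) * (\<Sum>i\<in>S. \<bar>x i\<bar> ^ 3)"
proof -
  have "(\<Sum>i\<in>S. \<Sum>j\<in>S. \<bar>x i - x j\<bar> ^ 3) \<le> (\<Sum>i\<in>S. \<Sum>j\<in>S. 2 * \<bar>x i\<bar> ^ 3 + 2 * \<bar>x j\<bar> ^ 3 -
      2 * (x i * \<bar>x i\<bar>) * x j - 2 * x i * (x j * \<bar>x j\<bar>))"
    by (intro sum_mono abs_diff_cubed_le)
  also have "\<dots> = 4 * real (card S) * (\<Sum>i\<in>S. \<bar>x i\<bar> ^ 3)
      - 2 * ((\<Sum>i\<in>S. x i * \<bar>x i\<bar>) * (\<Sum>j\<in>S. x j)) - 2 * ((\<Sum>i\<in>S. x i) * (\<Sum>j\<in>S. x j * \<bar>x j\<bar>))"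
    unfolding sum_product by (simp add: sum.distrib sum_subtractf sum_distrib_left mult.assoc)
  finally show ?thesis using assms by simp
qed

text \<open>The variance of \<open>W S\<close> under a uniform permutation is \<open>v\<close>. It
  remains a parameter near 1: the coefficients \<open>a\<close> can be scaled once and for all, but
  \<open>b\<close> comes from the random vector. With \<open>1000 \<le> n\<close>, dropping four
  indices changes the number of pairs by at most about one percent.\<close>

locale normalized_array = perm_array S a b for S :: "'i set" and a b +
  fixes v n :: real
  assumes n_def: "n = real (card S)" and n_ge: "1000 \<le> n"
    and sum_a: "(\<Sum>i\<in>S. a i) = 0" and sum_a2: "(\<Sum>i\<in>S. (a i)\<^sup>2) = 1"
    and sum_b: "(\<Sum>i\<in>S. b i) = 0" and sum_b2: "(\<Sum>i\<in>S. (b i)\<^sup>2) = (n - 1) * v"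
    and v_ge: "3 / 4 \<le> v" and v_le: "v \<le> 5 / 4"
begin

text \<open>The sum over \<open>i\<close> of the average of
  \<open>\<bar>a i * b (\<pi> i)\<bar> ^ 3\<close>, hence a Lyapunov ratio, as the variance is close
  to 1. Being linear in the cubes of \<open>b\<close>, it can be integrated over the values of the
  random vector.\<close>

definition \<beta> :: real where
  "\<beta> = (\<Sum>i\<in>S. \<bar>a i\<bar> ^ 3) * (\<Sum>i\<in>S. \<bar>b i\<bar> ^ 3) / n"

lemma sum_a_diff: "(\<Sum>i\<in>S. \<Sum>j\<in>S. (a i - a j)\<^sup>2) = 2 * n"
  using sum_sq_differences[OF sum_a] by (simp add: sum_a2 n_def)

lemma sum_b_diff: "(\<Sum>i\<in>S. \<Sum>j\<in>S. (b i - b j)\<^sup>2) = 2 * n * (n - 1) * v"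
  using sum_sq_differences[OF sum_b] by (simp add: sum_b2 n_def)

lemma card_rest:
  assumes "K \<subseteq> S" "card K \<le> 4"
  shows "n - 4 \<le> real (card (S - K))" "real (card (S - K)) \<le> n"
    "n * (n - 1) \<le> 101 / 100 * (real (card (S - K)) * (real (card (S - K)) - 1))"
proof -
  let ?r = "real (card (S - K))"
  have "real (card (S - K)) = n - real (card K)"
    using assms fin finite_subset[OF assms(1) fin] card_mono[OF fin assms(1)]
    by (simp add: card_Diff_subset n_def of_nat_diff)
  thus 1: "n - 4 \<le> ?r" "?r \<le> n" using assms(2) by auto
  have "n * (n - 1) \<le> 101 / 100 * ((n - 4) * (n - 5))"
  proof -
    have "101 / 100 * ((n - 4) * (n - 5)) - n * (n - 1) = (n * (n - 809) + 2020) / 100"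
      by (simp add: algebra_simps)
    moreover have "0 \<le> (n * (n - 809) + 2020) / 100" using n_ge by simp
    ultimately show ?thesis by simp
  qed
  also have "(n - 4) * (n - 5) \<le> ?r * (?r - 1)"
    using 1 n_ge by (intro mult_mono) auto
  finally show "n * (n - 1) \<le> 101 / 100 * (?r * (?r - 1))" by simp
qed

text \<open>The factor \<open>51 / 10\<close> rounds up \<open>4 * (101 / 100) * (5 / 4)\<close>:
  the two pair sums give \<open>4 * v\<close>, the removed indices cost \<open>101 / 100\<close>,
  and \<open>v \<le> 5 / 4\<close>.\<close>

lemma E_D_sq_sum:
  assumes "K \<subseteq> S" "card K \<le> 4" "stable_off S K w" "\<And>\<pi>. \<pi> permutes S \<Longrightarrow> 0 \<le> w \<pi>"
  shows "(\<Sum>i\<in>S - K. \<Sum>j\<in>S - K. E (\<lambda>\<pi>. w \<pi> * (D i j \<pi>)\<^sup>2)) \<le> 51 / 10 * n * E w"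
proof -
  let ?A = "S - K"
  define r where "r = real (card ?A)"
  have Ew: "0 \<le> E w" by (rule E_nonneg[OF assms(4)])
  have r: "n - 4 \<le> r" "r \<le> n" "n * (n - 1) \<le> 101 / 100 * (r * (r - 1))"
    using card_rest[OF assms(1,2)] by (auto simp: r_def)
  have rr: "0 < r * (r - 1)" using r n_ge by simp
  have *: "r * (r - 1) * E (\<lambda>\<pi>. w \<pi> * (D i j \<pi>)\<^sup>2) \<le> (a i - a j)\<^sup>2 * (2 * n * (n - 1) * v * E w)"
    if "i \<in> ?A" "j \<in> ?A" for i j
  proof (cases "i = j")
    case False
    have "r * (r - 1) * E (\<lambda>\<pi>. w \<pi> * (D i j \<pi>)\<^sup>2) \<le>
        (\<Sum>p\<in>S. \<Sum>q\<in>S. ((a i - a j) * (b p - b q))\<^sup>2) * E w"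
      unfolding r_def D_def
      by (rule E_stable_pair_le[where h = "\<lambda>p q. ((a i - a j) * (b p - b q))\<^sup>2", OF assms(3,4) that False])
         auto
    also have "(\<Sum>p\<in>S. \<Sum>q\<in>S. ((a i - a j) * (b p - b q))\<^sup>2) = (a i - a j)\<^sup>2 * (2 * n * (n - 1) * v)"
      unfolding sum_b_diff[symmetric] by (simp add: power_mult_distrib sum_distrib_left)
    finally show ?thesis by simp
  qed simp
  have "r * (r - 1) * (\<Sum>i\<in>?A. \<Sum>j\<in>?A. E (\<lambda>\<pi>. w \<pi> * (D i j \<pi>)\<^sup>2)) \<le>
      (\<Sum>i\<in>?A. \<Sum>j\<in>?A. (a i - a j)\<^sup>2 * (2 * n * (n - 1) * v * E w))"
    unfolding sum_distrib_left by (intro sum_mono *)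
  also have "\<dots> = (\<Sum>i\<in>?A. \<Sum>j\<in>?A. (a i - a j)\<^sup>2) * (2 * n * (n - 1) * v * E w)"
    by (simp add: sum_distrib_right)
  also have "\<dots> \<le> (\<Sum>i\<in>S. \<Sum>j\<in>S. (a i - a j)\<^sup>2) * (2 * n * (n - 1) * v * E w)"
    using fin n_ge v_ge Ew
    by (intro mult_right_mono order.trans[OF sum_mono sum_mono2] sum_mono2 sum_nonneg mult_nonneg_nonneg) auto
  also have "\<dots> = (4 * n * v * E w) * (n * (n - 1))"
    by (simp add: sum_a_diff)
  also have "\<dots> \<le> (4 * n * v * E w) * (101 / 100 * (r * (r - 1)))"
    using n_ge v_ge Ew by (intro mult_left_mono r) auto
  also have "\<dots> = r * (r - 1) * ((404 / 100 * n * E w) * v)" by simp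
  also have "\<dots> \<le> r * (r - 1) * ((404 / 100 * n * E w) * (5 / 4))"
    using n_ge Ew v_le rr by (intro mult_left_mono) auto
  also have "\<dots> \<le> r * (r - 1) * (51 / 10 * n * E w)"
    using n_ge Ew rr by (intro mult_left_mono) (auto simp: mult_left_mono)
  finally show ?thesis using rr by (simp only: mult_le_cancel_left_pos)
qed

lemma E_antisym_sum_abs:
  assumes "K \<subseteq> S" "card K \<le> 4" "stable_off S K w" "\<And>\<pi>. \<pi> permutes S \<Longrightarrow> 0 \<le> w \<pi>"
    and odd: "\<And>x. \<phi> (- x) = - \<phi> x" and le: "\<And>x. (\<phi> x)\<^sup>2 \<le> x\<^sup>2"
  shows "E (\<lambda>\<pi>. w \<pi> * \<bar>\<Sum>i\<in>S - K. \<Sum>j\<in>S - K. \<phi> (D i j \<pi>)\<bar>) \<le> 46 / 10 * n * E w"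
proof -
  let ?A = "S - K"
  let ?G = "\<lambda>\<pi>. \<Sum>i\<in>?A. \<Sum>j\<in>?A. \<phi> (D i j \<pi>)"
  have Ew: "0 \<le> E w" by (rule E_nonneg[OF assms(4)])
  have n0: "0 < n" using n_ge by simp
  have "E (\<lambda>\<pi>. w \<pi> * (?G \<pi>)\<^sup>2) \<le>
      4 * real (card ?A) * (\<Sum>i\<in>?A. \<Sum>j\<in>?A. E (\<lambda>\<pi>. w \<pi> * (\<phi> (D i j \<pi>))\<^sup>2))"
    by (rule E_antisym_sum_sq[where \<phi> = \<phi>, OF assms(3,4) odd])
  also have "\<dots> \<le> 4 * n * (\<Sum>i\<in>?A. \<Sum>j\<in>?A. E (\<lambda>\<pi>. w \<pi> * (D i j \<pi>)\<^sup>2))"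
    using card_rest[OF assms(1,2)] n0
    by (intro mult_mono sum_mono E_mono mult_left_mono le assms(4) sum_nonneg E_nonneg mult_nonneg_nonneg) auto
  also have "\<dots> \<le> 4 * n * (51 / 10 * n * E w)"
    using n0 by (intro mult_left_mono E_D_sq_sum assms(1-4)) auto
  finally have G2: "E (\<lambda>\<pi>. w \<pi> * (?G \<pi>)\<^sup>2) \<le> 204 / 10 * n\<^sup>2 * E w" by (simp add: power2_eq_square)
  have "E (\<lambda>\<pi>. w \<pi> * \<bar>?G \<pi>\<bar>) \<le> E (\<lambda>\<pi>. (23 / 10 * n) * w \<pi> + (1 / (92 / 10 * n)) * (w \<pi> * (?G \<pi>)\<^sup>2))"
  proof (rule E_mono)
    fix \<pi> assume \<pi>: "\<pi> permutes S"
    \<comment> \<open>Cauchy-Schwarz in linear form, so that the result stays linear in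
      \<open>E w\<close>. The balancing weight \<open>46 / 10 * n\<close> is close to the square
      root of \<open>204 / 10 * n\<^sup>2\<close>.\<close>
    have "2 * \<bar>?G \<pi>\<bar> * (46 / 10 * n) \<le> \<bar>?G \<pi>\<bar>\<^sup>2 + (46 / 10 * n)\<^sup>2"
      by (rule sum_squares_bound)
    hence "\<bar>?G \<pi>\<bar> \<le> 23 / 10 * n + (1 / (92 / 10 * n)) * (?G \<pi>)\<^sup>2"
      using n0 by (simp add: field_simps power2_eq_square)
    from mult_left_mono[OF this assms(4)[OF \<pi>]]
    show "w \<pi> * \<bar>?G \<pi>\<bar> \<le> (23 / 10 * n) * w \<pi> + (1 / (92 / 10 * n)) * (w \<pi> * (?G \<pi>)\<^sup>2)"
      by (simp add: algebra_simps)
  qed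
  also have "\<dots> = (23 / 10 * n) * E w + (1 / (92 / 10 * n)) * E (\<lambda>\<pi>. w \<pi> * (?G \<pi>)\<^sup>2)"
    unfolding E_add E_cmult ..
  also have "\<dots> \<le> (23 / 10 * n) * E w + (1 / (92 / 10 * n)) * (204 / 10 * n\<^sup>2 * E w)"
    using n0 by (intro add_left_mono mult_left_mono G2) auto
  also have "\<dots> = (23 / 10 + 204 / 92) * n * E w"
    using n0 by (simp add: field_simps power2_eq_square)
  also have "\<dots> \<le> 46 / 10 * n * E w"
    using n0 Ew by (intro mult_right_mono) auto
  finally show ?thesis .
qed

text \<open>The sum of all \<open>D i j \<pi>\<close> over the remaining indices is
  \<open>2 * r * W (S - K) \<pi>\<close> up to the product of the remaining sums of \<open>a\<close>
  and of \<open>b\<close>. By centering these are minus the sums over \<open>K\<close>, so the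
  product is at most \<open>sqrt (20 * n)\<close>, which is below \<open>15 / 100 * n\<close> for
  \<open>1000 \<le> n\<close>.\<close>

lemma E_W_rest_abs:
  assumes "K \<subseteq> S" "card K \<le> 4" "stable_off S K w" "\<And>\<pi>. \<pi> permutes S \<Longrightarrow> 0 \<le> w \<pi>"
  shows "E (\<lambda>\<pi>. w \<pi> * \<bar>W (S - K) \<pi>\<bar>) \<le> 5 / 2 * E w"
proof -
  let ?A = "S - K"
  define r where "r = real (card ?A)"
  let ?G = "\<lambda>\<pi>. \<Sum>i\<in>?A. \<Sum>j\<in>?A. D i j \<pi>"
  have Ew: "0 \<le> E w" by (rule E_nonneg[OF assms(4)])
  have finK: "finite K" using assms(1) fin by (rule finite_subset)
  have r: "n - 4 \<le> r" using card_rest[OF assms(1,2)] by (simp add: r_def)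
  have r0: "0 < r" using r n_ge by simp
  have K4: "(\<Sum>k\<in>K. f k)\<^sup>2 \<le> 4 * (\<Sum>k\<in>S. (f k)\<^sup>2)" for f :: "'i \<Rightarrow> real"
  proof -
    have "(\<Sum>k\<in>K. 1 * f k)\<^sup>2 \<le> (\<Sum>k\<in>K. 1\<^sup>2) * (\<Sum>k\<in>K. (f k)\<^sup>2)"
      by (rule Cauchy_Schwarz_ineq_sum)
    also have "\<dots> \<le> 4 * (\<Sum>k\<in>S. (f k)\<^sup>2)"
      using assms(1,2) fin by (intro mult_mono sum_mono2 sum_nonneg) auto
    finally show ?thesis by simp
  qed
  have "E (\<lambda>\<pi>. w \<pi> * \<bar>W ?A \<pi>\<bar>) \<le> E (\<lambda>\<pi>. (1 / (2 * r)) * (w \<pi> * \<bar>?G \<pi>\<bar>) + (15 / 100 * n / r) * w \<pi>)"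
  proof (rule E_mono)
    fix \<pi> assume \<pi>: "\<pi> permutes S"
    define x y where "x = (\<Sum>i\<in>?A. a i)" and "y = (\<Sum>i\<in>?A. b (\<pi> i))"
    have x: "x = - (\<Sum>i\<in>K. a i)"
      using sum.subset_diff[OF assms(1) fin, of a] sum_a by (simp add: x_def)
    have y: "y = - (\<Sum>i\<in>K. b (\<pi> i))"
      using sum.subset_diff[OF assms(1) fin, of "\<lambda>i. b (\<pi> i)"] sum_b sum_over_perm[OF \<pi>, of b]
      by (simp add: y_def)
    have "x\<^sup>2 \<le> 4" using K4[of a] by (simp add: x sum_a2)
    moreover have "y\<^sup>2 \<le> 5 * n"
    proof -
      have "y\<^sup>2 \<le> 4 * ((n - 1) * v)"
        using K4[of "\<lambda>i. b (\<pi> i)"] sum_over_perm[OF \<pi>, of "\<lambda>i. (b i)\<^sup>2"] by (simp add: y sum_b2)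
      also have "\<dots> \<le> 4 * (n * (5 / 4))"
        using n_ge v_ge v_le by (intro mult_left_mono mult_mono) auto
      finally show ?thesis by simp
    qed
    ultimately have "x\<^sup>2 * y\<^sup>2 \<le> 4 * (5 * n)" by (intro mult_mono) auto
    also have "\<dots> \<le> (15 / 100 * n)\<^sup>2" using n_ge by (simp add: power2_eq_square)
    finally have "\<bar>x * y\<bar>\<^sup>2 \<le> (15 / 100 * n)\<^sup>2" by (simp add: power_mult_distrib)
    hence xy: "\<bar>x * y\<bar> \<le> 15 / 100 * n"
      by (rule power2_le_imp_le) (use n_ge in simp)
    have "?G \<pi> = 2 * r * W ?A \<pi> - 2 * (x * y)"
      using sum_product_differences[of a "\<lambda>i. b (\<pi> i)" ?A]
      by (simp add: D_def W_def r_def x_def y_def)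
    hence "W ?A \<pi> = (1 / (2 * r)) * ?G \<pi> + (1 / r) * (x * y)"
      using r0 by (simp add: field_simps)
    hence "\<bar>W ?A \<pi>\<bar> \<le> \<bar>(1 / (2 * r)) * ?G \<pi>\<bar> + \<bar>(1 / r) * (x * y)\<bar>"
      by (simp only: abs_triangle_ineq)
    also have "\<dots> = (1 / (2 * r)) * \<bar>?G \<pi>\<bar> + (1 / r) * \<bar>x * y\<bar>"
      using r0 by (simp add: abs_mult)
    also have "\<dots> \<le> (1 / (2 * r)) * \<bar>?G \<pi>\<bar> + (1 / r) * (15 / 100 * n)"
      using r0 by (intro add_left_mono mult_left_mono xy) auto
    finally have "w \<pi> * \<bar>W ?A \<pi>\<bar> \<le> w \<pi> * ((1 / (2 * r)) * \<bar>?G \<pi>\<bar> + (1 / r) * (15 / 100 * n))"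
      by (intro mult_left_mono assms(4)[OF \<pi>])
    thus "w \<pi> * \<bar>W ?A \<pi>\<bar> \<le> (1 / (2 * r)) * (w \<pi> * \<bar>?G \<pi>\<bar>) + (15 / 100 * n / r) * w \<pi>"
      by (simp add: algebra_simps)
  qed
  also have "\<dots> = (1 / (2 * r)) * E (\<lambda>\<pi>. w \<pi> * \<bar>?G \<pi>\<bar>) + (15 / 100 * n / r) * E w"
    unfolding E_add E_cmult ..
  also have "\<dots> \<le> (1 / (2 * r)) * (46 / 10 * n * E w) + (15 / 100 * n / r) * E w"
    using r0 by (intro add_right_mono mult_left_mono E_antisym_sum_abs[where \<phi> = "\<lambda>x. x"] assms) auto
  also have "\<dots> = (245 / 100 * (n / r)) * E w" using r0 by (simp add: field_simps)
  also have "\<dots> \<le> 5 / 2 * E w"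
  proof (rule mult_right_mono[OF _ Ew])
    show "245 / 100 * (n / r) \<le> 5 / 2" using r r0 n_ge by (simp add: field_simps)
  qed
  finally show ?thesis .
qed

end

section \<open>Concentration of the permutation statistic\<close>

context normalized_array
begin

lemma \<beta>_pos: "0 < \<beta>"
proof -
  have "0 < (\<Sum>i\<in>S. \<bar>x i\<bar> ^ 3)" if "0 < (\<Sum>i\<in>S. (x i)\<^sup>2)" for x :: "'i \<Rightarrow> real"
  proof -
    have "\<exists>i\<in>S. x i \<noteq> 0"
    proof (rule ccontr)
      assume "\<not> (\<exists>i\<in>S. x i \<noteq> 0)"
      hence "(\<Sum>i\<in>S. (x i)\<^sup>2) = 0" by simp
      with that show False by simp
    qed
    thus ?thesis using fin by (auto intro!: sum_pos2)
  qed
  from this[of a] this[of b] show ?thesis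
    using n_ge v_ge by (simp add: \<beta>_def sum_a2 sum_b2)
qed

text \<open>Truncation at \<open>lev\<close> costs at most \<open>2 / 5 / lev\<close> times a
  third-moment sum of at most \<open>16 * n ^ 3 * \<beta>\<close>. At level
  \<open>6 * \<beta>\<close> this is \<open>16 / 15 * n ^ 3\<close>, against an untruncated total of
  at least \<open>2997 / 1000 * n ^ 3\<close>.\<close>

definition lev :: real where "lev = 6 * \<beta>"

definition cell :: "'i \<Rightarrow> 'i \<Rightarrow> 'i \<Rightarrow> 'i \<Rightarrow> real" where
  "cell i j p q = min (((a i - a j) * (b p - b q))\<^sup>2) (lev\<^sup>2)"

text \<open>For a pair of distinct indices this is \<open>n * (n - 1)\<close> times the plain
  average of \<open>trunc p\<close>.\<close>

definition cell_sum :: "'i \<times> 'i \<Rightarrow> real" where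
  "cell_sum p = (\<Sum>s\<in>S. \<Sum>t\<in>S. cell (fst p) (snd p) s t)"

definition trunc :: "'i \<times> 'i \<Rightarrow> ('i \<Rightarrow> 'i) \<Rightarrow> real" where
  "trunc p \<pi> = min ((D (fst p) (snd p) \<pi>)\<^sup>2) (lev\<^sup>2)"

lemma lev_pos: "0 < lev"
  using \<beta>_pos by (simp add: lev_def)

lemma trunc_eq_cell: "trunc p \<pi> = cell (fst p) (snd p) (\<pi> (fst p)) (\<pi> (snd p))"
  by (simp add: trunc_def cell_def D_def)

lemma cell_nonneg [simp]: "0 \<le> cell i j p q" and cell_le: "cell i j p q \<le> lev\<^sup>2"
  and cell_diag [simp]: "cell i j p p = 0" "cell i i p q = 0"
  by (auto simp: cell_def)

lemma trunc_nonneg [simp]: "0 \<le> trunc p \<pi>" and trunc_le: "trunc p \<pi> \<le> lev\<^sup>2"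
  by (auto simp: trunc_eq_cell cell_le)

lemma cell_sum_nonneg [simp]: "0 \<le> cell_sum p"
  by (auto simp: cell_sum_def intro!: sum_nonneg)

lemma cell_sum_le: "cell_sum p \<le> n\<^sup>2 * lev\<^sup>2"
proof -
  have "cell_sum p \<le> (\<Sum>s\<in>S. \<Sum>t\<in>S. lev\<^sup>2)"
    unfolding cell_sum_def by (intro sum_mono cell_le)
  thus ?thesis by (simp add: n_def power2_eq_square)
qed

lemma stable_off_trunc:
  assumes "fst p \<in> K" "snd p \<in> K"
  shows "stable_off S K (trunc p)"
  unfolding trunc_def
  by (rule stable_off_comp[where h = "\<lambda>x. min (x\<^sup>2) (lev\<^sup>2)", OF stable_off_D[OF assms]])

lemma E_trunc_le:
  assumes "stable_off S K w" "\<And>\<pi>. \<pi> permutes S \<Longrightarrow> 0 \<le> w \<pi>" "p \<in> (S - K) \<times> (S - K)"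
  shows "real (card (S - K)) * (real (card (S - K)) - 1) * E (\<lambda>\<pi>. w \<pi> * trunc p \<pi>) \<le> cell_sum p * E w"
proof (cases "fst p = snd p")
  case True
  thus ?thesis using E_nonneg[OF assms(2)] by (simp add: trunc_def)
next
  case False
  show ?thesis unfolding trunc_eq_cell cell_sum_def
    using assms(3) by (intro E_stable_pair_le[where h = "cell (fst p) (snd p)", OF assms(1,2) _ _ False]) auto
qed

lemma E_trunc_ge:
  assumes "K \<subseteq> S" "card K \<le> 4"
    and "stable_off S K w" "\<And>\<pi>. \<pi> permutes S \<Longrightarrow> 0 \<le> w \<pi>" "p \<in> (S - K) \<times> (S - K)"
  shows "(cell_sum p - 8 * n * lev\<^sup>2) * E w \<le>
    real (card (S - K)) * (real (card (S - K)) - 1) * E (\<lambda>\<pi>. w \<pi> * trunc p \<pi>)"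
proof (cases "fst p = snd p")
  case True
  have "0 \<le> 8 * n * lev\<^sup>2 * E w" using E_nonneg[OF assms(4)] n_ge by simp
  thus ?thesis using True by (simp add: trunc_def cell_sum_def)
next
  case False
  have "(cell_sum p - 8 * n * lev\<^sup>2) * E w \<le>
      (cell_sum p - 2 * real (card K) * real (card S) * lev\<^sup>2) * E w"
    using E_nonneg[OF assms(4)] n_ge assms(2)
    by (intro mult_right_mono diff_left_mono) (auto simp: n_def intro!: mult_right_mono)
  also have "\<dots> \<le> real (card (S - K)) * (real (card (S - K)) - 1) * E (\<lambda>\<pi>. w \<pi> * trunc p \<pi>)"
    unfolding trunc_eq_cell cell_sum_def using assms(5)
    by (intro E_stable_pair_ge[where h = "cell (fst p) (snd p)", OF assms(3,4,1) _ _ False]) (auto intro: cell_le)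
  finally show ?thesis .
qed

lemma sum_cell_sum_le:
  assumes "K \<subseteq> S" "card K \<le> 4"
  shows "(\<Sum>p\<in>(S - K) \<times> (S - K). cell_sum p) \<le>
    51 / 10 * n * (real (card (S - K)) * (real (card (S - K)) - 1))"
proof -
  let ?r = "real (card (S - K))"
  have "(\<Sum>p\<in>(S - K) \<times> (S - K). cell_sum p) \<le> (\<Sum>p\<in>S \<times> S. cell_sum p)"
    using fin by (intro sum_mono2) auto
  also have "\<dots> \<le> (\<Sum>p\<in>S \<times> S. (a (fst p) - a (snd p))\<^sup>2 * (2 * n * (n - 1) * v))"
  proof (rule sum_mono)
    fix p
    have "cell_sum p \<le> (\<Sum>s\<in>S. \<Sum>t\<in>S. (a (fst p) - a (snd p))\<^sup>2 * (b s - b t)\<^sup>2)"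
      unfolding cell_sum_def cell_def by (intro sum_mono) (auto simp: power_mult_distrib)
    thus "cell_sum p \<le> (a (fst p) - a (snd p))\<^sup>2 * (2 * n * (n - 1) * v)"
      unfolding sum_b_diff[symmetric] by (simp add: sum_distrib_left)
  qed
  also have "\<dots> = (\<Sum>i\<in>S. \<Sum>j\<in>S. (a i - a j)\<^sup>2) * (2 * n * (n - 1) * v)"
    by (simp add: sum_distrib_right sum.cartesian_product case_prod_beta)
  also have "\<dots> = (4 * n * v) * (n * (n - 1))" by (simp add: sum_a_diff)
  also have "\<dots> \<le> (4 * n * v) * (101 / 100 * (?r * (?r - 1)))"
    using n_ge v_ge by (intro mult_left_mono card_rest assms) auto
  also have "\<dots> = 404 / 100 * n * (?r * (?r - 1)) * v" by simp
  also have "\<dots> \<le> 404 / 100 * n * (?r * (?r - 1)) * (5 / 4)"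
    using n_ge v_le card_rest[OF assms] by (intro mult_left_mono mult_nonneg_nonneg) auto
  also have "\<dots> = 505 / 100 * n * (?r * (?r - 1))" by simp
  also have "\<dots> \<le> 51 / 10 * n * (?r * (?r - 1))"
    using n_ge card_rest[OF assms] by (intro mult_right_mono mult_nonneg_nonneg) auto
  finally show ?thesis .
qed

lemma sum_cell_sum_ge:
  assumes "K \<subseteq> S" "card K \<le> 4" "400 * \<beta> \<le> 1"
  shows "192 / 100 * n ^ 3 \<le> (\<Sum>p\<in>(S - K) \<times> (S - K). cell_sum p)"
proof -
  let ?A = "S - K"
  have n0: "0 < n" using n_ge by simp
  have finK: "finite K" using assms(1) fin by (rule finite_subset)
  define T where "T = (\<Sum>p\<in>S \<times> S. cell_sum p)"
  have T: "T = (\<Sum>i\<in>S. \<Sum>j\<in>S. \<Sum>s\<in>S. \<Sum>t\<in>S. cell i j s t)"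
  proof -
    have "T = (\<Sum>(i, j)\<in>S \<times> S. \<Sum>s\<in>S. \<Sum>t\<in>S. cell i j s t)"
      by (simp add: T_def cell_sum_def case_prod_beta)
    thus ?thesis by (simp only: sum.cartesian_product[symmetric])
  qed
  define T3 where "T3 = (\<Sum>i\<in>S. \<Sum>j\<in>S. \<bar>a i - a j\<bar> ^ 3) * (\<Sum>s\<in>S. \<Sum>t\<in>S. \<bar>b s - b t\<bar> ^ 3)"
  have "4 * n\<^sup>2 * (n - 1) * v - 2 / 5 / lev * T3 =
      (\<Sum>i\<in>S. \<Sum>j\<in>S. (a i - a j)\<^sup>2) * (\<Sum>s\<in>S. \<Sum>t\<in>S. (b s - b t)\<^sup>2) - 2 / 5 / lev * T3"
    unfolding sum_a_diff sum_b_diff by (simp add: power2_eq_square)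
  also have "\<dots> = (\<Sum>i\<in>S. \<Sum>j\<in>S. \<Sum>s\<in>S. \<Sum>t\<in>S. ((a i - a j) * (b s - b t))\<^sup>2
      - 2 / 5 * \<bar>(a i - a j) * (b s - b t)\<bar> ^ 3 / lev)"
  proof -
    have prod: "(\<Sum>i\<in>S. \<Sum>j\<in>S. f i j) * (\<Sum>s\<in>S. \<Sum>t\<in>S. g s t) =
        (\<Sum>i\<in>S. \<Sum>j\<in>S. \<Sum>s\<in>S. \<Sum>t\<in>S. f i j * g s t)" for f g :: "'i \<Rightarrow> 'i \<Rightarrow> real"
      unfolding sum_distrib_right unfolding sum_distrib_left ..
    show ?thesis unfolding T3_def prod
      by (simp add: sum_subtractf sum_distrib_left power_mult_distrib abs_mult)
  qed
  also have "\<dots> \<le> T" unfolding T cell_def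
    by (intro sum_mono min_sq_ge lev_pos)
  finally have 1: "4 * n\<^sup>2 * (n - 1) * v - 2 / 5 / lev * T3 \<le> T" .
  have "T3 \<le> (4 * n * (\<Sum>i\<in>S. \<bar>a i\<bar> ^ 3)) * (4 * n * (\<Sum>i\<in>S. \<bar>b i\<bar> ^ 3))"
    unfolding T3_def using sum_cubed_differences[OF sum_a] sum_cubed_differences[OF sum_b]
    by (intro mult_mono sum_nonneg) (auto simp: n_def sum_nonneg)
  also have "\<dots> = 16 * n ^ 3 * \<beta>"
    using n0 by (simp add: \<beta>_def power3_eq_cube)
  finally have "2 / 5 / lev * T3 \<le> 2 / 5 / lev * (16 * n ^ 3 * \<beta>)"
    using lev_pos by (intro mult_left_mono) auto
  also have "\<dots> = 16 / 15 * n ^ 3" using \<beta>_pos by (simp add: lev_def)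
  finally have 2: "2 / 5 / lev * T3 \<le> 16 / 15 * n ^ 3" .
  have 3: "2997 / 1000 * n ^ 3 \<le> 4 * n\<^sup>2 * (n - 1) * v"
  proof -
    have "2997 / 1000 * n ^ 3 = n\<^sup>2 * (2997 / 1000 * n)" by (simp add: power2_eq_square power3_eq_cube)
    also have "\<dots> \<le> n\<^sup>2 * (3 * (n - 1))" using n_ge by (intro mult_left_mono) auto
    also have "\<dots> = 4 * n\<^sup>2 * (n - 1) * (3 / 4)" by simp
    also have "\<dots> \<le> 4 * n\<^sup>2 * (n - 1) * v" using n_ge v_ge by (intro mult_left_mono) auto
    finally show ?thesis .
  qed
  \<comment> \<open>At most \<open>8 * n\<close> index pairs meet \<open>K\<close>, and each has a
    \<open>cell_sum\<close> of at most \<open>n\<^sup>2 * lev\<^sup>2\<close>. Smallness of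
    \<open>\<beta>\<close> gives \<open>lev \<le> 15 / 1000\<close>, so their share is
    negligible.\<close>
  have "T \<le> (\<Sum>p\<in>?A \<times> ?A. cell_sum p) + (\<Sum>p\<in>K \<times> S \<union> S \<times> K. cell_sum p)"
  proof -
    have "T \<le> (\<Sum>p\<in>?A \<times> ?A \<union> (K \<times> S \<union> S \<times> K). cell_sum p)"
      unfolding T_def using fin finK by (intro sum_mono2) auto
    also have "\<dots> \<le> (\<Sum>p\<in>?A \<times> ?A. cell_sum p) + (\<Sum>p\<in>K \<times> S \<union> S \<times> K. cell_sum p)"
    proof -
      have "0 \<le> (\<Sum>p\<in>?A \<times> ?A \<inter> (K \<times> S \<union> S \<times> K). cell_sum p)" by (intro sum_nonneg) auto
      thus ?thesis using fin finK by (simp add: sum_Un)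
    qed
    finally show ?thesis .
  qed
  also have "(\<Sum>p\<in>K \<times> S \<union> S \<times> K. cell_sum p) \<le> real (card (K \<times> S \<union> S \<times> K)) * (n\<^sup>2 * lev\<^sup>2)"
    by (intro sum_bounded_above cell_sum_le)
  also have "\<dots> \<le> (8 * n) * (n\<^sup>2 * lev\<^sup>2)"
  proof (rule mult_right_mono)
    have "card (K \<times> S \<union> S \<times> K) \<le> card (K \<times> S) + card (S \<times> K)" by (rule card_Un_le)
    also have "\<dots> = 2 * (card K * card S)" by (simp add: card_cartesian_product)
    also have "\<dots> \<le> 2 * (4 * card S)" by (intro mult_left_mono mult_right_mono assms(2)) auto
    finally have "real (card (K \<times> S \<union> S \<times> K)) \<le> real (2 * (4 * card S))" by (simp only: of_nat_le_iff)
    thus "real (card (K \<times> S \<union> S \<times> K)) \<le> 8 * n" by (simp add: n_def)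
  qed simp
  also have "\<dots> \<le> (8 * n) * (n\<^sup>2 * (15 / 1000)\<^sup>2)"
    using lev_pos assms(3) n0 by (intro mult_left_mono power_mono) (auto simp: lev_def)
  also have "\<dots> = 18 / 10000 * n ^ 3" by (simp add: power2_eq_square power3_eq_cube)
  finally have 4: "T \<le> (\<Sum>p\<in>?A \<times> ?A. cell_sum p) + 18 / 10000 * n ^ 3" by simp
  have 5: "0 \<le> n ^ 3" using n0 by simp
  show ?thesis using 1 2 3 4 5 by linarith
qed

text \<open>For disjoint pairs, \<open>w \<pi> * trunc q \<pi>\<close> is again a weight, stable off
  \<open>K\<close> together with the indices of \<open>q\<close>, so the bound for a single term
  applies a second time with two indices fewer. For overlapping pairs one factor is replaced by
  \<open>lev\<^sup>2\<close>.\<close>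

lemma E_trunc_sum_sq:
  assumes "K \<subseteq> S" "card K \<le> 4" "stable_off S K w" "\<And>\<pi>. \<pi> permutes S \<Longrightarrow> 0 \<le> w \<pi>"
  defines "A \<equiv> S - K" and "r \<equiv> real (card (S - K))"
    and "\<mu> \<equiv> (\<Sum>p\<in>(S - K) \<times> (S - K). cell_sum p) / (real (card (S - K)) * (real (card (S - K)) - 1))"
  shows "E (\<lambda>\<pi>. w \<pi> * (\<Sum>p\<in>A \<times> A. trunc p \<pi>)\<^sup>2) \<le>
    (\<mu>\<^sup>2 * (1 + 42 / 10 / n) + 4 * n * lev\<^sup>2 * \<mu>) * E w"
proof -
  have finA: "finite A" using fin by (simp add: A_def)
  have Ew: "0 \<le> E w" by (rule E_nonneg[OF assms(4)])
  have n0: "0 < n" using n_ge by simp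
  have r: "n - 4 \<le> r" "r \<le> n" using card_rest[OF assms(1,2)] by (auto simp: r_def)
  define R where "R = r * (r - 1)"
  define R2 where "R2 = (r - 2) * (r - 3)"
  define H where "H = (\<Sum>p\<in>A \<times> A. cell_sum p)"
  have R0: "0 < R" "0 < R2" using r n_ge by (auto simp: R_def R2_def)
  have H0: "0 \<le> H" unfolding H_def by (intro sum_nonneg) auto
  have \<mu>: "\<mu> = H / R" by (simp add: \<mu>_def H_def R_def r_def A_def)
  have e: "E (\<lambda>\<pi>. w \<pi> * trunc p \<pi>) \<le> cell_sum p * E w / R" if "p \<in> A \<times> A" for p
    using E_trunc_le[OF assms(3,4), of p] that R0 by (simp add: field_simps R_def r_def A_def)
  have pq: "E (\<lambda>\<pi>. w \<pi> * (trunc p \<pi> * trunc q \<pi>)) \<le>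
      cell_sum p * cell_sum q * E w / (R * R2) + of_bool (overlap q p) * (lev\<^sup>2 * (cell_sum q * E w / R))"
    if pq: "p \<in> A \<times> A" "q \<in> A \<times> A" for p q
  proof (cases "overlap q p")
    case True
    have "E (\<lambda>\<pi>. w \<pi> * (trunc p \<pi> * trunc q \<pi>)) \<le> E (\<lambda>\<pi>. lev\<^sup>2 * (w \<pi> * trunc q \<pi>))"
    proof (rule E_mono)
      fix \<pi> assume "\<pi> permutes S"
      hence "trunc p \<pi> * (w \<pi> * trunc q \<pi>) \<le> lev\<^sup>2 * (w \<pi> * trunc q \<pi>)"
        by (intro mult_right_mono trunc_le mult_nonneg_nonneg assms(4) trunc_nonneg)
      thus "w \<pi> * (trunc p \<pi> * trunc q \<pi>) \<le> lev\<^sup>2 * (w \<pi> * trunc q \<pi>)" by (simp add: mult_ac)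
    qed
    also have "\<dots> = lev\<^sup>2 * E (\<lambda>\<pi>. w \<pi> * trunc q \<pi>)" by (rule E_cmult)
    also have "\<dots> \<le> lev\<^sup>2 * (cell_sum q * E w / R)" by (intro mult_left_mono e pq) auto
    also have "\<dots> \<le> cell_sum p * cell_sum q * E w / (R * R2) + lev\<^sup>2 * (cell_sum q * E w / R)"
      using R0 Ew by simp
    finally show ?thesis using True by simp
  next
    case False
    show ?thesis
    proof (cases "fst q = snd q")
      case True
      thus ?thesis using R0 Ew by (simp add: trunc_def)
    next
      case q: False
      let ?K = "K \<union> {fst q, snd q}"
      let ?w = "\<lambda>\<pi>. w \<pi> * trunc q \<pi>"
      have st: "stable_off S ?K ?w"
        by (intro stable_off_comp2[where h = "\<lambda>x y. x * y"] stable_off_mono[OF assms(3)] stable_off_trunc) auto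
      have mem: "p \<in> (S - ?K) \<times> (S - ?K)"
        using pq False by (auto simp: overlap_def A_def)
      have card: "card (S - ?K) = card A - 2"
      proof -
        have "S - ?K = A - {fst q, snd q}" by (auto simp: A_def)
        moreover have "card (A - {fst q, snd q}) = card A - card {fst q, snd q}"
          using pq by (intro card_Diff_subset) auto
        ultimately show ?thesis using q by simp
      qed
      have cA: "real (card A - 2) = r - 2"
        using r n_ge by (subst of_nat_diff) (auto simp: r_def A_def)
      have "R2 * E (\<lambda>\<pi>. ?w \<pi> * trunc p \<pi>) \<le> cell_sum p * E ?w"
        using E_trunc_le[OF st _ mem] assms(4) unfolding card cA by (simp add: R2_def algebra_simps)
      also have "\<dots> \<le> cell_sum p * (cell_sum q * E w / R)" by (intro mult_left_mono e pq) auto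
      finally have "E (\<lambda>\<pi>. ?w \<pi> * trunc p \<pi>) \<le> cell_sum p * cell_sum q * E w / (R * R2)"
        using R0 by (simp add: field_simps)
      thus ?thesis using False by (simp add: mult_ac)
    qed
  qed
  have "E (\<lambda>\<pi>. w \<pi> * (\<Sum>p\<in>A \<times> A. trunc p \<pi>)\<^sup>2) =
      (\<Sum>p\<in>A \<times> A. \<Sum>q\<in>A \<times> A. E (\<lambda>\<pi>. w \<pi> * (trunc p \<pi> * trunc q \<pi>)))"
    unfolding power2_eq_square sum_product by (simp add: sum_distrib_left E_sum)
  also have "\<dots> \<le> (\<Sum>p\<in>A \<times> A. \<Sum>q\<in>A \<times> A. cell_sum p * cell_sum q * E w / (R * R2) +
      of_bool (overlap q p) * (lev\<^sup>2 * (cell_sum q * E w / R)))"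
    by (intro sum_mono pq)
  also have "\<dots> = H\<^sup>2 * E w / (R * R2) +
      (\<Sum>p\<in>A \<times> A. \<Sum>q\<in>A \<times> A. of_bool (overlap q p) * (lev\<^sup>2 * (cell_sum q * E w / R)))"
    unfolding sum.distrib H_def power2_eq_square sum_product
    by (simp add: sum_distrib_right sum_divide_distrib)
  also have "(\<Sum>p\<in>A \<times> A. \<Sum>q\<in>A \<times> A. of_bool (overlap q p) * (lev\<^sup>2 * (cell_sum q * E w / R))) =
      (\<Sum>q\<in>A \<times> A. \<Sum>p\<in>A \<times> A. of_bool (overlap q p) * (lev\<^sup>2 * (cell_sum q * E w / R)))"
    by (rule sum.swap)
  also have "\<dots> = (\<Sum>q\<in>A \<times> A. real (card {p \<in> A \<times> A. overlap q p}) * (lev\<^sup>2 * (cell_sum q * E w / R)))"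
    using finA by (intro sum.cong refl) (subst sum_distrib_right[symmetric], simp add: Int_def)
  also have "\<dots> \<le> (\<Sum>q\<in>A \<times> A. (4 * n) * (lev\<^sup>2 * (cell_sum q * E w / R)))"
  proof (intro sum_mono mult_right_mono)
    fix q
    have "real (card {p \<in> A \<times> A. overlap q p}) \<le> real (4 * card A)"
      using card_overlap[OF finA, of q] by (simp only: of_nat_le_iff)
    thus "real (card {p \<in> A \<times> A. overlap q p}) \<le> 4 * n" using r by (simp add: r_def A_def)
  qed (use R0 Ew in auto)
  also have "\<dots> = 4 * n * lev\<^sup>2 * (H / R) * E w"
    by (simp add: H_def sum_distrib_left sum_distrib_right sum_divide_distrib mult_ac)
  finally have 1: "E (\<lambda>\<pi>. w \<pi> * (\<Sum>p\<in>A \<times> A. trunc p \<pi>)\<^sup>2) \<le>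
      H\<^sup>2 * E w / (R * R2) + 4 * n * lev\<^sup>2 * \<mu> * E w" by (simp add: \<mu>)
  \<comment> \<open>Numbers of ordered pairs among \<open>r\<close> and among \<open>r - 2\<close>
    indices. The excess of about \<open>4 / n\<close> over 1 is the effect of sampling without
    replacement.\<close>
  have "R / R2 \<le> 1 + 42 / 10 / n"
  proof -
    have "n * (4 * r - 6) \<le> (r + 4) * (4 * r - 6)" using r n_ge by (intro mult_right_mono) auto
    also have "\<dots> \<le> 42 / 10 * R2"
    proof -
      have "42 / 10 * R2 - (r + 4) * (4 * r - 6) = (r * (r - 155) + 246) / 5"
        by (simp add: R2_def field_simps)
      moreover have "0 \<le> (r * (r - 155) + 246) / 5" using r n_ge by simp
      ultimately show ?thesis by linarith
    qed
    finally have "n * (R - R2) \<le> 42 / 10 * R2"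
      by (simp add: R_def R2_def algebra_simps)
    thus ?thesis using R0 n0 by (simp add: field_simps)
  qed
  hence "(H / R)\<^sup>2 * E w * (R / R2) \<le> (H / R)\<^sup>2 * E w * (1 + 42 / 10 / n)"
    using Ew by (intro mult_left_mono) auto
  moreover have "H\<^sup>2 * E w / (R * R2) = (H / R)\<^sup>2 * E w * (R / R2)"
    using R0 by (simp add: power2_eq_square field_simps)
  ultimately have "H\<^sup>2 * E w / (R * R2) \<le> \<mu>\<^sup>2 * (1 + 42 / 10 / n) * E w"
    by (simp add: \<mu> mult_ac)
  with 1 show ?thesis by (simp add: algebra_simps)
qed


text \<open>The terms \<open>\<mu>\<^sup>2\<close> cancel between the second moment and the lower
  bound for the mean. What is left is of order \<open>n + n\<^sup>2 * lev\<^sup>2\<close>, small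
  against \<open>\<mu>\<^sup>2\<close>, which is of order \<open>n\<^sup>2\<close> when
  \<open>\<beta>\<close> is small.\<close>

lemma E_trunc_variance:
  assumes "K \<subseteq> S" "card K \<le> 4" "stable_off S K w" "\<And>\<pi>. \<pi> permutes S \<Longrightarrow> 0 \<le> w \<pi>"
  defines "A \<equiv> S - K"
    and "\<mu> \<equiv> (\<Sum>p\<in>(S - K) \<times> (S - K). cell_sum p) / (real (card (S - K)) * (real (card (S - K)) - 1))"
  shows "E (\<lambda>\<pi>. w \<pi> * ((\<Sum>p\<in>A \<times> A. trunc p \<pi>) - \<mu>)\<^sup>2) \<le> (110 * n + 103 * n\<^sup>2 * lev\<^sup>2) * E w"
proof -
  have finA: "finite A" using fin by (simp add: A_def)
  have Ew: "0 \<le> E w" by (rule E_nonneg[OF assms(4)])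
  have n0: "0 < n" using n_ge by simp
  define r where "r = real (card A)"
  have r: "n - 4 \<le> r" "r \<le> n" using card_rest[OF assms(1,2)] by (auto simp: r_def A_def)
  define R where "R = r * (r - 1)"
  define H where "H = (\<Sum>p\<in>A \<times> A. cell_sum p)"
  let ?V = "\<lambda>\<pi>. \<Sum>p\<in>A \<times> A. trunc p \<pi>"
  have R0: "0 < R" using r n_ge by (auto simp: R_def)
  have \<mu>: "\<mu> = H / R" by (simp add: \<mu>_def H_def R_def r_def A_def)
  have \<mu>0: "0 \<le> \<mu>" unfolding \<mu> H_def using R0 by (intro divide_nonneg_pos sum_nonneg) auto
  have \<mu>_le: "\<mu> \<le> 51 / 10 * n"
    using sum_cell_sum_le[OF assms(1,2)] R0 by (simp add: \<mu> H_def R_def r_def A_def field_simps)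
  have "R * E (\<lambda>\<pi>. w \<pi> * ?V \<pi>) = (\<Sum>p\<in>A \<times> A. R * E (\<lambda>\<pi>. w \<pi> * trunc p \<pi>))"
    by (simp add: sum_distrib_left E_sum)
  also have "\<dots> \<ge> (\<Sum>p\<in>A \<times> A. (cell_sum p - 8 * n * lev\<^sup>2) * E w)"
    unfolding R_def r_def A_def by (intro sum_mono E_trunc_ge assms(1-4))
  also have "(\<Sum>p\<in>A \<times> A. (cell_sum p - 8 * n * lev\<^sup>2) * E w) = (H - r\<^sup>2 * (8 * n * lev\<^sup>2)) * E w"
    by (simp add: sum_distrib_right[symmetric] sum_subtractf H_def r_def card_cartesian_product power2_eq_square)
  finally have "(H - r\<^sup>2 * (8 * n * lev\<^sup>2)) * E w \<le> R * E (\<lambda>\<pi>. w \<pi> * ?V \<pi>)" .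
  moreover have "(R * \<mu> - R * (808 / 100 * n * lev\<^sup>2)) * E w \<le> (H - r\<^sup>2 * (8 * n * lev\<^sup>2)) * E w"
  proof (intro mult_right_mono Ew diff_mono)
    have "r\<^sup>2 \<le> R * (101 / 100)"
    proof -
      have "r * r \<le> r * ((r - 1) * (101 / 100))" using r n_ge by (intro mult_left_mono) auto
      thus ?thesis by (simp add: R_def power2_eq_square algebra_simps)
    qed
    hence "r\<^sup>2 * (8 * n * lev\<^sup>2) \<le> R * (101 / 100) * (8 * n * lev\<^sup>2)"
      using n0 by (intro mult_right_mono) auto
    thus "r\<^sup>2 * (8 * n * lev\<^sup>2) \<le> R * (808 / 100 * n * lev\<^sup>2)" by simp
  qed (use R0 \<mu> in auto)
  ultimately have "R * ((\<mu> - 808 / 100 * n * lev\<^sup>2) * E w) \<le> R * E (\<lambda>\<pi>. w \<pi> * ?V \<pi>)"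
    by (simp add: algebra_simps)
  hence V1: "(\<mu> - 808 / 100 * n * lev\<^sup>2) * E w \<le> E (\<lambda>\<pi>. w \<pi> * ?V \<pi>)"
    using R0 by simp
  have V2: "E (\<lambda>\<pi>. w \<pi> * (?V \<pi>)\<^sup>2) \<le> (\<mu>\<^sup>2 * (1 + 42 / 10 / n) + 4 * n * lev\<^sup>2 * \<mu>) * E w"
    unfolding A_def \<mu>_def by (rule E_trunc_sum_sq[OF assms(1-4)])
  have "E (\<lambda>\<pi>. w \<pi> * (?V \<pi> - \<mu>)\<^sup>2) =
      E (\<lambda>\<pi>. w \<pi> * (?V \<pi>)\<^sup>2 - (2 * \<mu>) * (w \<pi> * ?V \<pi>) + \<mu>\<^sup>2 * w \<pi>)"
    by (intro E_cong) (simp add: power2_diff algebra_simps)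
  also have "\<dots> = E (\<lambda>\<pi>. w \<pi> * (?V \<pi>)\<^sup>2) - (2 * \<mu>) * E (\<lambda>\<pi>. w \<pi> * ?V \<pi>) + \<mu>\<^sup>2 * E w"
    unfolding E_add E_diff E_cmult ..
  also have "\<dots> \<le> (\<mu>\<^sup>2 * (1 + 42 / 10 / n) + 4 * n * lev\<^sup>2 * \<mu>) * E w -
      (2 * \<mu>) * ((\<mu> - 808 / 100 * n * lev\<^sup>2) * E w) + \<mu>\<^sup>2 * E w"
    using \<mu>0 by (intro add_right_mono diff_mono V2 mult_left_mono V1) auto
  also have "\<dots> = (\<mu>\<^sup>2 * (42 / 10 / n) + (2016 / 100 * n * lev\<^sup>2) * \<mu>) * E w"
    by (simp add: algebra_simps power2_eq_square)
  also have "\<dots> \<le> ((51 / 10 * n)\<^sup>2 * (42 / 10 / n) + (2016 / 100 * n * lev\<^sup>2) * (51 / 10 * n)) * E w"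
    using \<mu>0 \<mu>_le n0 by (intro mult_right_mono Ew add_mono mult_left_mono power_mono) auto
  also have "\<dots> = (109242 / 1000 * n + 102816 / 1000 * n\<^sup>2 * lev\<^sup>2) * E w"
    using n0 by (simp add: power2_eq_square field_simps)
  also have "\<dots> \<le> (110 * n + 103 * n\<^sup>2 * lev\<^sup>2) * E w"
    using n0 by (intro mult_right_mono Ew add_mono) auto
  finally show ?thesis .
qed

section \<open>The conditional concentration inequality\<close>

lemma W_rest_transpose:
  assumes "i \<in> S - K" "j \<in> S - K"
  shows "W (S - K) (\<pi> \<circ> Transposition.transpose i j) = W (S - K) \<pi> - D i j \<pi>"
  using fin assms by (intro W_transpose) auto

text \<open>Swapping \<open>i\<close> and \<open>j\<close> negates
  \<open>\<phi> (D i j \<pi>)\<close> and turns the statistic into itself minus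
  \<open>D i j \<pi>\<close>, so the average is half its antisymmetrised form. The stable parameter
  \<open>c\<close> admits test functions that depend on the values on \<open>K\<close>, such as a
  clipping level.\<close>

lemma E_swap_increment:
  assumes "stable_off S K w" "stable_off S K c" "i \<in> S - K" "j \<in> S - K" "\<And>x. \<phi> (- x) = - \<phi> x"
  shows "2 * E (\<lambda>\<pi>. w \<pi> * (\<phi> (D i j \<pi>) * F (c \<pi>) (W (S - K) \<pi>))) =
    E (\<lambda>\<pi>. w \<pi> * (\<phi> (D i j \<pi>) * (F (c \<pi>) (W (S - K) \<pi>) - F (c \<pi>) (W (S - K) \<pi> - D i j \<pi>))))"
proof -
  let ?t = "Transposition.transpose i j"
  have t: "?t permutes S - K" using assms by (intro permutes_swap_id)
  have tS: "?t permutes S" using t by (rule permutes_subset) auto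
  have "E (\<lambda>\<pi>. w \<pi> * (\<phi> (D i j \<pi>) * F (c \<pi>) (W (S - K) \<pi>))) =
      E (\<lambda>\<pi>. w (\<pi> \<circ> ?t) * (\<phi> (D i j (\<pi> \<circ> ?t)) * F (c (\<pi> \<circ> ?t)) (W (S - K) (\<pi> \<circ> ?t))))"
    by (rule E_comp[OF tS, symmetric])
  also have "\<dots> = E (\<lambda>\<pi>. - (w \<pi> * (\<phi> (D i j \<pi>) * F (c \<pi>) (W (S - K) \<pi> - D i j \<pi>))))"
  proof (rule E_cong)
    fix \<pi> assume \<pi>: "\<pi> permutes S"
    show "w (\<pi> \<circ> ?t) * (\<phi> (D i j (\<pi> \<circ> ?t)) * F (c (\<pi> \<circ> ?t)) (W (S - K) (\<pi> \<circ> ?t))) =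
        - (w \<pi> * (\<phi> (D i j \<pi>) * F (c \<pi>) (W (S - K) \<pi> - D i j \<pi>)))"
      unfolding stable_offD[OF assms(1) \<pi> t] stable_offD[OF assms(2) \<pi> t]
        W_rest_transpose[OF assms(3,4)] D_transpose assms(5) by simp
  qed
  finally have "2 * E (\<lambda>\<pi>. w \<pi> * (\<phi> (D i j \<pi>) * F (c \<pi>) (W (S - K) \<pi>))) =
      E (\<lambda>\<pi>. w \<pi> * (\<phi> (D i j \<pi>) * F (c \<pi>) (W (S - K) \<pi>))) -
      E (\<lambda>\<pi>. w \<pi> * (\<phi> (D i j \<pi>) * F (c \<pi>) (W (S - K) \<pi> - D i j \<pi>)))"
    unfolding E_minus by simp
  also have "\<dots> = E (\<lambda>\<pi>. w \<pi> * (\<phi> (D i j \<pi>) * (F (c \<pi>) (W (S - K) \<pi>) - F (c \<pi>) (W (S - K) \<pi> - D i j \<pi>))))"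
    unfolding E_diff[symmetric] by (intro E_cong) (simp add: algebra_simps)
  finally show ?thesis .
qed

text \<open>The half-length \<open>L\<close> varies with the values on \<open>K\<close> and so stays
  under the average: it will be the distance by which a rearrangement within \<open>K\<close> can
  move the statistic. Near \<open>z\<close> each truncated square is at most
  \<open>clip lev (D i j \<pi>)\<close> times an increment of the clipped identity, while that
  function itself never exceeds \<open>L \<pi> + lev\<close>.\<close>

lemma concentration:
  assumes "K \<subseteq> S" "card K \<le> 4" "400 * \<beta> \<le> 1"
    and w: "stable_off S K w" "\<And>\<pi>. \<pi> permutes S \<Longrightarrow> 0 \<le> w \<pi>"
    and L: "stable_off S K L" "\<And>\<pi>. \<pi> permutes S \<Longrightarrow> 0 \<le> L \<pi>"
  shows "E (\<lambda>\<pi>. w \<pi> * of_bool (\<bar>W (S - K) \<pi> - z\<bar> \<le> L \<pi>)) \<le>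
    96 / 10 * E (\<lambda>\<pi>. w \<pi> * (L \<pi> + lev)) + (30 / n + 28 * lev\<^sup>2) * E w"
proof -
  define A where "A = S - K"
  define \<mu> where "\<mu> = (\<Sum>p\<in>A \<times> A. cell_sum p) / (real (card A) * (real (card A) - 1))"
  let ?V = "\<lambda>\<pi>. \<Sum>p\<in>A \<times> A. trunc p \<pi>"
  let ?I = "\<lambda>\<pi>. of_bool (\<bar>W A \<pi> - z\<bar> \<le> L \<pi>) :: real"
  let ?G = "\<lambda>\<pi>. \<Sum>i\<in>A. \<Sum>j\<in>A. clip lev (D i j \<pi>)"
  let ?F = "\<lambda>l x. clip (l + lev) (x - z)"
  have Ew: "0 \<le> E w" by (rule E_nonneg[OF w(2)])
  have n0: "0 < n" using n_ge by simp
  have lev0: "0 \<le> lev" using lev_pos by simp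
  have r: "n - 4 \<le> real (card A)" "real (card A) \<le> n"
    using card_rest[OF assms(1,2)] by (auto simp: A_def)
  have V_nonneg: "0 \<le> ?V \<pi>" for \<pi> by (intro sum_nonneg) auto
  have \<mu>_ge: "192 / 100 * n \<le> \<mu>"
  proof -
    have "real (card A) * (real (card A) - 1) \<le> n * n" "0 < real (card A) * (real (card A) - 1)"
      using r n_ge by (auto intro!: mult_mono)
    hence "192 / 100 * n * (real (card A) * (real (card A) - 1)) \<le> 192 / 100 * n * (n * n)"
      using n0 by (intro mult_left_mono) auto
    also have "\<dots> = 192 / 100 * n ^ 3" by (simp add: power3_eq_cube)
    also have "\<dots> \<le> (\<Sum>p\<in>A \<times> A. cell_sum p)"
      unfolding A_def by (rule sum_cell_sum_ge[OF assms(1-3)])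
    finally show ?thesis
      using \<open>0 < real (card A) * (real (card A) - 1)\<close> unfolding \<mu>_def by (subst pos_le_divide_eq)
  qed
  have I1: "E (\<lambda>\<pi>. w \<pi> * (?V \<pi> * ?I \<pi>)) \<le> 92 / 10 * n * E (\<lambda>\<pi>. w \<pi> * (L \<pi> + lev))"
  proof -
    have "E (\<lambda>\<pi>. w \<pi> * (?V \<pi> * ?I \<pi>)) = (\<Sum>p\<in>A \<times> A. E (\<lambda>\<pi>. w \<pi> * (trunc p \<pi> * ?I \<pi>)))"
      by (simp add: sum_distrib_left sum_distrib_right E_sum)
    also have "\<dots> = (\<Sum>i\<in>A. \<Sum>j\<in>A. E (\<lambda>\<pi>. w \<pi> * (trunc (i, j) \<pi> * ?I \<pi>)))"
      by (simp add: sum.cartesian_product case_prod_beta)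
    also have "\<dots> \<le> (\<Sum>i\<in>A. \<Sum>j\<in>A. E (\<lambda>\<pi>. w \<pi> * (clip lev (D i j \<pi>) *
        (?F (L \<pi>) (W A \<pi>) - ?F (L \<pi>) (W A \<pi> - D i j \<pi>)))))"
    proof (intro sum_mono E_mono mult_left_mono w(2))
      fix i j \<pi> assume \<pi>: "\<pi> permutes S"
      have "?F (L \<pi>) (W A \<pi> - D i j \<pi>) = clip (L \<pi> + lev) ((W A \<pi> - z) - D i j \<pi>)"
        by (simp add: algebra_simps)
      thus "trunc (i, j) \<pi> * ?I \<pi> \<le> clip lev (D i j \<pi>) * (?F (L \<pi>) (W A \<pi>) - ?F (L \<pi>) (W A \<pi> - D i j \<pi>))"
        using clip_increment_ge[OF lev0, of "W A \<pi> - z" "L \<pi>" "D i j \<pi>"]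
          clip_increment_nonneg[OF lev0, of "D i j \<pi>" "L \<pi> + lev" "W A \<pi> - z"]
        by (auto simp: trunc_def)
    qed
    also have "\<dots> = (\<Sum>i\<in>A. \<Sum>j\<in>A. 2 * E (\<lambda>\<pi>. w \<pi> * (clip lev (D i j \<pi>) * ?F (L \<pi>) (W A \<pi>))))"
      unfolding A_def
      by (intro sum.cong refl E_swap_increment[where \<phi> = "clip lev" and F = ?F, symmetric] w L clip_minus lev0)
    also have "\<dots> = 2 * E (\<lambda>\<pi>. w \<pi> * (?G \<pi> * ?F (L \<pi>) (W A \<pi>)))"
      by (simp add: sum_distrib_left sum_distrib_right E_sum)
    also have "\<dots> \<le> 2 * E (\<lambda>\<pi>. (w \<pi> * (L \<pi> + lev)) * \<bar>?G \<pi>\<bar>)"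
    proof (intro mult_left_mono E_mono)
      fix \<pi> assume \<pi>: "\<pi> permutes S"
      have "?G \<pi> * ?F (L \<pi>) (W A \<pi>) \<le> \<bar>?G \<pi>\<bar> * \<bar>?F (L \<pi>) (W A \<pi>)\<bar>"
        by (metis abs_ge_self abs_mult)
      also have "\<dots> \<le> \<bar>?G \<pi>\<bar> * (L \<pi> + lev)"
        using L(2)[OF \<pi>] lev0 by (intro mult_left_mono abs_clip_le) auto
      finally have "w \<pi> * (?G \<pi> * ?F (L \<pi>) (W A \<pi>)) \<le> w \<pi> * (\<bar>?G \<pi>\<bar> * (L \<pi> + lev))"
        by (intro mult_left_mono w(2) \<pi>)
      thus "w \<pi> * (?G \<pi> * ?F (L \<pi>) (W A \<pi>)) \<le> (w \<pi> * (L \<pi> + lev)) * \<bar>?G \<pi>\<bar>"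
        by (simp add: mult_ac)
    qed simp
    also have "\<dots> \<le> 2 * (46 / 10 * n * E (\<lambda>\<pi>. w \<pi> * (L \<pi> + lev)))"
    proof (intro mult_left_mono)
      show "E (\<lambda>\<pi>. (w \<pi> * (L \<pi> + lev)) * \<bar>?G \<pi>\<bar>) \<le> 46 / 10 * n * E (\<lambda>\<pi>. w \<pi> * (L \<pi> + lev))"
        unfolding A_def
      proof (rule E_antisym_sum_abs[where \<phi> = "clip lev", OF assms(1,2)])
        show "stable_off S K (\<lambda>\<pi>. w \<pi> * (L \<pi> + lev))"
          by (rule stable_off_comp2[where h = "\<lambda>x y. x * (y + lev)", OF w(1) L(1)])
      qed (use w L lev0 in \<open>auto simp: clip_minus clip_sq intro!: mult_nonneg_nonneg add_nonneg_nonneg\<close>)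
    qed simp
    finally show ?thesis by simp
  qed
  have I2: "E (\<lambda>\<pi>. w \<pi> * (?V \<pi> - \<mu>)\<^sup>2) \<le> (110 * n + 103 * n\<^sup>2 * lev\<^sup>2) * E w"
    unfolding A_def \<mu>_def by (rule E_trunc_variance[OF assms(1,2) w])
  have "96 / 100 * n * E (\<lambda>\<pi>. w \<pi> * ?I \<pi>) = E (\<lambda>\<pi>. 96 / 100 * n * (w \<pi> * ?I \<pi>))"
    by (rule E_cmult[symmetric])
  also have "\<dots> \<le> E (\<lambda>\<pi>. w \<pi> * (?V \<pi> * ?I \<pi>) + 1 / (384 / 100 * n) * (w \<pi> * (?V \<pi> - \<mu>)\<^sup>2))"
  proof (rule E_mono)
    fix \<pi> assume \<pi>: "\<pi> permutes S"
    \<comment> \<open>Half the lower bound for \<open>\<mu>\<close>: wherever \<open>?V\<close>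
      falls below \<open>c\<close>, it misses \<open>\<mu>\<close> by at least \<open>c\<close>, and
      the Chebyshev term takes over.\<close>
    define c where "c = 96 / 100 * n"
    have c0: "0 < c" using n0 by (simp add: c_def)
    have "c \<le> ?V \<pi> + 1 / (4 * c) * (?V \<pi> - \<mu>)\<^sup>2"
    proof (cases "c \<le> ?V \<pi>")
      case False
      have "4 * c * (c - ?V \<pi>) + (?V \<pi>)\<^sup>2 = (2 * c - ?V \<pi>)\<^sup>2"
        by (simp add: power2_eq_square algebra_simps)
      also have "\<dots> \<le> (\<mu> - ?V \<pi>)\<^sup>2"
        using False \<mu>_ge c0 by (intro power_mono) (auto simp: c_def)
      also have "\<dots> = (?V \<pi> - \<mu>)\<^sup>2" by (rule power2_commute)
      finally have "4 * c * (c - ?V \<pi>) \<le> (?V \<pi> - \<mu>)\<^sup>2"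
        using zero_le_power2[of "?V \<pi>"] by linarith
      hence "c - ?V \<pi> \<le> (?V \<pi> - \<mu>)\<^sup>2 / (4 * c)"
        using c0 by (subst pos_le_divide_eq) (auto simp: mult_ac)
      thus ?thesis by simp
    next
      case True
      have "0 \<le> 1 / (4 * c) * (?V \<pi> - \<mu>)\<^sup>2" using c0 by simp
      with True show ?thesis by linarith
    qed
    hence "c * ?I \<pi> \<le> ?V \<pi> * ?I \<pi> + 1 / (4 * c) * (?V \<pi> - \<mu>)\<^sup>2"
      using c0 by (cases "\<bar>W A \<pi> - z\<bar> \<le> L \<pi>") auto
    hence "w \<pi> * (c * ?I \<pi>) \<le> w \<pi> * (?V \<pi> * ?I \<pi> + 1 / (4 * c) * (?V \<pi> - \<mu>)\<^sup>2)"
      by (intro mult_left_mono w(2) \<pi>)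
    moreover have "1 / (384 / 100 * n) = 1 / (4 * c)" by (simp add: c_def)
    ultimately show "96 / 100 * n * (w \<pi> * ?I \<pi>) \<le>
        w \<pi> * (?V \<pi> * ?I \<pi>) + 1 / (384 / 100 * n) * (w \<pi> * (?V \<pi> - \<mu>)\<^sup>2)"
      unfolding c_def[symmetric] by (simp only: distrib_left mult_ac)
  qed
  also have "\<dots> = E (\<lambda>\<pi>. w \<pi> * (?V \<pi> * ?I \<pi>)) + 1 / (384 / 100 * n) * E (\<lambda>\<pi>. w \<pi> * (?V \<pi> - \<mu>)\<^sup>2)"
    unfolding E_add E_cmult ..
  also have "\<dots> \<le> 92 / 10 * n * E (\<lambda>\<pi>. w \<pi> * (L \<pi> + lev)) +
      1 / (384 / 100 * n) * ((110 * n + 103 * n\<^sup>2 * lev\<^sup>2) * E w)"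
    using n0 by (intro add_mono I1 mult_left_mono I2) auto
  also have "\<dots> = 96 / 100 * n * (920 / 96 * E (\<lambda>\<pi>. w \<pi> * (L \<pi> + lev)) +
      (11000 / 384 * (100 / 96) / n + 10300 / 384 * (100 / 96) * lev\<^sup>2) * E w)"
    using n0 by (simp add: field_simps power2_eq_square)
  finally have "E (\<lambda>\<pi>. w \<pi> * ?I \<pi>) \<le> 920 / 96 * E (\<lambda>\<pi>. w \<pi> * (L \<pi> + lev)) +
      (11000 / 384 * (100 / 96) / n + 10300 / 384 * (100 / 96) * lev\<^sup>2) * E w"
    using n0 by (simp only: mult_le_cancel_left_pos mult_pos_pos zero_less_divide_iff zero_less_numeral simp_thms)
  also have "\<dots> \<le> 96 / 10 * E (\<lambda>\<pi>. w \<pi> * (L \<pi> + lev)) + (30 / n + 28 * lev\<^sup>2) * E w"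
    using n0 w L lev0
    by (intro add_mono mult_right_mono Ew divide_right_mono E_nonneg mult_nonneg_nonneg add_nonneg_nonneg) auto
  finally show ?thesis by (simp add: A_def)
qed

end

section \<open>Normal approximation of the permutation statistic\<close>

text \<open>In the proof \<open>A\<close>, \<open>B\<close> and \<open>t\<close> are the quadratic
  means of the two pairs and of all four numbers. A quadratic mean is at most the cubic mean, and
  \<open>3 * A\<^sup>2 * t \<le> t ^ 3 + 2 * A ^ 3\<close> splits the product. The outcome is a sum
  of single cubes, so that only one-point averages of \<open>b (\<pi> m)\<close> arise
  later.\<close>

lemma sq_sum_times_norm_le:
  fixes x y z w :: real
  shows "(x\<^sup>2 + y\<^sup>2) * sqrt (x\<^sup>2 + y\<^sup>2 + z\<^sup>2 + w\<^sup>2) \<le>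
    5 / 3 * (\<bar>x\<bar> ^ 3 + \<bar>y\<bar> ^ 3) + 1 / 3 * (\<bar>z\<bar> ^ 3 + \<bar>w\<bar> ^ 3)"
proof -
  have pm: "4 * (A ^ 3) \<le> 2 * (p ^ 3 + q ^ 3)"
    if "0 \<le> p" "0 \<le> q" "0 \<le> A" "2 * A\<^sup>2 = p\<^sup>2 + q\<^sup>2" for A p q :: real
  proof -
    have "0 \<le> (p - A)\<^sup>2 * (2 * p + A) + (q - A)\<^sup>2 * (2 * q + A)" using that by simp
    also have "\<dots> = 2 * (p ^ 3 + q ^ 3) - 3 * A * (p\<^sup>2 + q\<^sup>2) + 2 * A ^ 3"
      by (simp add: power2_eq_square power3_eq_cube algebra_simps)
    also have "\<dots> = 2 * (p ^ 3 + q ^ 3) - 4 * A ^ 3"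
      unfolding that(4)[symmetric] by (simp add: power2_eq_square power3_eq_cube)
    finally show ?thesis by simp
  qed
  define A where "A = sqrt ((x\<^sup>2 + y\<^sup>2) / 2)"
  define B where "B = sqrt ((z\<^sup>2 + w\<^sup>2) / 2)"
  define s where "s = sqrt (x\<^sup>2 + y\<^sup>2 + z\<^sup>2 + w\<^sup>2)"
  define t where "t = s / 2"
  have A: "0 \<le> A" "2 * A\<^sup>2 = x\<^sup>2 + y\<^sup>2" and B: "0 \<le> B" "2 * B\<^sup>2 = z\<^sup>2 + w\<^sup>2"
    and s: "0 \<le> s" "s\<^sup>2 = x\<^sup>2 + y\<^sup>2 + z\<^sup>2 + w\<^sup>2"
    by (simp_all add: A_def B_def s_def)
  have A3: "4 * A ^ 3 \<le> 2 * (\<bar>x\<bar> ^ 3 + \<bar>y\<bar> ^ 3)" using pm[of "\<bar>x\<bar>" "\<bar>y\<bar>" A] A by simp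
  have B3: "4 * B ^ 3 \<le> 2 * (\<bar>z\<bar> ^ 3 + \<bar>w\<bar> ^ 3)" using pm[of "\<bar>z\<bar>" "\<bar>w\<bar>" B] B by simp
  have t: "0 \<le> t" "2 * t\<^sup>2 = A\<^sup>2 + B\<^sup>2" using A B s by (simp_all add: t_def power_divide)
  have t3: "4 * t ^ 3 \<le> 2 * (A ^ 3 + B ^ 3)" using pm[of A B t] A B t by simp
  have "0 \<le> (t - A)\<^sup>2 * (t + 2 * A)" using t A by simp
  also have "\<dots> = t ^ 3 - 3 * A\<^sup>2 * t + 2 * A ^ 3"
    by (simp add: power2_eq_square power3_eq_cube algebra_simps)
  finally have "3 * A\<^sup>2 * t \<le> t ^ 3 + 2 * A ^ 3" by simp
  from mult_left_mono[OF this, of "4 / 3"]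
  have "4 / 3 * (3 * A\<^sup>2 * t) \<le> 4 / 3 * t ^ 3 + 8 / 3 * A ^ 3" by (simp add: distrib_left)
  also have "\<dots> \<le> 10 / 3 * A ^ 3 + 2 / 3 * B ^ 3" using t3 by simp
  also have "\<dots> \<le> 5 / 3 * (\<bar>x\<bar> ^ 3 + \<bar>y\<bar> ^ 3) + 1 / 3 * (\<bar>z\<bar> ^ 3 + \<bar>w\<bar> ^ 3)"
    using A3 B3 by (intro add_mono) simp_all
  also have "4 / 3 * (3 * A\<^sup>2 * t) = (x\<^sup>2 + y\<^sup>2) * s"
    unfolding A(2)[symmetric] by (simp add: t_def)
  finally show ?thesis unfolding s_def .
qed

lemma sq_diff_times_norm_le:
  fixes x y z w :: real
  shows "(x - y)\<^sup>2 * sqrt (x\<^sup>2 + y\<^sup>2 + z\<^sup>2 + w\<^sup>2) \<le>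
    10 / 3 * (\<bar>x\<bar> ^ 3 + \<bar>y\<bar> ^ 3) + 2 / 3 * (\<bar>z\<bar> ^ 3 + \<bar>w\<bar> ^ 3)"
proof -
  have "(x - y)\<^sup>2 \<le> 2 * (x\<^sup>2 + y\<^sup>2)"
    using zero_le_power2[of "x + y"] by (simp add: power2_eq_square algebra_simps)
  hence "(x - y)\<^sup>2 * sqrt (x\<^sup>2 + y\<^sup>2 + z\<^sup>2 + w\<^sup>2) \<le>
      (2 * (x\<^sup>2 + y\<^sup>2)) * sqrt (x\<^sup>2 + y\<^sup>2 + z\<^sup>2 + w\<^sup>2)"
    by (rule mult_right_mono) simp
  also have "\<dots> = 2 * ((x\<^sup>2 + y\<^sup>2) * sqrt (x\<^sup>2 + y\<^sup>2 + z\<^sup>2 + w\<^sup>2))" by simp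
  finally show ?thesis using sq_sum_times_norm_le[of x y z w] by linarith
qed

context perm_array
begin

lemma E_eval:
  assumes "i \<in> S"
  shows "E (\<lambda>\<pi>. h (\<pi> i)) = (\<Sum>p\<in>S. h p) / card S"
proof -
  have "E (\<lambda>\<pi>. h (\<pi> k)) = E (\<lambda>\<pi>. h (\<pi> i))" if "k \<in> S" for k
    using E_comp[OF permutes_swap_id[OF assms that], of "\<lambda>\<pi>. h (\<pi> k)"] by simp
  hence "real (card S) * E (\<lambda>\<pi>. h (\<pi> i)) = (\<Sum>k\<in>S. E (\<lambda>\<pi>. h (\<pi> k)))" by simp
  also have "\<dots> = E (\<lambda>\<pi>. \<Sum>k\<in>S. h (\<pi> k))" by (simp add: E_sum)
  also have "\<dots> = E (\<lambda>\<pi>. \<Sum>k\<in>S. h k)" by (intro E_cong sum_over_perm)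
  finally have "real (card S) * E (\<lambda>\<pi>. h (\<pi> i)) = (\<Sum>k\<in>S. h k)" by simp
  moreover have "card S \<noteq> 0" using assms fin by auto
  ultimately show ?thesis by (simp add: field_simps)
qed

text \<open>Only the part of the sum over \<open>K\<close> can change, and Cauchy-Schwarz bounds it
  by norms that ignore how \<open>\<rho>\<close> arranges the values.\<close>

lemma W_compose_near_rest:
  assumes "K \<subseteq> S" "\<rho> permutes K"
  shows "\<bar>W S (\<pi> \<circ> \<rho>) - W (S - K) \<pi>\<bar> \<le> sqrt (\<Sum>m\<in>K. (a m)\<^sup>2) * sqrt (\<Sum>m\<in>K. (b (\<pi> m))\<^sup>2)"
proof -
  have finK: "finite K" using assms(1) fin by (rule finite_subset)
  have "W S (\<pi> \<circ> \<rho>) = (\<Sum>m\<in>S - K. a m * b (\<pi> (\<rho> m))) + (\<Sum>m\<in>K. a m * b (\<pi> (\<rho> m)))"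
    unfolding W_def using sum.subset_diff[OF assms(1) fin] by simp
  also have "(\<Sum>m\<in>S - K. a m * b (\<pi> (\<rho> m))) = W (S - K) \<pi>"
    unfolding W_def using permutes_not_in[OF assms(2)] by (intro sum.cong) auto
  finally have "(W S (\<pi> \<circ> \<rho>) - W (S - K) \<pi>)\<^sup>2 = (\<Sum>m\<in>K. a m * b (\<pi> (\<rho> m)))\<^sup>2"
    by (simp add: comp_def)
  also have "\<dots> \<le> (\<Sum>m\<in>K. (a m)\<^sup>2) * (\<Sum>m\<in>K. (b (\<pi> (\<rho> m)))\<^sup>2)"
    by (rule Cauchy_Schwarz_ineq_sum)
  also have "(\<Sum>m\<in>K. (b (\<pi> (\<rho> m)))\<^sup>2) = (\<Sum>m\<in>K. (b (\<pi> m))\<^sup>2)"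
    using sum.permute[OF assms(2), of "\<lambda>m. (b (\<pi> m))\<^sup>2"] by (simp add: comp_def)
  finally have "sqrt ((W S (\<pi> \<circ> \<rho>) - W (S - K) \<pi>)\<^sup>2) \<le>
      sqrt ((\<Sum>m\<in>K. (a m)\<^sup>2) * (\<Sum>m\<in>K. (b (\<pi> m))\<^sup>2))"
    by (rule real_sqrt_le_mono)
  thus ?thesis by (simp add: real_sqrt_mult)
qed

lemma sum_four_points_le:
  fixes x :: "'i \<Rightarrow> real"
  assumes "\<And>m. 0 \<le> x m"
  shows "(\<Sum>m\<in>{i, j, k, l}. x m) \<le> x i + x j + x k + x l"
proof -
  have ins: "(\<Sum>m\<in>insert t T. x m) \<le> x t + (\<Sum>m\<in>T. x m)" if "finite T" for t T
    using that assms by (cases "t \<in> T") (auto simp: insert_absorb)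
  have "(\<Sum>m\<in>{i, j, k, l}. x m) \<le> x i + (\<Sum>m\<in>{j, k, l}. x m)" by (rule ins) simp
  also have "(\<Sum>m\<in>{j, k, l}. x m) \<le> x j + (\<Sum>m\<in>{k, l}. x m)" by (rule ins) simp
  also have "(\<Sum>m\<in>{k, l}. x m) \<le> x k + (\<Sum>m\<in>{l}. x m)" by (rule ins) simp
  finally show ?thesis by simp
qed

end

context normalized_array
begin

section \<open>Stein's method for the permutation statistic\<close>

abbreviation "\<alpha>3 \<equiv> \<Sum>i\<in>S. \<bar>a i\<bar> ^ 3"
abbreviation "\<gamma>3 \<equiv> (\<Sum>i\<in>S. \<bar>b i\<bar> ^ 3) / n"

text \<open>Composition with a \<open>\<tau>\<close> that carries \<open>k\<close> to
  \<open>i\<close> and \<open>l\<close> to \<open>j\<close> gives both averages the weight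
  \<open>(D i j \<pi>)\<^sup>2\<close>. All arguments of Stein's solution and derivative are then of
  the form \<open>W S (\<pi> \<circ> \<rho>)\<close> with \<open>\<rho>\<close> permuting
  \<open>K\<close>, hence within \<open>N \<pi>\<close> of the statistic on \<open>S - K\<close>, to
  which the conditional estimates apply.\<close>

lemma stein_swap_error:
  assumes ijkl: "i \<in> S" "j \<in> S" "k \<in> S" "l \<in> S" "k \<noteq> l" and small: "400 * \<beta> \<le> 1"
  shows "\<bar>E (\<lambda>\<pi>. (a i - a j)\<^sup>2 * (b (\<pi> k) - b (\<pi> l))\<^sup>2 * stein_der z (W S \<pi>)) -
      E (\<lambda>\<pi>. D i j \<pi> * (stein_sol z (W S \<pi>) - stein_sol z (W S \<pi> - D i j \<pi>)))\<bar>
    \<le> 259 / 15 * (8 * \<gamma>3 * (10 / 3 * (\<bar>a i\<bar> ^ 3 + \<bar>a j\<bar> ^ 3) + 2 / 3 * (\<bar>a k\<bar> ^ 3 + \<bar>a l\<bar> ^ 3)))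
      + (96 / 10 * lev + (30 / n + 28 * lev\<^sup>2)) * E (\<lambda>\<pi>. (D i j \<pi>)\<^sup>2)"
    (is "\<bar>?L1 - ?L2\<bar> \<le> 259 / 15 * ?RN + ?RD * E ?w")
proof (cases "i = j")
  case True
  have "0 \<le> \<gamma>3" using n_ge by (intro divide_nonneg_nonneg sum_nonneg) auto
  hence "0 \<le> 259 / 15 * ?RN" by (intro mult_nonneg_nonneg add_nonneg_nonneg) auto
  thus ?thesis using True by simp
next
  case False
  define K where "K = {i, j, k, l}"
  define Na where "Na = sqrt ((a i)\<^sup>2 + (a j)\<^sup>2 + (a k)\<^sup>2 + (a l)\<^sup>2)"
  define Nb where "Nb = (\<lambda>\<pi>. sqrt ((b (\<pi> i))\<^sup>2 + (b (\<pi> j))\<^sup>2 + (b (\<pi> k))\<^sup>2 + (b (\<pi> l))\<^sup>2))"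
  define N where "N = (\<lambda>\<pi>. Na * Nb \<pi>)"
  let ?wN = "\<lambda>\<pi>. ?w \<pi> * N \<pi>" and ?R = "W (S - K)"
  have K: "K \<subseteq> S" "card K \<le> 4" "finite K" "i \<in> K" "j \<in> K" "k \<in> K" "l \<in> K"
    using ijkl by (auto simp: K_def card_insert_if)
  have N0: "0 \<le> N \<pi>" for \<pi> by (simp add: N_def Na_def Nb_def)
  have stw: "stable_off S K ?w"
    by (rule stable_off_comp[where h = "\<lambda>x. x\<^sup>2", OF stable_off_D[OF K(4,5)]])
  have stNb: "stable_off S K Nb"
    unfolding Nb_def
    by (intro stable_off_comp[where h = sqrt] stable_off_comp2[where h = "(+)"]
        stable_off_eval[where f = "\<lambda>p. (b p)\<^sup>2"] K)
  have stN: "stable_off S K N"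
    unfolding N_def by (rule stable_off_comp[where h = "\<lambda>x. Na * x", OF stNb])
  have stwN: "stable_off S K ?wN"
    by (rule stable_off_comp2[where h = "\<lambda>x y. x * y", OF stw stN])
  have near: "\<bar>W S (\<pi> \<circ> \<rho>) - ?R \<pi>\<bar> \<le> N \<pi>" if "\<rho> permutes K" for \<rho> \<pi>
  proof -
    have "\<bar>W S (\<pi> \<circ> \<rho>) - ?R \<pi>\<bar> \<le> sqrt (\<Sum>m\<in>K. (a m)\<^sup>2) * sqrt (\<Sum>m\<in>K. (b (\<pi> m))\<^sup>2)"
      by (rule W_compose_near_rest[OF K(1) that])
    also have "\<dots> \<le> N \<pi>"
      unfolding N_def Na_def Nb_def K_def
      by (intro mult_mono real_sqrt_le_mono sum_four_points_le real_sqrt_ge_zero sum_nonneg) auto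
    finally show ?thesis .
  qed
  obtain \<tau> where \<tau>: "\<tau> permutes K" "\<tau> k = i" "\<tau> l = j"
    using exists_perm_two_points[OF K(4-7) False ijkl(5)] .
  have \<tau>S: "\<tau> permutes S" using \<tau>(1) K(1) by (rule permutes_subset)
  have "?L1 = E (\<lambda>\<pi>. (a i - a j)\<^sup>2 * (b ((\<pi> \<circ> \<tau>) k) - b ((\<pi> \<circ> \<tau>) l))\<^sup>2 * stein_der z (W S (\<pi> \<circ> \<tau>)))"
    by (rule E_comp[OF \<tau>S, symmetric])
  also have "\<dots> = E (\<lambda>\<pi>. ?w \<pi> * stein_der z (W S (\<pi> \<circ> \<tau>)))"
    by (simp add: \<tau> D_def power_mult_distrib)
  finally have "?L1 - ?L2 = E (\<lambda>\<pi>. ?w \<pi> * stein_der z (W S (\<pi> \<circ> \<tau>)) -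
      D i j \<pi> * (stein_sol z (W S \<pi>) - stein_sol z (W S \<pi> - D i j \<pi>)))"
    unfolding E_diff by simp
  hence "\<bar>?L1 - ?L2\<bar> \<le> E (\<lambda>\<pi>. \<bar>?w \<pi> * stein_der z (W S (\<pi> \<circ> \<tau>)) -
      D i j \<pi> * (stein_sol z (W S \<pi>) - stein_sol z (W S \<pi> - D i j \<pi>))\<bar>)"
    by (simp only: E_abs)
  also have "\<dots> \<le> E (\<lambda>\<pi>. 2 * (?wN \<pi> * \<bar>?R \<pi>\<bar>) + 8 / 3 * ?wN \<pi> + ?w \<pi> * of_bool (\<bar>?R \<pi> - z\<bar> \<le> N \<pi>))"
  proof (rule E_mono)
    fix \<pi> assume \<pi>: "\<pi> permutes S"
    let ?d = "D i j \<pi>" and ?x = "W S \<pi>" and ?y = "W S (\<pi> \<circ> \<tau>)"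
    have x: "\<bar>?x - ?R \<pi>\<bar> \<le> N \<pi>" using near[OF permutes_id, of \<pi>] by simp
    have "?x - ?d = W S (\<pi> \<circ> Transposition.transpose i j)"
      using fin ijkl by (simp add: W_transpose)
    hence x2: "\<bar>?x - ?d - ?R \<pi>\<bar> \<le> N \<pi>"
      using near[OF permutes_swap_id[OF K(4,5)], of \<pi>] by simp
    have "\<bar>?w \<pi> * stein_der z ?y - ?d * (stein_sol z ?x - stein_sol z (?x - ?d))\<bar> =
        \<bar>?d\<bar> * \<bar>stein_sol z ?x - stein_sol z (?x - ?d) - (?x - (?x - ?d)) * stein_der z ?y\<bar>"
      unfolding abs_mult[symmetric] by (subst abs_minus_commute) (simp add: power2_eq_square algebra_simps)
    also have "\<dots> \<le> \<bar>?d\<bar> * (\<bar>?x - (?x - ?d)\<bar> *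
        (2 * N \<pi> * (\<bar>?R \<pi>\<bar> + 4 / 3) + of_bool (\<bar>?R \<pi> - z\<bar> \<le> N \<pi>)))"
      by (intro mult_left_mono stein_sol_increment x x2 near \<tau>) simp
    also have "\<dots> = (\<bar>?d\<bar> * \<bar>?d\<bar>) * (2 * N \<pi> * (\<bar>?R \<pi>\<bar> + 4 / 3) + of_bool (\<bar>?R \<pi> - z\<bar> \<le> N \<pi>))"
      by (simp only: mult.assoc diff_diff_eq2 add_diff_cancel_left')
    also have "\<bar>?d\<bar> * \<bar>?d\<bar> = ?w \<pi>" by (simp add: power2_eq_square)
    also have "?w \<pi> * (2 * N \<pi> * (\<bar>?R \<pi>\<bar> + 4 / 3) + of_bool (\<bar>?R \<pi> - z\<bar> \<le> N \<pi>)) =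
        2 * (?wN \<pi> * \<bar>?R \<pi>\<bar>) + 8 / 3 * ?wN \<pi> + ?w \<pi> * of_bool (\<bar>?R \<pi> - z\<bar> \<le> N \<pi>)"
      by (simp add: algebra_simps)
    finally show "\<bar>?w \<pi> * stein_der z ?y - ?d * (stein_sol z ?x - stein_sol z (?x - ?d))\<bar> \<le> \<dots>" .
  qed
  also have "\<dots> = 2 * E (\<lambda>\<pi>. ?wN \<pi> * \<bar>?R \<pi>\<bar>) + 8 / 3 * E ?wN +
      E (\<lambda>\<pi>. ?w \<pi> * of_bool (\<bar>?R \<pi> - z\<bar> \<le> N \<pi>))"
    unfolding E_add E_cmult ..
  also have "\<dots> \<le> 2 * (5 / 2 * E ?wN) + 8 / 3 * E ?wN +
      (96 / 10 * E (\<lambda>\<pi>. ?w \<pi> * (N \<pi> + lev)) + (30 / n + 28 * lev\<^sup>2) * E ?w)"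
    using N0 by (intro add_mono mult_left_mono E_W_rest_abs[OF K(1,2) stwN]
        concentration[OF K(1,2) small stw _ stN]) auto
  also have "E (\<lambda>\<pi>. ?w \<pi> * (N \<pi> + lev)) = E ?wN + lev * E ?w"
    unfolding E_cmult[symmetric] E_add[symmetric] by (simp add: algebra_simps)
  \<comment> \<open>The coefficient \<open>259 / 15\<close> is \<open>5 + 8 / 3 + 96 / 10\<close>:
    the size of the remaining statistic, the bound \<open>4 / 3\<close> on Stein's solution, and
    concentration.\<close>
  finally have 1: "\<bar>?L1 - ?L2\<bar> \<le> 259 / 15 * E ?wN + ?RD * E ?w"
    by (simp add: algebra_simps)
  have "E ?wN \<le> ?RN"
  proof -
    let ?Pa = "10 / 3 * (\<bar>a i\<bar> ^ 3 + \<bar>a j\<bar> ^ 3) + 2 / 3 * (\<bar>a k\<bar> ^ 3 + \<bar>a l\<bar> ^ 3)"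
    let ?c = "\<lambda>p. \<bar>b p\<bar> ^ 3"
    have "E ?wN \<le> E (\<lambda>\<pi>. ?Pa * (10 / 3 * (?c (\<pi> i) + ?c (\<pi> j)) + 2 / 3 * (?c (\<pi> k) + ?c (\<pi> l))))"
    proof (rule E_mono)
      fix \<pi>
      have "?wN \<pi> = ((a i - a j)\<^sup>2 * Na) * ((b (\<pi> i) - b (\<pi> j))\<^sup>2 * Nb \<pi>)"
        by (simp add: D_def N_def power_mult_distrib mult_ac)
      also have "\<dots> \<le> ?Pa * (10 / 3 * (?c (\<pi> i) + ?c (\<pi> j)) + 2 / 3 * (?c (\<pi> k) + ?c (\<pi> l)))"
        unfolding Na_def Nb_def by (intro mult_mono sq_diff_times_norm_le) auto
      finally show "?wN \<pi> \<le> \<dots>" .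
    qed
    \<comment> \<open>Only the uniform law of each single \<open>\<pi> m\<close> is used here, and
      \<open>8\<close> is \<open>2 * (10 / 3 + 2 / 3)\<close>.\<close>
    also have "\<dots> = ?Pa * (8 * \<gamma>3)"
      unfolding E_cmult E_add using ijkl E_eval[of _ ?c] by (simp add: n_def)
    finally show ?thesis by (simp add: mult_ac)
  qed
  with 1 show ?thesis by linarith
qed

text \<open>Antisymmetry under each swap, with nothing fixed, gives a factor 2. Since
  \<open>a\<close> is centered, the sum of all \<open>D i j \<pi>\<close> is
  \<open>2 * n * W S \<pi>\<close>, which gives the rest.\<close>

lemma stein_identity:
  "4 * n * E (\<lambda>\<pi>. W S \<pi> * F (W S \<pi>)) =
    (\<Sum>i\<in>S. \<Sum>j\<in>S. E (\<lambda>\<pi>. D i j \<pi> * (F (W S \<pi>) - F (W S \<pi> - D i j \<pi>))))"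
proof -
  have "(\<Sum>i\<in>S. \<Sum>j\<in>S. E (\<lambda>\<pi>. D i j \<pi> * (F (W S \<pi>) - F (W S \<pi> - D i j \<pi>)))) =
      (\<Sum>i\<in>S. \<Sum>j\<in>S. 2 * E (\<lambda>\<pi>. D i j \<pi> * F (W S \<pi>)))"
  proof (intro sum.cong refl)
    fix i j assume "i \<in> S" "j \<in> S"
    thus "E (\<lambda>\<pi>. D i j \<pi> * (F (W S \<pi>) - F (W S \<pi> - D i j \<pi>))) = 2 * E (\<lambda>\<pi>. D i j \<pi> * F (W S \<pi>))"
      using E_swap_increment[of "{}" "\<lambda>_. 1" "\<lambda>_. 0" i j "\<lambda>x. x" "\<lambda>_. F"]
      by (simp add: stable_off_const)
  qed
  also have "\<dots> = 2 * E (\<lambda>\<pi>. (\<Sum>i\<in>S. \<Sum>j\<in>S. D i j \<pi>) * F (W S \<pi>))"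
    by (simp add: sum_distrib_left sum_distrib_right E_sum)
  also have "\<dots> = 2 * E (\<lambda>\<pi>. (2 * n) * (W S \<pi> * F (W S \<pi>)))"
  proof -
    have "(\<Sum>i\<in>S. \<Sum>j\<in>S. D i j \<pi>) = 2 * n * W S \<pi>" for \<pi>
      using sum_product_differences[of a "\<lambda>i. b (\<pi> i)" S] by (simp add: D_def W_def sum_a n_def)
    thus ?thesis by (simp add: mult.assoc)
  qed
  finally show ?thesis unfolding E_cmult by simp
qed

text \<open>Both pair sums are constants, \<open>2 * n\<close> for \<open>a\<close> and
  \<open>2 * n * (n - 1) * v\<close> for \<open>b\<close>, so they may be inserted into the average.
  The vanishing diagonal \<open>l = k\<close> is dropped because the swap error is estimated for
  \<open>k \<noteq> l\<close>.\<close>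

lemma stein_der_expansion:
  "4 * n\<^sup>2 * (n - 1) * (v * E (\<lambda>\<pi>. G (W S \<pi>))) =
    (\<Sum>i\<in>S. \<Sum>j\<in>S. \<Sum>k\<in>S. \<Sum>l\<in>S - {k}. E (\<lambda>\<pi>. (a i - a j)\<^sup>2 * (b (\<pi> k) - b (\<pi> l))\<^sup>2 * G (W S \<pi>)))"
proof -
  have "(\<Sum>k\<in>S. \<Sum>l\<in>S - {k}. E (\<lambda>\<pi>. (a i - a j)\<^sup>2 * (b (\<pi> k) - b (\<pi> l))\<^sup>2 * G (W S \<pi>))) =
      (a i - a j)\<^sup>2 * (2 * n * (n - 1) * v * E (\<lambda>\<pi>. G (W S \<pi>)))" for i j
  proof -
    have "(\<Sum>k\<in>S. \<Sum>l\<in>S - {k}. E (\<lambda>\<pi>. (a i - a j)\<^sup>2 * (b (\<pi> k) - b (\<pi> l))\<^sup>2 * G (W S \<pi>))) =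
        (\<Sum>k\<in>S. \<Sum>l\<in>S. E (\<lambda>\<pi>. (a i - a j)\<^sup>2 * (b (\<pi> k) - b (\<pi> l))\<^sup>2 * G (W S \<pi>)))"
      using fin by (intro sum.cong refl sum.mono_neutral_left) auto
    also have "\<dots> = E (\<lambda>\<pi>. \<Sum>k\<in>S. \<Sum>l\<in>S. (a i - a j)\<^sup>2 * (b (\<pi> k) - b (\<pi> l))\<^sup>2 * G (W S \<pi>))"
      by (simp add: E_sum)
    also have "\<dots> = E (\<lambda>\<pi>. ((a i - a j)\<^sup>2 * (2 * n * (n - 1) * v)) * G (W S \<pi>))"
    proof (rule E_cong)
      fix \<pi> assume \<pi>: "\<pi> permutes S"
      have "(\<Sum>k\<in>S. \<Sum>l\<in>S. (a i - a j)\<^sup>2 * (b (\<pi> k) - b (\<pi> l))\<^sup>2 * G (W S \<pi>)) =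
          (a i - a j)\<^sup>2 * (\<Sum>k\<in>S. \<Sum>l\<in>S. (b (\<pi> k) - b (\<pi> l))\<^sup>2) * G (W S \<pi>)"
        by (simp add: sum_distrib_left sum_distrib_right)
      thus "(\<Sum>k\<in>S. \<Sum>l\<in>S. (a i - a j)\<^sup>2 * (b (\<pi> k) - b (\<pi> l))\<^sup>2 * G (W S \<pi>)) =
          ((a i - a j)\<^sup>2 * (2 * n * (n - 1) * v)) * G (W S \<pi>)"
        unfolding sum2_over_perm[OF \<pi>, of "\<lambda>p q. (b p - b q)\<^sup>2"] sum_b_diff .
    qed
    finally show ?thesis unfolding E_cmult by simp
  qed
  thus ?thesis
    by (simp add: sum_distrib_right[symmetric] sum_a_diff) (simp add: power2_eq_square)
qed

text \<open>The comparison is with variance 1 and not with \<open>v\<close>: as Stein's derivative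
  is bounded by 1, this costs just \<open>\<bar>v - 1\<bar>\<close>, a quantity with controlled mean
  when \<open>v\<close> becomes random.\<close>

theorem permutation_normal_approximation:
  assumes small: "400 * \<beta> \<le> 1"
  shows "\<bar>E (\<lambda>\<pi>. of_bool (W S \<pi> \<le> z)) - Phi z\<bar> \<le> \<bar>v - 1\<bar> + 400 * \<beta> + 40 / n"
proof -
  let ?f = "stein_sol z" and ?g = "stein_der z"
  have n0: "0 < n" "0 < n - 1" using n_ge by auto
  define X where "X = (\<lambda>i j. E (\<lambda>\<pi>. D i j \<pi> * (?f (W S \<pi>) - ?f (W S \<pi> - D i j \<pi>))))"
  define Y where "Y = (\<lambda>i j k l. E (\<lambda>\<pi>. (a i - a j)\<^sup>2 * (b (\<pi> k) - b (\<pi> l))\<^sup>2 * ?g (W S \<pi>)))"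
  define c where "c = 96 / 10 * lev + (30 / n + 28 * lev\<^sup>2)"
  define P where "P = (\<lambda>i j k l. 10 / 3 * (\<bar>a i\<bar> ^ 3 + \<bar>a j\<bar> ^ 3) + 2 / 3 * (\<bar>a k\<bar> ^ 3 + \<bar>a l\<bar> ^ 3))"
  define g where "g = \<gamma>3"
  have c0: "0 \<le> c" using lev_pos n0 by (simp add: c_def)
  have cardm: "real (card (S - {k})) = n - 1" if "k \<in> S" for k
    using that fin n_ge by (simp add: n_def of_nat_diff)
  have pairs: "(\<Sum>k\<in>S. \<Sum>l\<in>S - {k}. x) = n * (n - 1) * x" for x :: real
  proof -
    have "(\<Sum>k\<in>S. \<Sum>l\<in>S - {k}. x) = (\<Sum>k\<in>S. (n - 1) * x)"
      by (intro sum.cong refl) (simp only: sum_constant cardm)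
    thus ?thesis by (simp only: sum_constant n_def[symmetric] mult.assoc)
  qed
  have "4 * n\<^sup>2 * (n - 1) * (v * E (\<lambda>\<pi>. ?g (W S \<pi>)) - E (\<lambda>\<pi>. W S \<pi> * ?f (W S \<pi>))) =
      (\<Sum>i\<in>S. \<Sum>j\<in>S. \<Sum>k\<in>S. \<Sum>l\<in>S - {k}. Y i j k l) - n * (n - 1) * (\<Sum>i\<in>S. \<Sum>j\<in>S. X i j)"
    unfolding X_def Y_def stein_der_expansion[symmetric] stein_identity[symmetric]
    by (simp add: algebra_simps power2_eq_square)
  also have "n * (n - 1) * (\<Sum>i\<in>S. \<Sum>j\<in>S. X i j) = (\<Sum>i\<in>S. \<Sum>j\<in>S. \<Sum>k\<in>S. \<Sum>l\<in>S - {k}. X i j)"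
  proof -
    show ?thesis by (simp only: pairs sum_distrib_left)
  qed
  finally have "\<bar>4 * n\<^sup>2 * (n - 1) * (v * E (\<lambda>\<pi>. ?g (W S \<pi>)) - E (\<lambda>\<pi>. W S \<pi> * ?f (W S \<pi>)))\<bar> =
      \<bar>\<Sum>i\<in>S. \<Sum>j\<in>S. \<Sum>k\<in>S. \<Sum>l\<in>S - {k}. Y i j k l - X i j\<bar>"
    by (simp add: sum_subtractf)
  also have "\<dots> \<le> (\<Sum>i\<in>S. \<Sum>j\<in>S. \<Sum>k\<in>S. \<Sum>l\<in>S - {k}. \<bar>Y i j k l - X i j\<bar>)"
    by (intro order.trans[OF sum_abs] sum_mono) simp
  also have "\<dots> \<le> (\<Sum>i\<in>S. \<Sum>j\<in>S. \<Sum>k\<in>S. \<Sum>l\<in>S - {k}.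
      259 / 15 * (8 * g * P i j k l) + c * E (\<lambda>\<pi>. (D i j \<pi>)\<^sup>2))"
    unfolding X_def Y_def c_def g_def P_def by (intro sum_mono stein_swap_error small) auto
  also have "\<dots> = 2072 / 15 * g * (\<Sum>i\<in>S. \<Sum>j\<in>S. \<Sum>k\<in>S. \<Sum>l\<in>S - {k}. P i j k l)
      + c * (n * (n - 1) * (\<Sum>i\<in>S. \<Sum>j\<in>S. E (\<lambda>\<pi>. (D i j \<pi>)\<^sup>2)))"
  proof -
    have *: "259 / 15 * (8 * g * p) = (2072 / 15 * g) * p" for p by simp
    show ?thesis unfolding * sum.distrib pairs sum_distrib_left[symmetric] by (simp only: mult_ac)
  qed
  also have "(\<Sum>i\<in>S. \<Sum>j\<in>S. \<Sum>k\<in>S. \<Sum>l\<in>S - {k}. P i j k l) = 8 * n\<^sup>2 * (n - 1) * \<alpha>3"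
  proof -
    let ?x = "\<lambda>i. \<bar>a i\<bar> ^ 3"
    have 1: "(\<Sum>k\<in>S. \<Sum>l\<in>S - {k}. ?x k) = (n - 1) * \<alpha>3"
      unfolding sum_distrib_left by (intro sum.cong refl) (simp only: sum_constant cardm)
    have "(\<Sum>k\<in>S. \<Sum>l\<in>S - {k}. ?x l) = (\<Sum>k\<in>S. \<alpha>3 - ?x k)"
      using fin by (intro sum.cong refl) (simp add: sum_diff1)
    hence 2: "(\<Sum>k\<in>S. \<Sum>l\<in>S - {k}. ?x l) = (n - 1) * \<alpha>3"
      by (simp add: sum_subtractf n_def algebra_simps)
    have "(\<Sum>k\<in>S. \<Sum>l\<in>S - {k}. P i j k l) =
        n * (n - 1) * (10 / 3 * (?x i + ?x j)) + 2 / 3 * ((n - 1) * \<alpha>3 + (n - 1) * \<alpha>3)" for i j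
      unfolding P_def sum.distrib pairs sum_distrib_left[symmetric] 1 2 by (simp add: field_simps)
    hence "(\<Sum>i\<in>S. \<Sum>j\<in>S. \<Sum>k\<in>S. \<Sum>l\<in>S - {k}. P i j k l) =
        (\<Sum>i\<in>S. \<Sum>j\<in>S. n * (n - 1) * (10 / 3 * (?x i + ?x j)) + 2 / 3 * ((n - 1) * \<alpha>3 + (n - 1) * \<alpha>3))"
      by simp
    also have "\<dots> = n * (n - 1) * (10 / 3 * (n * \<alpha>3 + n * \<alpha>3)) +
        n * (n * (2 / 3 * ((n - 1) * \<alpha>3 + (n - 1) * \<alpha>3)))"
    proof -
      have "(\<Sum>i\<in>S. \<Sum>j\<in>S. e * (?x i + ?x j) + d) = e * (n * \<alpha>3 + n * \<alpha>3) + n * (n * d)" for d e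
        by (simp only: sum.distrib sum_distrib_left[symmetric] sum_constant n_def[symmetric])
      from this[of "n * (n - 1) * (10 / 3)"] show ?thesis by (simp only: mult.assoc)
    qed
    also have "\<dots> = 8 * n\<^sup>2 * (n - 1) * \<alpha>3"
      by (simp add: power2_eq_square field_simps)
    finally show ?thesis .
  qed
  also have "2072 / 15 * g * (8 * n\<^sup>2 * (n - 1) * \<alpha>3) = 16576 / 15 * n\<^sup>2 * (n - 1) * \<beta>"
    using n0 by (simp add: g_def \<beta>_def)
  also have "c * (n * (n - 1) * (\<Sum>i\<in>S. \<Sum>j\<in>S. E (\<lambda>\<pi>. (D i j \<pi>)\<^sup>2))) \<le> c * (n * (n - 1) * (51 / 10 * n))"
    using E_D_sq_sum[of "{}" "\<lambda>_. 1"] n0 c0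
    by (intro mult_left_mono) (auto simp: stable_off_const)
  finally have "\<bar>4 * n\<^sup>2 * (n - 1) * (v * E (\<lambda>\<pi>. ?g (W S \<pi>)) - E (\<lambda>\<pi>. W S \<pi> * ?f (W S \<pi>)))\<bar> \<le>
      4 * n\<^sup>2 * (n - 1) * (4144 / 15 * \<beta> + 51 / 40 * c)"
    by (simp add: field_simps power2_eq_square)
  hence "4 * n\<^sup>2 * (n - 1) * \<bar>v * E (\<lambda>\<pi>. ?g (W S \<pi>)) - E (\<lambda>\<pi>. W S \<pi> * ?f (W S \<pi>))\<bar> \<le>
      4 * n\<^sup>2 * (n - 1) * (4144 / 15 * \<beta> + 51 / 40 * c)"
    using n0 by (simp only: abs_mult abs_of_pos zero_less_mult_iff zero_less_power zero_less_numeral simp_thms)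
  hence 1: "\<bar>v * E (\<lambda>\<pi>. ?g (W S \<pi>)) - E (\<lambda>\<pi>. W S \<pi> * ?f (W S \<pi>))\<bar> \<le> 4144 / 15 * \<beta> + 51 / 40 * c"
    using n0 by (simp only: mult_le_cancel_left_pos zero_less_mult_iff zero_less_power zero_less_numeral simp_thms)
  \<comment> \<open>The smallness assumption turns the quadratic term
    \<open>28 * lev\<^sup>2\<close> into a multiple of \<open>\<beta>\<close>.\<close>
  have 2: "51 / 40 * c \<le> 78 * \<beta> + 40 / n"
  proof -
    have "\<beta> * \<beta> \<le> 1 / 400 * \<beta>" using small \<beta>_pos by (intro mult_right_mono) auto
    hence "28 * lev\<^sup>2 \<le> 252 / 100 * \<beta>" by (simp add: lev_def power2_eq_square)
    moreover have "c = 288 / 5 * \<beta> + 30 * (1 / n) + 28 * lev\<^sup>2" "40 / n = 40 * (1 / n)" "0 < 1 / n"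
      using n0 by (simp_all add: c_def lev_def)
    ultimately show ?thesis using \<beta>_pos by linarith
  qed
  have 3: "\<bar>(1 - v) * E (\<lambda>\<pi>. ?g (W S \<pi>))\<bar> \<le> \<bar>v - 1\<bar> * 1"
  proof -
    have "\<bar>E (\<lambda>\<pi>. ?g (W S \<pi>))\<bar> \<le> E (\<lambda>\<pi>. 1)"
      by (intro order.trans[OF E_abs E_mono] stein_der_bound)
    thus ?thesis unfolding abs_mult by (intro mult_mono) auto
  qed
  have 4: "E (\<lambda>\<pi>. of_bool (W S \<pi> \<le> z)) - Phi z =
      (1 - v) * E (\<lambda>\<pi>. ?g (W S \<pi>)) + (v * E (\<lambda>\<pi>. ?g (W S \<pi>)) - E (\<lambda>\<pi>. W S \<pi> * ?f (W S \<pi>)))"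
  proof -
    have "E (\<lambda>\<pi>. of_bool (W S \<pi> \<le> z)) = E (\<lambda>\<pi>. ?g (W S \<pi>) - W S \<pi> * ?f (W S \<pi>) + Phi z)"
      by (simp add: stein_der_def)
    also have "\<dots> = E (\<lambda>\<pi>. ?g (W S \<pi>)) - E (\<lambda>\<pi>. W S \<pi> * ?f (W S \<pi>)) + Phi z"
      unfolding E_add E_diff by simp
    finally show ?thesis by (simp add: algebra_simps)
  qed
  have 5: "4144 / 15 * \<beta> + 78 * \<beta> \<le> 400 * \<beta>"
    using \<beta>_pos by simp
  have "\<bar>x + y\<bar> \<le> p + r + s"
    if "\<bar>x\<bar> \<le> p * 1" "\<bar>y\<bar> \<le> q + t" "t \<le> u + s" "q + u \<le> r" for x y p q r s t u :: real
    using that by linarith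
  from this[OF 3 1 2 5] show ?thesis unfolding 4 .
qed

end

section \<open>Comparison of normal laws and reduction to the normalized case\<close>

text \<open>The maximum, at \<open>x = 1\<close>, is \<open>1 / sqrt (2 * pi * exp 1)\<close>, about
  0.242. After squaring, the bound follows from \<open>x\<^sup>2 \<le> exp (x\<^sup>2 - 1)\<close>
  and \<open>8 / pi \<le> exp 1\<close>.\<close>

lemma abs_mult_std_normal_density_le: "\<bar>x * std_normal_density x\<bar> \<le> 1 / 4"
proof -
  have "(x * exp (- x\<^sup>2 / 2))\<^sup>2 = x\<^sup>2 * exp (- x\<^sup>2)"
    by (simp add: power_mult_distrib flip: exp_double)
  also have "\<dots> \<le> exp (x\<^sup>2 - 1) * exp (- x\<^sup>2)"
    using exp_ge_add_one_self[of "x\<^sup>2 - 1"] by (intro mult_right_mono) auto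
  also have "\<dots> = exp ((x\<^sup>2 - 1) + - x\<^sup>2)" by (rule exp_add[symmetric])
  also have "\<dots> = 1 / exp 1" by (simp add: exp_minus divide_inverse)
  also have "\<dots> \<le> 1 / (8 / pi)"
  proof (intro divide_left_mono)
    have "1 + 1 / 2 + (1 / 2)\<^sup>2 / 2 \<le> exp (1 / 2 :: real)"
      by (rule exp_lower_Taylor_quadratic) simp
    hence "(13 / 8) * (13 / 8) \<le> exp (1 / 2) * exp (1 / 2 :: real)"
      by (intro mult_mono) (auto simp: power2_eq_square)
    also have "\<dots> = exp 1" by (simp flip: exp_add)
    finally have "169 / 64 \<le> exp (1 :: real)" by simp
    moreover have "8 / pi \<le> 8 / 3.14" using pi_approx by (intro divide_left_mono) auto
    ultimately show "8 / pi \<le> exp 1" by simp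
  qed auto
  finally have "(x * exp (- x\<^sup>2 / 2))\<^sup>2 \<le> pi / 8" by simp
  hence "(x * std_normal_density x)\<^sup>2 \<le> (1 / 4)\<^sup>2"
    by (simp add: std_normal_density_def power_mult_distrib power_divide field_simps)
  hence "\<bar>x * std_normal_density x\<bar>\<^sup>2 \<le> (1 / 4)\<^sup>2" by simp
  thus ?thesis by (rule power2_le_imp_le) simp
qed

text \<open>The second derivative of \<open>Phi\<close> is at most \<open>1 / 4\<close> in absolute
  value. The linear term is kept apart because it disappears in the mean when \<open>h\<close> is
  random and centered.\<close>

lemma Phi_second_order: "\<bar>Phi (y + h) - Phi y - h * std_normal_density y\<bar> \<le> h\<^sup>2 / 8"
proof (cases "h = 0")
  case False
  define diff where "diff = (\<lambda>m::nat. if m = 0 then Phi else if m = 1 then std_normal_density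
     else (\<lambda>x. - (x * std_normal_density x)))"
  have "\<exists>t. (if y + h < y then y + h < t \<and> t < y else y < t \<and> t < y + h) \<and>
    Phi (y + h) = (\<Sum>m<2. (diff m y / fact m) * (y + h - y) ^ m) + (diff 2 t / fact 2) * (y + h - y) ^ 2"
  proof (rule Taylor[where a = "y - \<bar>h\<bar>" and b = "y + \<bar>h\<bar>"])
    show "\<forall>m t. m < 2 \<and> y - \<bar>h\<bar> \<le> t \<and> t \<le> y + \<bar>h\<bar> \<longrightarrow> (diff m has_real_derivative diff (Suc m) t) (at t)"
      by (auto simp: diff_def less_2_cases_iff Phi_deriv std_normal_density_deriv)
  qed (use False in \<open>auto simp: diff_def\<close>)
  then obtain t where "Phi (y + h) = (\<Sum>m<2. (diff m y / fact m) * (y + h - y) ^ m) + (diff 2 t / fact 2) * (y + h - y) ^ 2"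
    by blast
  moreover have two: "{..<2::nat} = {0, 1}" by auto
  ultimately have "Phi (y + h) - Phi y - h * std_normal_density y = - (t * std_normal_density t) / 2 * h\<^sup>2"
    using two by (simp add: diff_def mult.commute)
  hence "\<bar>Phi (y + h) - Phi y - h * std_normal_density y\<bar> = \<bar>t * std_normal_density t\<bar> / 2 * h\<^sup>2"
    by (simp add: abs_mult)
  also have "\<dots> \<le> (1 / 4) / 2 * h\<^sup>2"
    using abs_mult_std_normal_density_le[of t] by (intro mult_right_mono divide_right_mono) auto
  finally show ?thesis by simp
qed simp

text \<open>With \<open>y = z / sqrt x\<close> the derivative in \<open>x\<close> is
  \<open>- (y * std_normal_density y) / (2 * x)\<close>, bounded uniformly in \<open>z\<close> by
  \<open>(1 / 4) / (2 * (2 / 5)) = 5 / 16\<close>.\<close>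

lemma Phi_rescale:
  assumes "2 / 5 \<le> s" "2 / 5 \<le> t"
  shows "\<bar>Phi (z / sqrt s) - Phi (z / sqrt t)\<bar> \<le> 5 / 16 * \<bar>s - t\<bar>"
  using assms
proof (induction s t rule: linorder_wlog)
  case (le s t)
  let ?F = "\<lambda>x. Phi (z / sqrt x)"
  define d where "d = (\<lambda>x. std_normal_density (z / sqrt x) * (- (z / sqrt x) / (2 * x)))"
  have D: "(?F has_real_derivative d x) (at x)" if "0 < x" for x
  proof -
    have "((\<lambda>x. z / sqrt x) has_real_derivative - (z / sqrt x) / (2 * x)) (at x)"
      using that by (auto intro!: derivative_eq_intros simp: field_simps power2_eq_square)
    from DERIV_chain2[OF Phi_deriv this] show ?thesis by (simp add: d_def)
  qed
  show ?case
  proof (cases "s = t")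
    case False
    hence st: "s < t" using le by simp
    obtain x where x: "s < x" "x < t" "?F t - ?F s = (t - s) * d x"
      using MVT2[OF st, of ?F d] D le by auto
    have "\<bar>d x\<bar> = \<bar>(z / sqrt x) * std_normal_density (z / sqrt x)\<bar> / (2 * x)"
      using x le by (simp add: d_def abs_mult)
    also have "\<dots> \<le> (1 / 4) / (2 * (2 / 5))"
      using x le by (intro frac_le abs_mult_std_normal_density_le) auto
    finally have "\<bar>?F t - ?F s\<bar> \<le> (t - s) * (5 / 16)"
      using st unfolding x(3) abs_mult by (intro mult_mono) auto
    thus ?thesis using le by (simp add: abs_minus_commute mult.commute)
  qed simp
next
  case (sym s t)
  thus ?case by (simp add: abs_minus_commute)
qed

section \<open>A Kolmogorov bound below 1 for centered variables\<close>

lemma Phi_le_affine: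
  assumes "0 \<le> y"
  shows "Phi y \<le> 1 / 2 + 2 / 5 * y"
proof -
  have "std_normal_density x \<le> 2 / 5" for x
  proof -
    have "std_normal_density x \<le> std_normal_density 0" by (rule std_normal_density_bound) simp
    also have "\<dots> = 1 / sqrt (2 * pi)" by (simp add: std_normal_density_def)
    also have "\<dots> \<le> 1 / (5 / 2)"
      using pi_approx by (intro divide_left_mono real_le_rsqrt) (auto simp: power2_eq_square)
    finally show ?thesis by simp
  qed
  moreover have "((\<lambda>t. 2 / 5 * t - Phi t) has_real_derivative 2 / 5 - std_normal_density x) (at x)" for x
    by (auto intro!: derivative_eq_intros Phi_deriv)
  ultimately have "2 / 5 * 0 - Phi 0 \<le> 2 / 5 * y - Phi y"
    using assms by (intro DERIV_nonneg_imp_nondecreasing[where f = "\<lambda>t. 2 / 5 * t - Phi t"]) force+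
  thus ?thesis by (simp add: Phi_zero)
qed

text \<open>The subtracted term is Cantelli's lower bound for the distribution function of any
  standardized variable. For \<open>y \<le> 1\<close> the affine bound on \<open>Phi\<close> leaves
  a quadratic with minimum at \<open>2 / 7\<close>; beyond that \<open>Phi y \<le> 1\<close> is
  enough.\<close>

lemma Phi_sub_Cantelli_le:
  assumes "0 \<le> y"
  shows "Phi y - y\<^sup>2 / (1 + y\<^sup>2) \<le> 3 / 5"
proof -
  have p: "0 < 1 + y\<^sup>2" by (rule add_pos_nonneg) auto
  show ?thesis
  proof (cases "y \<le> 1")
    case True
    have "0 \<le> (y - 2 / 7)\<^sup>2 * (7 / 10) + (1 / 10 - 2 / 35)" by simp
    also have "\<dots> = 1 / 10 + 7 / 10 * y\<^sup>2 - 2 / 5 * y" by (simp add: power2_eq_square algebra_simps)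
    finally have 1: "2 / 5 * y \<le> 1 / 10 + 7 / 10 * y\<^sup>2" by simp
    have "y\<^sup>2 * y \<le> y\<^sup>2 * 1" using True by (intro mult_left_mono) auto
    moreover have "(2 / 5 * y - 1 / 10) * (1 + y\<^sup>2) = 2 / 5 * y - 1 / 10 + 2 / 5 * (y\<^sup>2 * y) - 1 / 10 * y\<^sup>2"
      by (simp add: field_simps)
    ultimately have "(2 / 5 * y - 1 / 10) * (1 + y\<^sup>2) \<le> y\<^sup>2"
      using 1 by linarith
    hence "2 / 5 * y - 1 / 10 \<le> y\<^sup>2 / (1 + y\<^sup>2)" using p by (simp add: pos_le_divide_eq)
    thus ?thesis using Phi_le_affine[OF assms] by simp
  next
    case False
    hence "1 \<le> y\<^sup>2" by (simp add: one_le_power)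
    hence "2 / 5 \<le> y\<^sup>2 / (1 + y\<^sup>2)" using p by (simp add: pos_le_divide_eq)
    thus ?thesis using Phi_le_one[of y] by linarith
  qed
qed

lemma cdf_normal_law:
  assumes "0 < s"
  shows "cdf (normal_law 0 s) z = Phi (z / sqrt s)"
proof -
  interpret real_distribution std_normal_distribution by (rule real_dist_normal_dist)
  have "distributed std_normal_distribution lborel (\<lambda>x. x) std_normal_density"
    unfolding distributed_def by (auto simp: distr_id2)
  from normal_density_affine[OF this, of "sqrt s" 0]
  have "distributed std_normal_distribution lborel (\<lambda>x. sqrt s * x) (normal_density 0 (sqrt s))"
    using assms by simp
  hence "distr std_normal_distribution lborel (\<lambda>x. sqrt s * x) = density lborel (normal_density 0 (sqrt s))"
    by (rule distributed_distr_eq_density)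
  hence "cdf (normal_law 0 s) z = measure (distr std_normal_distribution lborel (\<lambda>x. sqrt s * x)) {..z}"
    using assms by (simp add: normal_law_def cdf_def)
  also have "\<dots> = measure std_normal_distribution {x. sqrt s * x \<le> z}"
    by (subst measure_distr) (auto simp: vimage_def)
  also have "{x. sqrt s * x \<le> z} = {..z / sqrt s}"
    using assms by (auto simp: field_simps)
  finally show ?thesis by (simp add: cdf_def)
qed

lemma borel_measurable_Phi [measurable]: "Phi \<in> borel_measurable borel"
  by (intro borel_measurable_continuous_onI continuous_at_imp_continuous_on ballI DERIV_isCont[OF Phi_deriv])

text \<open>The condition on \<open>A\<close> describes the upper tail for \<open>0 < y\<close> and
  the lower tail for \<open>y < 0\<close>. The square of
  \<open>(y * (X w / sqrt s) + 1) / (1 + y\<^sup>2)\<close> is the extremal quadratic majorant of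
  the indicator.\<close>

lemma (in prob_space) Cantelli_square:
  assumes "integrable M X" "integrable M (\<lambda>w. (X w)\<^sup>2)" "expectation X = 0" "expectation (\<lambda>w. (X w)\<^sup>2) = s"
    and "0 < s" and A: "A \<in> events" "\<And>w. w \<in> A \<Longrightarrow> y\<^sup>2 \<le> y * (X w / sqrt s)"
  shows "prob A \<le> 1 / (1 + y\<^sup>2)"
proof -
  have p: "0 < 1 + y\<^sup>2" by (rule add_pos_nonneg) auto
  let ?q = "\<lambda>w. (y\<^sup>2 / s) * (X w)\<^sup>2 + (2 * y / sqrt s) * X w + 1"
  have q: "?q w = (y * (X w / sqrt s) + 1)\<^sup>2" for w
    using assms(5) by (simp add: power2_sum power_mult_distrib power_divide)
  have "prob A = expectation (indicator A)" using A by simp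
  also have "\<dots> \<le> expectation (\<lambda>w. ?q w / (1 + y\<^sup>2)\<^sup>2)"
  proof (rule integral_mono)
    fix w assume "w \<in> space M"
    show "indicat_real A w \<le> ?q w / (1 + y\<^sup>2)\<^sup>2"
    proof (cases "w \<in> A")
      case True
      have "(1 + y\<^sup>2)\<^sup>2 \<le> (y * (X w / sqrt s) + 1)\<^sup>2"
        using A(2)[OF True] p by (intro power_mono) auto
      thus ?thesis using True p unfolding q by simp
    next
      case False
      thus ?thesis unfolding q by simp
    qed
  next
    show "integrable M (indicat_real A)"
      using A(1) by (intro integrable_real_indicator) (auto simp: less_top[symmetric])
  qed (use assms(1,2) in simp)
  also have "\<dots> = (y\<^sup>2 + 1) / (1 + y\<^sup>2)\<^sup>2"
    using assms(1,2,5) by (simp add: assms(3,4) prob_space)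
  also have "\<dots> = 1 / (1 + y\<^sup>2)"
    using p by (simp add: power2_eq_square add.commute)
  finally show ?thesis .
qed

text \<open>
  Since the constant is less than 1, the main theorem is trivial unless
  \<open>(\<bar>\<delta>\<^sub>0\<bar> + 1/n) (\<Sum> \<theta>\<^sub>i)\<^sup>2 < 3/5\<close>, which keeps all variances away from 0.
\<close>

lemma (in prob_space) centered_Kolmogorov_bound:
  assumes "integrable M X" "integrable M (\<lambda>w. (X w)\<^sup>2)" "expectation X = 0" "expectation (\<lambda>w. (X w)\<^sup>2) = s"
    and "0 < s"
  shows "\<bar>prob {w \<in> space M. X w \<le> z} - Phi (z / sqrt s)\<bar> \<le> 3 / 5"
proof -
  define y where "y = z / sqrt s"
  have [measurable]: "X \<in> borel_measurable M" using assms(1) by auto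
  have z: "X w \<le> z \<longleftrightarrow> X w / sqrt s \<le> y" for w
    using assms(5) by (simp add: y_def divide_le_cancel)
  have p: "0 < 1 + y\<^sup>2" by (rule add_pos_nonneg) auto
  have c: "1 - 1 / (1 + y\<^sup>2) = y\<^sup>2 / (1 + y\<^sup>2)" using p by (simp add: field_simps)
  show ?thesis
  proof (cases "0 \<le> y")
    case True
    have "prob {w \<in> space M. \<not> X w \<le> z} \<le> 1 / (1 + y\<^sup>2)"
    proof (rule Cantelli_square[OF assms])
      fix w assume "w \<in> {w \<in> space M. \<not> X w \<le> z}"
      hence "y * y \<le> y * (X w / sqrt s)" using True z[of w] by (intro mult_left_mono) auto
      thus "y\<^sup>2 \<le> y * (X w / sqrt s)" by (simp add: power2_eq_square)
    qed measurable
    moreover have "prob {w \<in> space M. \<not> X w \<le> z} = 1 - prob {w \<in> space M. X w \<le> z}"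
      by (rule prob_neg) measurable
    moreover have "1 / 2 \<le> Phi y" using Phi_mono[OF True] by (simp add: Phi_zero)
    moreover have "prob {w \<in> space M. X w \<le> z} \<le> 1" by simp
    ultimately show ?thesis
      using Phi_sub_Cantelli_le[OF True] c unfolding y_def[symmetric] by linarith
  next
    case False
    have "prob {w \<in> space M. X w \<le> z} \<le> 1 / (1 + y\<^sup>2)"
    proof (rule Cantelli_square[OF assms])
      fix w assume "w \<in> {w \<in> space M. X w \<le> z}"
      hence "y * y \<le> y * (X w / sqrt s)" using False z[of w] by (intro mult_left_mono_neg) auto
      thus "y\<^sup>2 \<le> y * (X w / sqrt s)" by (simp add: power2_eq_square)
    qed measurable
    moreover have "Phi y \<le> 1 / 2" using Phi_mono[of y 0] False by (simp add: Phi_zero)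
    moreover have "0 \<le> prob {w \<in> space M. X w \<le> z}" by simp
    moreover have "Phi (- y) - y\<^sup>2 / (1 + y\<^sup>2) \<le> 3 / 5"
      using Phi_sub_Cantelli_le[of "- y"] False by simp
    ultimately show ?thesis
      using c Phi_minus[of y] Phi_nonneg[of y] unfolding y_def[symmetric] by linarith
  qed
qed

text \<open>The last term is linear in \<open>x - m\<close> and cancels in the sum if
  \<open>m\<close> is the mean of the family. Centering then costs a factor \<open>3 / 2\<close> in
  the sum of cubes, where convexity alone would give 8.\<close>

lemma centered_cube_le:
  fixes x m :: real
  shows "\<bar>x - m\<bar> ^ 3 \<le> 3 / 2 * \<bar>x\<bar> ^ 3 - 6 * (m * \<bar>m\<bar>) * (x - m)"
proof -
  have pos: "\<bar>x - m\<bar> ^ 3 \<le> 3 / 2 * \<bar>x\<bar> ^ 3 - 6 * (m * m) * (x - m)" if m: "0 \<le> m" for x m :: real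
  proof -
    consider "x \<le> 0" | "0 \<le> x" "x \<le> m" | "m \<le> x" by linarith
    thus ?thesis
    proof cases
      case 1
      define t where "t = - x"
      have t: "0 \<le> t" using 1 by (simp add: t_def)
      \<comment> \<open>The cubic has its local minimum at \<open>t = (2 + sqrt 2) * m\<close>. The
        rational \<open>171 / 50\<close> is close to \<open>2 + sqrt 2\<close> and leaves positive
        remainders.\<close>
      have "0 \<le> (t - 171 / 50 * m)\<^sup>2 * (t + 21 / 25 * m) + 123 / 2500 * (m * m) * t + 10939 / 62500 * (m * m * m)"
        using m t by (intro add_nonneg_nonneg mult_nonneg_nonneg) auto
      also have "\<dots> = t * t * t - 6 * (m * (t * t)) + 6 * (m * m * t) + 10 * (m * m * m)"
        by (simp add: power2_eq_square field_simps)
      finally show ?thesis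
        using 1 m by (simp add: t_def power3_eq_cube abs_if algebra_simps)
    next
      case 2
      have "(m - x) * (m - x) * (m - x) \<le> m * m * (m - x)"
        using 2 by (intro mult_mono) auto
      moreover have "0 \<le> m * m * (m - x)" "0 \<le> x * x * x" using 2 by auto
      moreover have "\<bar>x - m\<bar> ^ 3 = (m - x) * (m - x) * (m - x)" "\<bar>x\<bar> ^ 3 = x * x * x"
        using 2 by (auto simp: power3_eq_cube)
      moreover have "6 * (m * m) * (x - m) = - (6 * (m * m * (m - x)))" by (simp add: algebra_simps)
      ultimately show ?thesis by linarith
    next
      case 3
      define s where "s = x - m"
      have s: "0 \<le> s" using 3 by (simp add: s_def)
      have "0 \<le> 1 / 2 * (s * s * s) + m * (9 / 2 * (s - m / 6)\<^sup>2 + 11 / 8 * (m * m))"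
        using m s by (intro add_nonneg_nonneg mult_nonneg_nonneg) auto
      also have "\<dots> = 1 / 2 * (s * s * s) + 9 / 2 * (m * (s * s)) - 3 / 2 * (m * m * s) + 3 / 2 * (m * m * m)"
        by (simp add: power2_eq_square field_simps)
      finally have "s * s * s \<le> 3 / 2 * ((s + m) * (s + m) * (s + m)) - 6 * (m * m) * s"
        by (simp add: algebra_simps)
      moreover have "\<bar>x - m\<bar> = s" "\<bar>x\<bar> = s + m" "x - m = s" using 3 m by (auto simp: s_def)
      ultimately show ?thesis by (simp only: power3_eq_cube)
    qed
  qed
  show ?thesis
  proof (cases "0 \<le> m")
    case True
    thus ?thesis using pos[OF True, of x] by simp
  next
    case False
    thus ?thesis using pos[of "- m" "- x"] by (simp add: abs_minus_commute algebra_simps)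
  qed
qed

lemma sum_centered_cube_le:
  fixes x :: "'i \<Rightarrow> real"
  assumes "(\<Sum>i\<in>S. x i) = real (card S) * m"
  shows "(\<Sum>i\<in>S. \<bar>x i - m\<bar> ^ 3) \<le> 3 / 2 * (\<Sum>i\<in>S. \<bar>x i\<bar> ^ 3)"
proof -
  have "(\<Sum>i\<in>S. \<bar>x i - m\<bar> ^ 3) \<le> (\<Sum>i\<in>S. 3 / 2 * \<bar>x i\<bar> ^ 3 - 6 * (m * \<bar>m\<bar>) * (x i - m))"
    by (intro sum_mono centered_cube_le)
  also have "\<dots> = 3 / 2 * (\<Sum>i\<in>S. \<bar>x i\<bar> ^ 3) - 6 * (m * \<bar>m\<bar>) * ((\<Sum>i\<in>S. x i) - real (card S) * m)"
    by (simp only: sum_subtractf sum_distrib_left[symmetric] sum_constant)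
  finally show ?thesis using assms by simp
qed

text \<open>The claim is trivial once its right side reaches 1, which supplies the bounds on
  \<open>v\<close> and on the third-moment ratio needed for the normalized array. Centering shifts
  the statistic by \<open>m * T\<close>; only the coefficients are rescaled, by the deterministic
  \<open>sqrt u\<close>.\<close>

lemma linear_permutation_statistic_bound:
  fixes x \<theta> :: "'i \<Rightarrow> real"
  assumes "finite S" "1000 \<le> card S" "(\<Sum>i\<in>S. (\<theta> i)\<^sup>2) = 1"
  defines "n \<equiv> real (card S)"
  defines "T \<equiv> \<Sum>i\<in>S. \<theta> i" and "m \<equiv> (\<Sum>i\<in>S. x i) / n"
  defines "v \<equiv> ((\<Sum>i\<in>S. (x i)\<^sup>2) - n * m\<^sup>2) / (n - 1)"
  assumes u: "2 / 5 \<le> u" "u = 1 - T\<^sup>2 / n"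
  shows "\<bar>perm_avg S (\<lambda>\<pi>. of_bool ((\<Sum>i\<in>S. \<theta> i * x (\<pi> i)) \<le> z)) - Phi ((z - m * T) / sqrt u)\<bar>
    \<le> 4 * \<bar>v - 1\<bar> + 3600 * ((\<Sum>i\<in>S. \<bar>\<theta> i\<bar> ^ 3) * ((\<Sum>i\<in>S. \<bar>x i\<bar> ^ 3) / n)) + 40 / n"
    (is "\<bar>?P - ?Q\<bar> \<le> 4 * \<bar>v - 1\<bar> + 3600 * ?B + 40 / n")
proof -
  have n: "1000 \<le> n" using assms(2) by (simp add: n_def)
  have B0: "0 \<le> ?B" using n by (intro mult_nonneg_nonneg divide_nonneg_nonneg sum_nonneg) auto
  have n40: "0 \<le> 40 / n" using n by simp
  interpret P: perm_array S \<theta> x by standard (rule assms(1))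
  have P01: "0 \<le> ?P" "?P \<le> 1"
    using P.E_mono[of "\<lambda>_. 0" "\<lambda>\<pi>. of_bool ((\<Sum>i\<in>S. \<theta> i * x (\<pi> i)) \<le> z)"]
      P.E_mono[of "\<lambda>\<pi>. of_bool ((\<Sum>i\<in>S. \<theta> i * x (\<pi> i)) \<le> z)" "\<lambda>_. 1"] by auto
  have "\<bar>p - q\<bar> \<le> 1" if "0 \<le> p" "p \<le> 1" "0 \<le> q" "q \<le> 1" for p q :: real
    using that by linarith
  from this[OF P01 Phi_nonneg Phi_le_one] have le1: "\<bar>?P - ?Q\<bar> \<le> 1" .
  show ?thesis
  proof (cases "\<bar>v - 1\<bar> \<le> 1 / 4")
    case False
    hence "1 \<le> 4 * \<bar>v - 1\<bar>" by simp
    thus ?thesis using le1 B0 n40 by linarith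
  next
    case v: True
    have su: "0 < sqrt u" using u(1) by simp
    define a where "a = (\<lambda>i. (\<theta> i - T / n) / sqrt u)"
    define b where "b = (\<lambda>i. x i - m)"
    have sx: "(\<Sum>i\<in>S. x i) = n * m" using n by (simp add: m_def)
    have sT: "(\<Sum>i\<in>S. \<theta> i) = n * (T / n)" using n by (simp add: T_def)
    interpret N: normalized_array S a b v n
    proof
      show "n = real (card S)" by (simp add: n_def)
      show "1000 \<le> n" by (rule n)
      show "(\<Sum>i\<in>S. a i) = 0"
        using sT by (simp add: a_def sum_divide_distrib[symmetric] sum_subtractf n_def[symmetric])
      have "(\<Sum>i\<in>S. (\<theta> i - T / n)\<^sup>2) = u"
      proof -
        have "(\<Sum>i\<in>S. (\<theta> i - T / n)\<^sup>2) = (\<Sum>i\<in>S. (\<theta> i)\<^sup>2 - (2 * (T / n)) * \<theta> i + (T / n)\<^sup>2)"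
          by (intro sum.cong refl) (simp add: power2_diff)
        also have "\<dots> = 1 - (2 * (T / n)) * T + n * (T / n)\<^sup>2"
          by (simp only: sum.distrib sum_subtractf sum_distrib_left[symmetric] assms(3) T_def[symmetric]
            sum_constant n_def[symmetric])
        also have "\<dots> = u" using n by (simp add: u(2) power2_eq_square)
        finally show ?thesis .
      qed
      thus "(\<Sum>i\<in>S. (a i)\<^sup>2) = 1"
        using u(1) by (simp add: a_def power_divide sum_divide_distrib[symmetric])
      show "(\<Sum>i\<in>S. b i) = 0"
        using sx by (simp add: b_def sum_subtractf n_def[symmetric])
      have "(\<Sum>i\<in>S. (b i)\<^sup>2) = (\<Sum>i\<in>S. (x i)\<^sup>2 - (2 * m) * x i + m\<^sup>2)"
        by (intro sum.cong refl) (simp add: b_def power2_diff)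
      also have "\<dots> = (\<Sum>i\<in>S. (x i)\<^sup>2) - (2 * m) * (n * m) + n * m\<^sup>2"
        by (simp only: sum.distrib sum_subtractf sum_distrib_left[symmetric] sx sum_constant n_def[symmetric])
      also have "\<dots> = (n - 1) * v" using n by (simp add: v_def power2_eq_square)
      finally show "(\<Sum>i\<in>S. (b i)\<^sup>2) = (n - 1) * v" .
      show "3 / 4 \<le> v" "v \<le> 5 / 4" using v by linarith+
    qed
    \<comment> \<open>The \<open>9\<close> is \<open>4 * (3 / 2) * (3 / 2)\<close>:
      \<open>u * sqrt u\<close> is at least \<open>1 / 4\<close>, and centering costs
      \<open>3 / 2\<close> for the coefficients and for the values. With
      \<open>400 * N.\<beta>\<close> it yields \<open>3600\<close>.\<close>
    have \<beta>: "N.\<beta> \<le> 9 * ?B"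
    proof -
      have "25 / 64 \<le> u" using u(1) by simp
      hence "5 / 8 \<le> sqrt u" by (intro real_le_rsqrt) (auto simp: power2_eq_square)
      hence "(2 / 5) * (5 / 8) \<le> u * sqrt u" using u(1) by (intro mult_mono) auto
      hence su3: "1 / 4 \<le> sqrt u ^ 3" using u(1) by (simp add: power3_eq_cube)
      have "(\<Sum>i\<in>S. \<bar>a i\<bar> ^ 3) = (\<Sum>i\<in>S. \<bar>\<theta> i - T / n\<bar> ^ 3) / sqrt u ^ 3"
        using su by (simp add: a_def abs_divide power_divide sum_divide_distrib)
      also have "\<dots> \<le> (3 / 2 * (\<Sum>i\<in>S. \<bar>\<theta> i\<bar> ^ 3)) / (1 / 4)"
        using su3 sT by (intro frac_le sum_centered_cube_le mult_nonneg_nonneg sum_nonneg) (auto simp: n_def)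
      finally have "(\<Sum>i\<in>S. \<bar>a i\<bar> ^ 3) \<le> 6 * (\<Sum>i\<in>S. \<bar>\<theta> i\<bar> ^ 3)" by simp
      moreover have "(\<Sum>i\<in>S. \<bar>b i\<bar> ^ 3) \<le> 3 / 2 * (\<Sum>i\<in>S. \<bar>x i\<bar> ^ 3)"
        unfolding b_def using sx by (intro sum_centered_cube_le) (simp add: n_def)
      ultimately have "N.\<beta> \<le> (6 * (\<Sum>i\<in>S. \<bar>\<theta> i\<bar> ^ 3)) * (3 / 2 * (\<Sum>i\<in>S. \<bar>x i\<bar> ^ 3)) / n"
        unfolding N.\<beta>_def using n by (intro divide_right_mono mult_mono sum_nonneg mult_nonneg_nonneg) auto
      thus ?thesis by simp
    qed
    show ?thesis
    proof (cases "400 * N.\<beta> \<le> 1")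
      case False
      hence "1 \<le> 3600 * ?B" using \<beta> by linarith
      moreover have "0 \<le> 4 * \<bar>v - 1\<bar>" by simp
      ultimately show ?thesis using le1 n40 by linarith
    next
      case True
      have "?P = perm_avg S (\<lambda>\<pi>. of_bool (N.W S \<pi> \<le> (z - m * T) / sqrt u))"
      proof (rule N.E_cong)
        fix \<pi> assume \<pi>: "\<pi> permutes S"
        have s\<pi>: "(\<Sum>i\<in>S. x (\<pi> i)) = n * m" using N.sum_over_perm[OF \<pi>, of x] sx by simp
        have "N.W S \<pi> * sqrt u = (\<Sum>i\<in>S. (\<theta> i - T / n) * (x (\<pi> i) - m))"
          unfolding N.W_def sum_distrib_right
          by (intro sum.cong refl) (use su in \<open>simp add: a_def b_def\<close>)
        also have "\<dots> = (\<Sum>i\<in>S. \<theta> i * x (\<pi> i) - m * \<theta> i - (T / n) * x (\<pi> i) + (T / n) * m)"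
          by (intro sum.cong refl) (simp add: algebra_simps)
        also have "\<dots> = (\<Sum>i\<in>S. \<theta> i * x (\<pi> i)) - m * T - (T / n) * (n * m) + n * ((T / n) * m)"
          by (simp only: sum.distrib sum_subtractf sum_distrib_left[symmetric] s\<pi> T_def[symmetric]
              sum_constant n_def[symmetric]) (simp only: mult_ac)
        also have "\<dots> = (\<Sum>i\<in>S. \<theta> i * x (\<pi> i)) - m * T" using n by simp
        finally have "(\<Sum>i\<in>S. \<theta> i * x (\<pi> i)) \<le> z \<longleftrightarrow> N.W S \<pi> * sqrt u \<le> z - m * T" by simp
        also have "\<dots> \<longleftrightarrow> N.W S \<pi> \<le> (z - m * T) / sqrt u"
          by (rule pos_le_divide_eq[OF su, symmetric])
        finally show "of_bool ((\<Sum>i\<in>S. \<theta> i * x (\<pi> i)) \<le> z) =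
            (of_bool (N.W S \<pi> \<le> (z - m * T) / sqrt u) :: real)" by simp
      qed
      hence "\<bar>?P - ?Q\<bar> \<le> \<bar>v - 1\<bar> + 400 * N.\<beta> + 40 / n"
        using N.permutation_normal_approximation[OF True] by simp
      moreover have "\<bar>v - 1\<bar> \<le> 4 * \<bar>v - 1\<bar>" by simp
      ultimately show ?thesis using \<beta> by linarith
    qed
  qed
qed

section \<open>Exchangeable vectors\<close>

locale exchangeable_vector = prob_space M for M :: "'a measure" +
  fixes n :: nat and X :: "nat \<Rightarrow> 'a \<Rightarrow> real" and \<delta> :: real
  assumes n_ge: "2 \<le> n"
    and X_meas: "\<And>i. i \<in> {1..n} \<Longrightarrow> X i \<in> borel_measurable M"
    and exch: "exchangeable M n X"
    and mean_X1: "expectation (X 1) = 0"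
    and square_X1: "expectation (\<lambda>w. (X 1 w)\<^sup>2) = 1"
    and cube_X1: "integrable M (\<lambda>w. \<bar>X 1 w\<bar> ^ 3)"
    and \<delta>_def: "\<delta> = expectation (\<lambda>w. X 1 w * X 2 w)"
begin

abbreviation vec :: "(nat \<Rightarrow> nat) \<Rightarrow> 'a \<Rightarrow> nat \<Rightarrow> real" where
  "vec p w \<equiv> \<lambda>i\<in>{1..n}. X (p i) w"

lemma vec_measurable:
  assumes "p permutes {1..n}"
  shows "vec p \<in> M \<rightarrow>\<^sub>M (\<Pi>\<^sub>M i\<in>{1..n}. borel)"
  using permutes_in_image[OF assms] by (intro measurable_restrict X_meas) auto

lemma vec_distr:
  assumes "p permutes {1..n}"
  shows "distr M (\<Pi>\<^sub>M i\<in>{1..n}. borel) (vec p) = distr M (\<Pi>\<^sub>M i\<in>{1..n}. borel) (vec id)"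
  using exch assms unfolding exchangeable_def by simp

lemma exchange_integral:
  fixes g :: "(nat \<Rightarrow> real) \<Rightarrow> real"
  assumes p: "p permutes {1..n}" and g: "g \<in> borel_measurable (\<Pi>\<^sub>M i\<in>{1..n}. borel)"
  shows "expectation (\<lambda>w. g (vec p w)) = expectation (\<lambda>w. g (vec id w))"
    and "integrable M (\<lambda>w. g (vec p w)) \<longleftrightarrow> integrable M (\<lambda>w. g (vec id w))"
proof -
  note m = vec_measurable[OF p] vec_measurable[OF permutes_id]
  show "expectation (\<lambda>w. g (vec p w)) = expectation (\<lambda>w. g (vec id w))"
    using integral_distr[OF m(1) g] integral_distr[OF m(2) g] vec_distr[OF p] by simp
  show "integrable M (\<lambda>w. g (vec p w)) \<longleftrightarrow> integrable M (\<lambda>w. g (vec id w))"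
    using integrable_distr_eq[OF m(1) g] integrable_distr_eq[OF m(2) g] vec_distr[OF p] by simp
qed

lemma exchange_single:
  fixes h :: "real \<Rightarrow> real"
  assumes i: "i \<in> {1..n}" and h: "h \<in> borel_measurable borel"
  shows "expectation (\<lambda>w. h (X i w)) = expectation (\<lambda>w. h (X 1 w))"
    and "integrable M (\<lambda>w. h (X i w)) \<longleftrightarrow> integrable M (\<lambda>w. h (X 1 w))"
proof -
  let ?p = "Transposition.transpose 1 i"
  have 1: "1 \<in> {1..n}" using n_ge by simp
  have p: "?p permutes {1..n}" using i 1 by (intro permutes_swap_id)
  have g: "(\<lambda>y. h (y 1)) \<in> borel_measurable (\<Pi>\<^sub>M i\<in>{1..n}. borel)"
    using h 1 by measurable
  show "expectation (\<lambda>w. h (X i w)) = expectation (\<lambda>w. h (X 1 w))"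
    "integrable M (\<lambda>w. h (X i w)) \<longleftrightarrow> integrable M (\<lambda>w. h (X 1 w))"
    using exchange_integral[OF p g] 1 by simp_all
qed

lemma exchange_pair:
  assumes ij: "i \<in> {1..n}" "j \<in> {1..n}" "i \<noteq> j"
  shows "expectation (\<lambda>w. X i w * X j w) = \<delta>"
proof -
  have 12: "1 \<in> {1..n}" "2 \<in> {1..n}" "(1::nat) \<noteq> 2" using n_ge by auto
  obtain p where p: "p permutes {1..n}" "p 1 = i" "p 2 = j"
    using exists_perm_two_points[OF ij(1,2) 12(1,2) ij(3) 12(3)] .
  have g: "(\<lambda>y. y 1 * y 2) \<in> borel_measurable (\<Pi>\<^sub>M i\<in>{1..n}. (borel :: real measure))"
    using 12 by measurable
  show ?thesis
    using exchange_integral(1)[OF p(1) g] 12 p(2,3) by (simp add: \<delta>_def)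
qed

lemma cube_integrable: "i \<in> {1..n} \<Longrightarrow> integrable M (\<lambda>w. \<bar>X i w\<bar> ^ 3)"
  using exchange_single(2)[of i "\<lambda>x. \<bar>x\<bar> ^ 3"] cube_X1 by simp

lemma square_integrable:
  assumes "i \<in> {1..n}"
  shows "integrable M (\<lambda>w. (X i w)\<^sup>2)"
proof (rule Bochner_Integration.integrable_bound)
  show "integrable M (\<lambda>w. 1 + \<bar>X i w\<bar> ^ 3)" using cube_integrable[OF assms] by simp
  show "AE w in M. norm ((X i w)\<^sup>2) \<le> norm (1 + \<bar>X i w\<bar> ^ 3)"
  proof (rule AE_I2)
    fix w
    have "t\<^sup>2 \<le> 1 + t ^ 3" if "0 \<le> t" for t :: real
    proof (cases "t \<le> 1")
      case True
      thus ?thesis using that power_le_one[of t 2] zero_le_power[of t 3] by linarith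
    next
      case False
      thus ?thesis using power_increasing[of 2 3 t] by linarith
    qed
    from this[of "\<bar>X i w\<bar>"] show "norm ((X i w)\<^sup>2) \<le> norm (1 + \<bar>X i w\<bar> ^ 3)" by simp
  qed
qed (use X_meas[OF assms] in measurable)

lemma mult_integrable:
  assumes "i \<in> {1..n}" "j \<in> {1..n}"
  shows "integrable M (\<lambda>w. X i w * X j w)"
proof (rule Bochner_Integration.integrable_bound)
  show "integrable M (\<lambda>w. (X i w)\<^sup>2 + (X j w)\<^sup>2)" using square_integrable assms by simp
  show "AE w in M. norm (X i w * X j w) \<le> norm ((X i w)\<^sup>2 + (X j w)\<^sup>2)"
  proof (rule AE_I2)
    fix w
    have "2 * \<bar>X i w\<bar> * \<bar>X j w\<bar> \<le> \<bar>X i w\<bar>\<^sup>2 + \<bar>X j w\<bar>\<^sup>2" by (rule sum_squares_bound)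
    moreover have "0 \<le> \<bar>X i w\<bar> * \<bar>X j w\<bar>" by simp
    ultimately have "\<bar>X i w\<bar> * \<bar>X j w\<bar> \<le> \<bar>X i w\<bar>\<^sup>2 + \<bar>X j w\<bar>\<^sup>2" by linarith
    thus "norm (X i w * X j w) \<le> norm ((X i w)\<^sup>2 + (X j w)\<^sup>2)" by (simp add: abs_mult)
  qed
qed (use X_meas[OF assms(1)] X_meas[OF assms(2)] in measurable)

lemma X_integrable: "i \<in> {1..n} \<Longrightarrow> integrable M (X i)"
  by (rule square_integrable_imp_integrable[OF X_meas square_integrable])

lemma mean_X: "i \<in> {1..n} \<Longrightarrow> expectation (X i) = 0"
  using exchange_single(1)[of i "\<lambda>x. x"] mean_X1 by simp

lemma square_X: "i \<in> {1..n} \<Longrightarrow> expectation (\<lambda>w. (X i w)\<^sup>2) = 1"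
  using exchange_single(1)[of i "\<lambda>x. x\<^sup>2"] square_X1 by simp

lemma cube_X: "i \<in> {1..n} \<Longrightarrow> expectation (\<lambda>w. \<bar>X i w\<bar> ^ 3) = expectation (\<lambda>w. \<bar>X 1 w\<bar> ^ 3)"
  using exchange_single(1)[of i "\<lambda>x. \<bar>x\<bar> ^ 3"] by simp

section \<open>Second moments of linear forms and the sample variance\<close>

lemma linear_moments:
  fixes c :: "nat \<Rightarrow> real"
  defines "L \<equiv> \<lambda>w. \<Sum>i=1..n. c i * X i w"
  shows "integrable M L" "integrable M (\<lambda>w. (L w)\<^sup>2)" "expectation L = 0"
    and "expectation (\<lambda>w. (L w)\<^sup>2) = (1 - \<delta>) * (\<Sum>i=1..n. (c i)\<^sup>2) + \<delta> * (\<Sum>i=1..n. c i)\<^sup>2"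
proof -
  show "integrable M L"
    unfolding L_def by (intro Bochner_Integration.integrable_sum integrable_mult_right X_integrable)
  have "expectation L = (\<Sum>i=1..n. expectation (\<lambda>w. c i * X i w))"
    unfolding L_def by (intro Bochner_Integration.integral_sum integrable_mult_right X_integrable)
  also have "\<dots> = (\<Sum>i=1..n. c i * 0)"
    using mean_X by (intro sum.cong refl) simp
  finally show "expectation L = 0" by simp
  have sq: "(L w)\<^sup>2 = (\<Sum>i=1..n. \<Sum>j=1..n. c i * c j * (X i w * X j w))" for w
    unfolding L_def power2_eq_square sum_product by (intro sum.cong refl) simp
  show "integrable M (\<lambda>w. (L w)\<^sup>2)"
    unfolding sq by (intro Bochner_Integration.integrable_sum integrable_mult_right mult_integrable)
  have "expectation (\<lambda>w. (L w)\<^sup>2) = (\<Sum>i=1..n. expectation (\<lambda>w. \<Sum>j=1..n. c i * c j * (X i w * X j w)))"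
    unfolding sq by (intro Bochner_Integration.integral_sum Bochner_Integration.integrable_sum
      integrable_mult_right mult_integrable)
  also have "\<dots> = (\<Sum>i=1..n. \<Sum>j=1..n. expectation (\<lambda>w. c i * c j * (X i w * X j w)))"
    by (intro sum.cong refl Bochner_Integration.integral_sum integrable_mult_right mult_integrable)
  also have "\<dots> = (\<Sum>i=1..n. \<Sum>j=1..n. c i * c j * expectation (\<lambda>w. X i w * X j w))"
    by simp
  also have "\<dots> = (\<Sum>i=1..n. \<Sum>j=1..n. \<delta> * (c i * c j) + (if j = i then (1 - \<delta>) * (c i)\<^sup>2 else 0))"
  proof (intro sum.cong refl)
    fix i j assume ij: "i \<in> {1..n}" "j \<in> {1..n}"
    show "c i * c j * expectation (\<lambda>w. X i w * X j w) =
        \<delta> * (c i * c j) + (if j = i then (1 - \<delta>) * (c i)\<^sup>2 else 0)"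
    proof (cases "i = j")
      case True
      thus ?thesis using square_X[OF ij(1)] by (simp add: power2_eq_square algebra_simps)
    next
      case False
      thus ?thesis using exchange_pair[OF ij False] by simp
    qed
  qed
  also have "\<dots> = \<delta> * (\<Sum>i=1..n. c i)\<^sup>2 + (1 - \<delta>) * (\<Sum>i=1..n. (c i)\<^sup>2)"
  proof -
    have "(\<Sum>i=1..n. c i)\<^sup>2 = (\<Sum>i=1..n. \<Sum>j=1..n. c i * c j)"
      by (simp only: power2_eq_square sum_product)
    thus ?thesis by (simp only:) (simp add: sum.distrib sum_distrib_left)
  qed
  finally show "expectation (\<lambda>w. (L w)\<^sup>2) = (1 - \<delta>) * (\<Sum>i=1..n. (c i)\<^sup>2) + \<delta> * (\<Sum>i=1..n. c i)\<^sup>2"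
    by simp
qed

definition avg :: "'a \<Rightarrow> real" where
  "avg w = (\<Sum>i=1..n. X i w) / n"

lemma avg_moments:
  "integrable M avg" "integrable M (\<lambda>w. (avg w)\<^sup>2)" "expectation avg = 0"
  "expectation (\<lambda>w. (avg w)\<^sup>2) \<le> \<bar>\<delta>\<bar> + 1 / n"
proof -
  have n0: "0 < real n" using n_ge by simp
  have eq: "avg = (\<lambda>w. \<Sum>i=1..n. (1 / n) * X i w)"
    unfolding avg_def by (simp add: sum_divide_distrib)
  note lm = linear_moments[of "\<lambda>_. 1 / n", folded eq]
  show "integrable M avg" "expectation avg = 0" using lm(1,3) by auto
  show "integrable M (\<lambda>w. (avg w)\<^sup>2)" using lm(2) eq by simp
  have "expectation (\<lambda>w. (avg w)\<^sup>2) = (1 - \<delta>) * (n * (1 / n)\<^sup>2) + \<delta> * (n * (1 / n))\<^sup>2"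
    using lm(4) by (simp add: eq)
  also have "\<dots> = 1 / n + \<delta> * (1 - 1 / n)"
    using n0 by (simp add: power2_eq_square field_simps)
  also have "\<delta> * (1 - 1 / n) \<le> \<bar>\<delta>\<bar> * 1"
    using n0 by (intro mult_mono) (auto simp: field_simps)
  finally show "expectation (\<lambda>w. (avg w)\<^sup>2) \<le> \<bar>\<delta>\<bar> + 1 / n" by simp
qed

text \<open>The parameter \<open>v\<close> of the bound for fixed values, evaluated at the random
  vector.\<close>

definition sample_var :: "'a \<Rightarrow> real" where
  "sample_var w = ((\<Sum>i=1..n. (X i w)\<^sup>2) - real n * (avg w)\<^sup>2) / (real n - 1)"

lemma sum_square_integrable: "integrable M (\<lambda>w. \<Sum>i=1..n. (X i w)\<^sup>2)"
  by (intro Bochner_Integration.integrable_sum square_integrable)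

lemma sample_var_integrable: "integrable M (\<lambda>w. \<bar>sample_var w - 1\<bar>)"
  unfolding sample_var_def
  by (intro integrable_abs Bochner_Integration.integrable_diff integrable_divide_zero integrable_mult_right
      sum_square_integrable avg_moments(2)) auto

text \<open>The ratio \<open>n / (n - 1)\<close> is bounded by \<open>5 / 4\<close>, which turns the
  coefficient 4 into the 5 in front of \<open>osc\<close>. The random mean contributes through its
  second moment.\<close>

lemma expectation_sample_var:
  assumes "1000 \<le> n"
  shows "expectation (\<lambda>w. 4 * \<bar>sample_var w - 1\<bar>) \<le> 5 * osc M n X + 5 * \<bar>\<delta>\<bar> + 10 / n"
proof -
  have n0: "1000 \<le> real n" using assms by simp
  define c where "c = real n / (real n - 1)"
  have c: "1 \<le> c" "c \<le> 5 / 4" "c - 1 \<le> (5 / 4) / n" "c = 1 + 1 / (real n - 1)"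
    using n0 by (auto simp: c_def field_simps)
  let ?q = "\<lambda>w. \<bar>(\<Sum>j=1..n. (X j w)\<^sup>2) / n - 1\<bar>"
  have q: "integrable M ?q"
    by (intro integrable_abs Bochner_Integration.integrable_diff integrable_divide_zero
        sum_square_integrable) auto
  have "expectation (\<lambda>w. 4 * \<bar>sample_var w - 1\<bar>) \<le>
      expectation (\<lambda>w. 5 * ?q w + 5 * (avg w)\<^sup>2 + 5 / n)"
  proof (rule integral_mono)
    fix w
    let ?s = "\<Sum>i=1..n. (X i w)\<^sup>2"
    have *: "sample_var w - 1 = c * (?s / n - 1) - c * (avg w)\<^sup>2 + (c - 1)"
    proof -
      define k where "k = real n - 1"
      have k: "0 < k" "real n = k + 1" using n0 by (auto simp: k_def)
      have "c * (?s / n - 1) = (?s - n) / k"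
        using n0 by (simp add: c_def k_def[symmetric] right_diff_distrib diff_divide_distrib)
      moreover have "c * (avg w)\<^sup>2 = n * (avg w)\<^sup>2 / k" by (simp add: c_def k_def)
      moreover have "c - 1 = 1 / k" using c(4) by (simp add: k_def)
      moreover have "sample_var w - 1 = (?s - n * (avg w)\<^sup>2 - k) / k"
        using k(1) by (simp add: sample_var_def k_def[symmetric] diff_divide_distrib)
      ultimately show ?thesis
        by (simp add: k_def flip: add_divide_distrib diff_divide_distrib)
    qed
    have "\<bar>sample_var w - 1\<bar> \<le> \<bar>c * (?s / n - 1)\<bar> + \<bar>c * (avg w)\<^sup>2\<bar> + \<bar>c - 1\<bar>"
    proof -
      have "\<bar>p - q + r\<bar> \<le> \<bar>p\<bar> + \<bar>q\<bar> + \<bar>r\<bar>" for p q r :: real by linarith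
      with * show ?thesis by metis
    qed
    also have "\<dots> = c * ?q w + c * (avg w)\<^sup>2 + (c - 1)" using c(1) by (simp add: abs_mult)
    also have "\<dots> \<le> 5 / 4 * ?q w + 5 / 4 * (avg w)\<^sup>2 + (5 / 4) / n"
      using c by (intro add_mono mult_right_mono) auto
    finally have "4 * \<bar>sample_var w - 1\<bar> \<le> 4 * (5 / 4 * ?q w + 5 / 4 * (avg w)\<^sup>2 + (5 / 4) / n)"
      by (rule mult_left_mono) simp
    thus "4 * \<bar>sample_var w - 1\<bar> \<le> 5 * ?q w + 5 * (avg w)\<^sup>2 + 5 / n"
      by (simp add: distrib_left)
  qed (use sample_var_integrable q avg_moments in auto)
  also have "\<dots> = 5 * osc M n X + 5 * expectation (\<lambda>w. (avg w)\<^sup>2) + 5 / n"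
    using q avg_moments by (simp add: osc_def prob_space)
  also have "\<dots> \<le> 5 * osc M n X + 5 * (\<bar>\<delta>\<bar> + 1 / n) + 5 / n"
    by (intro add_mono mult_left_mono avg_moments) auto
  finally show ?thesis by (simp add: algebra_simps)
qed

text \<open>By exchangeability all permuted events have the same probability, so averaging over
  permutations changes nothing. It moves the average inside the expectation, where the bound for
  fixed values applies.\<close>

lemma prob_eq_permutation_average:
  fixes \<theta> :: "nat \<Rightarrow> real"
  shows "prob {w \<in> space M. (\<Sum>i=1..n. \<theta> i * X i w) \<le> z} =
    expectation (\<lambda>w. perm_avg {1..n} (\<lambda>\<pi>. of_bool ((\<Sum>i=1..n. \<theta> i * X (\<pi> i) w) \<le> z)))"
    (is "?P = expectation (\<lambda>w. perm_avg _ (?f w))")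
    and "integrable M (\<lambda>w. perm_avg {1..n} (\<lambda>\<pi>. of_bool ((\<Sum>i=1..n. \<theta> i * X (\<pi> i) w) \<le> z)))"
proof -
  let ?g = "\<lambda>y. of_bool ((\<Sum>i=1..n. \<theta> i * y i) \<le> z) :: real"
  have g: "?g \<in> borel_measurable (\<Pi>\<^sub>M i\<in>{1..n}. borel)" by measurable
  have vec: "(\<Sum>i=1..n. \<theta> i * vec p w i) = (\<Sum>i=1..n. \<theta> i * X (p i) w)" for p w
    by (intro sum.cong) auto
  have f: "?f w \<pi> = ?g (vec \<pi> w)" for w \<pi> unfolding vec ..
  have set: "{w \<in> space M. (\<Sum>i=1..n. \<theta> i * X i w) \<le> z} \<in> events" using X_meas by measurable
  have id: "?g (vec id w) = indicator {w \<in> space M. (\<Sum>i=1..n. \<theta> i * X i w) \<le> z} w" if "w \<in> space M" for w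
    using that unfolding vec by (simp add: indicator_def)
  have int_id: "integrable M (\<lambda>w. ?g (vec id w))"
  proof (rule integrable_const_bound[of _ 1])
    show "(\<lambda>w. ?g (vec id w)) \<in> borel_measurable M"
      using measurable_compose[OF vec_measurable[OF permutes_id] g] by simp
  qed auto
  have E: "expectation (\<lambda>w. ?f w \<pi>) = ?P" "integrable M (\<lambda>w. ?f w \<pi>)" if \<pi>: "\<pi> permutes {1..n}" for \<pi>
  proof -
    have "expectation (\<lambda>w. ?f w \<pi>) = expectation (\<lambda>w. ?g (vec id w))"
      unfolding f by (rule exchange_integral(1)[OF \<pi> g])
    also have "\<dots> = expectation (indicator {w \<in> space M. (\<Sum>i=1..n. \<theta> i * X i w) \<le> z})"
      by (intro Bochner_Integration.integral_cong refl id)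
    also have "\<dots> = ?P" using set by simp
    finally show "expectation (\<lambda>w. ?f w \<pi>) = ?P" .
    show "integrable M (\<lambda>w. ?f w \<pi>)"
      unfolding f using exchange_integral(2)[OF \<pi> g] int_id by simp
  qed
  show "integrable M (\<lambda>w. perm_avg {1..n} (?f w))"
    unfolding perm_avg_def
    by (intro integrable_divide_zero Bochner_Integration.integrable_sum E(2)) auto
  have "expectation (\<lambda>w. \<Sum>\<pi> | \<pi> permutes {1..n}. ?f w \<pi>) = (\<Sum>\<pi> | \<pi> permutes {1..n}. expectation (\<lambda>w. ?f w \<pi>))"
    by (intro Bochner_Integration.integral_sum E(2)) (simp only: mem_Collect_eq)
  hence "expectation (\<lambda>w. perm_avg {1..n} (?f w)) = (\<Sum>\<pi> | \<pi> permutes {1..n}. expectation (\<lambda>w. ?f w \<pi>)) / fact (card {1..n})"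
    unfolding perm_avg_def by simp
  also have "\<dots> = ?P"
    using card_permutations[of "{1..n}" "card {1..n}"] E(1) by simp
  finally show "?P = expectation (\<lambda>w. perm_avg {1..n} (?f w))" by simp
qed


text \<open>Here \<open>1 - T\<^sup>2 / n\<close> is the squared norm of the centered coefficients
  and \<open>1 + \<delta> * (T\<^sup>2 - 1)\<close> the variance of the linear form. The comparison
  goes through a normal law of the former variance whose mean \<open>avg w * T\<close> is random,
  then through the same law with mean 0.\<close>

theorem Kolmogorov_bound_nondegenerate:
  fixes \<theta> :: "nat \<Rightarrow> real"
  defines "T \<equiv> \<Sum>i=1..n. \<theta> i"
  assumes \<theta>: "(\<Sum>i=1..n. (\<theta> i)\<^sup>2) = 1" and n: "1000 \<le> n"
    and u: "2 / 5 \<le> 1 - T\<^sup>2 / n" and s: "2 / 5 \<le> 1 + \<delta> * (T\<^sup>2 - 1)"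
  shows "\<bar>prob {w \<in> space M. (\<Sum>i=1..n. \<theta> i * X i w) \<le> z} - Phi (z / sqrt (1 + \<delta> * (T\<^sup>2 - 1)))\<bar>
    \<le> 5 * osc M n X + 6 * \<bar>\<delta>\<bar> + 4320 / real n + (\<bar>\<delta>\<bar> + 1 / real n) * T\<^sup>2
      + 4320 * expectation (\<lambda>w. \<bar>X 1 w\<bar> ^ 3) * (\<Sum>i=1..n. \<bar>\<theta> i\<bar> ^ 3)"
proof -
  define u where "u = 1 - T\<^sup>2 / n"
  define s where "s = 1 + \<delta> * (T\<^sup>2 - 1)"
  define \<Theta> where "\<Theta> = (\<Sum>i=1..n. \<bar>\<theta> i\<bar> ^ 3)"
  define \<mu> where "\<mu> = expectation (\<lambda>w. \<bar>X 1 w\<bar> ^ 3)"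
  define y where "y = z / sqrt u"
  define F where "F = (\<lambda>w. perm_avg {1..n} (\<lambda>\<pi>. of_bool ((\<Sum>i=1..n. \<theta> i * X (\<pi> i) w) \<le> z)))"
  define Q where "Q = (\<lambda>w. Phi ((z - avg w * T) / sqrt u))"
  let ?P = "prob {w \<in> space M. (\<Sum>i=1..n. \<theta> i * X i w) \<le> z}"
  have n0: "1000 \<le> real n" using n by simp
  have u0: "2 / 5 \<le> u" using u by (simp only: u_def)
  hence u1: "0 < u" "0 < sqrt u" by auto
  have \<Theta>0: "0 \<le> \<Theta>" unfolding \<Theta>_def by (intro sum_nonneg) auto
  have \<mu>0: "0 \<le> \<mu>" unfolding \<mu>_def by simp
  have [measurable]: "avg \<in> borel_measurable M" using avg_moments(1) by auto
  have F: "integrable M F" "expectation F = ?P"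
    unfolding F_def using prob_eq_permutation_average[of \<theta> z] by simp_all
  have Q: "integrable M Q"
    unfolding Q_def by (rule integrable_const_bound[of _ 1]) auto
  let ?cubes = "\<lambda>w. (\<Sum>i=1..n. \<bar>X i w\<bar> ^ 3) / n"
  have cubes: "integrable M ?cubes"
    by (intro integrable_divide_zero Bochner_Integration.integrable_sum cube_integrable)
  have E_cubes: "expectation ?cubes = \<mu>"
  proof -
    have "expectation (\<lambda>w. \<Sum>i=1..n. \<bar>X i w\<bar> ^ 3) = (\<Sum>i=1..n. expectation (\<lambda>w. \<bar>X i w\<bar> ^ 3))"
      by (intro Bochner_Integration.integral_sum cube_integrable)
    also have "\<dots> = (\<Sum>i=1..n. \<mu>)" unfolding \<mu>_def by (intro sum.cong refl cube_X)
    finally show ?thesis using n0 by simp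
  qed
  let ?B = "\<lambda>w. 4 * \<bar>sample_var w - 1\<bar> + (3600 * \<Theta>) * ?cubes w + 40 / n"
  have "\<bar>?P - expectation Q\<bar> = \<bar>expectation (\<lambda>w. F w - Q w)\<bar>"
    using F Q by simp
  also have "\<dots> \<le> expectation (\<lambda>w. \<bar>F w - Q w\<bar>)" by (rule integral_abs_bound)
  also have "\<dots> \<le> expectation ?B"
  proof (rule integral_mono)
    show "integrable M (\<lambda>w. \<bar>F w - Q w\<bar>)" using F Q by simp
    show "integrable M ?B"
      using sample_var_integrable cubes
      by (intro Bochner_Integration.integrable_add integrable_mult_right) auto
    fix w
    have "\<bar>F w - Q w\<bar> \<le> 4 * \<bar>sample_var w - 1\<bar> + 3600 * (\<Theta> * ?cubes w) + 40 / n"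
      using linear_permutation_statistic_bound[of "{1..n}" \<theta> u "\<lambda>i. X i w" z] n \<theta> u0
      by (simp add: F_def Q_def \<Theta>_def sample_var_def avg_def u_def T_def)
    thus "\<bar>F w - Q w\<bar> \<le> ?B w" by simp
  qed
  also have "\<dots> = expectation (\<lambda>w. 4 * \<bar>sample_var w - 1\<bar>) + (3600 * \<Theta>) * \<mu> + 40 / n"
  proof -
    have i: "integrable M (\<lambda>w. 4 * \<bar>sample_var w - 1\<bar>)" "integrable M (\<lambda>w. (3600 * \<Theta>) * ?cubes w)"
      by (intro integrable_mult_right sample_var_integrable cubes)+
    have "expectation (\<lambda>w. (3600 * \<Theta>) * ?cubes w) = (3600 * \<Theta>) * \<mu>"
      by (simp only: integral_mult_right_zero E_cubes)
    moreover have "expectation ?B = expectation (\<lambda>w. 4 * \<bar>sample_var w - 1\<bar> + (3600 * \<Theta>) * ?cubes w) + 40 / n"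
      by (subst Bochner_Integration.integral_add[OF Bochner_Integration.integrable_add[OF i]])
         (simp_all only: integrable_const lebesgue_integral_const prob_space scaleR_one)
    ultimately show ?thesis by (simp only: Bochner_Integration.integral_add[OF i])
  qed
  also have "\<dots> \<le> 5 * osc M n X + 5 * \<bar>\<delta>\<bar> + 10 / n + (3600 * \<Theta>) * \<mu> + 40 / n"
    by (intro add_right_mono expectation_sample_var n)
  finally have 1: "\<bar>?P - expectation Q\<bar> \<le> 5 * osc M n X + 5 * \<bar>\<delta>\<bar> + 10 / n + (3600 * \<Theta>) * \<mu> + 40 / n" .
  have 2: "\<bar>expectation Q - Phi y\<bar> \<le> 5 / 16 * ((\<bar>\<delta>\<bar> + 1 / n) * T\<^sup>2)"
  proof -
    define h where "h = (\<lambda>w. - (T / sqrt u) * avg w)"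
    have h: "integrable M h" "expectation h = 0" "integrable M (\<lambda>w. (h w)\<^sup>2)"
      unfolding h_def power_mult_distrib using avg_moments by simp_all
    have Qh: "Q w = Phi (y + h w)" for w
      using u1 by (simp add: Q_def y_def h_def diff_divide_distrib mult.commute)
    \<comment> \<open>Subtracting the term linear in \<open>h\<close> is free because
      \<open>h\<close> has mean 0, so the random shift costs only its second moment.\<close>
    have "expectation Q - Phi y = expectation (\<lambda>w. Q w - Phi y - h w * std_normal_density y)"
      using Q h by (simp add: prob_space)
    hence "\<bar>expectation Q - Phi y\<bar> \<le> expectation (\<lambda>w. \<bar>Q w - Phi y - h w * std_normal_density y\<bar>)"
      by (simp only: integral_abs_bound)
    also have "\<dots> \<le> expectation (\<lambda>w. (T\<^sup>2 / u / 8) * (avg w)\<^sup>2)"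
    proof (rule integral_mono)
      fix w
      have "\<bar>Q w - Phi y - h w * std_normal_density y\<bar> \<le> (h w)\<^sup>2 / 8"
        unfolding Qh by (rule Phi_second_order)
      also have "\<dots> = (T\<^sup>2 / u / 8) * (avg w)\<^sup>2"
        using u1 by (simp add: h_def power_mult_distrib power_divide)
      finally show "\<bar>Q w - Phi y - h w * std_normal_density y\<bar> \<le> (T\<^sup>2 / u / 8) * (avg w)\<^sup>2" .
    qed (use Q h avg_moments in auto)
    also have "\<dots> = (T\<^sup>2 / u / 8) * expectation (\<lambda>w. (avg w)\<^sup>2)" by simp
    also have "\<dots> \<le> (T\<^sup>2 / (2 / 5) / 8) * (\<bar>\<delta>\<bar> + 1 / n)"
      using u0 u1 by (intro mult_mono avg_moments divide_right_mono divide_left_mono) auto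
    also have "\<dots> = 5 / 16 * ((\<bar>\<delta>\<bar> + 1 / n) * T\<^sup>2)" by simp
    finally show ?thesis .
  qed
  have 3: "\<bar>Phi y - Phi (z / sqrt s)\<bar> \<le> 5 / 16 * ((\<bar>\<delta>\<bar> + 1 / n) * T\<^sup>2 + \<bar>\<delta>\<bar>)"
  proof -
    have "\<bar>Phi y - Phi (z / sqrt s)\<bar> \<le> 5 / 16 * \<bar>u - s\<bar>"
      unfolding y_def using u0 s by (intro Phi_rescale) (auto simp: s_def)
    also have "u - s = - (T\<^sup>2 / n) - \<delta> * T\<^sup>2 + \<delta>" by (simp add: u_def s_def algebra_simps)
    also have "\<bar>- (T\<^sup>2 / n) - \<delta> * T\<^sup>2 + \<delta>\<bar> \<le> \<bar>T\<^sup>2 / n\<bar> + \<bar>\<delta> * T\<^sup>2\<bar> + \<bar>\<delta>\<bar>" by linarith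
    also have "\<dots> = (\<bar>\<delta>\<bar> + 1 / n) * T\<^sup>2 + \<bar>\<delta>\<bar>" by (simp add: abs_mult algebra_simps)
    finally show ?thesis by simp
  qed
  have 4: "0 \<le> (\<bar>\<delta>\<bar> + 1 / n) * T\<^sup>2" by simp
  have 5: "10 / n + 40 / n \<le> 4320 / n" using n0 by (simp add: divide_right_mono flip: add_divide_distrib)
  have 6: "(3600 * \<Theta>) * \<mu> \<le> 4320 * \<mu> * \<Theta>" using \<Theta>0 \<mu>0 by (simp add: mult_right_mono)
  have "\<bar>p - r\<bar> \<le> \<bar>p - q\<bar> + \<bar>q - f\<bar> + \<bar>f - r\<bar>" for p q f r :: real by linarith
  note tri = this[of ?P _ "expectation Q" "Phi y"]
  \<comment> \<open>The errors use up \<open>5 / 8\<close> of the term with \<open>T\<^sup>2\<close>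
    and \<open>5 + 5 / 16\<close> of \<open>\<bar>\<delta>\<bar>\<close>, within the available 1 and
    6.\<close>
  have "x1 + x2 + x3 \<le> q + 6 * d + c + t + m"
    if "x1 \<le> q + 5 * d + c1 + m1 + c2" "x2 \<le> 5 / 16 * t" "x3 \<le> 5 / 16 * (t + d)"
      "0 \<le> t" "c1 + c2 \<le> c" "m1 \<le> m" "0 \<le> d" for x1 x2 x3 q d c c1 c2 t m m1 :: real
    using that by argo
  from order.trans[OF tri this[OF 1 2 3 4 5 6]] show ?thesis
    by (simp add: s_def \<mu>_def \<Theta>_def)
qed

end

theorem corollary3p1:
  fixes M :: "'a measure" and n :: nat and X :: "nat \<Rightarrow> 'a \<Rightarrow> real"
    and \<theta> :: "nat \<Rightarrow> real" and var \<delta>\<^sub>0 :: real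
  assumes "prob_space M"
    and "n \<ge> 2"
    and "\<And>i. i \<in> {1..n} \<Longrightarrow> X i \<in> borel_measurable M"
    and "exchangeable M n X"
    and "prob_space.expectation M (X 1) = 0"
    and "prob_space.expectation M (\<lambda>\<omega>. (X 1 \<omega>)\<^sup>2) = 1"
    and "integrable M (\<lambda>\<omega>. \<bar>X 1 \<omega>\<bar> ^ 3)"
    and "(\<Sum>i=1..n. (\<theta> i)\<^sup>2) = 1"
    and "var = prob_space.variance M (\<lambda>\<omega>. \<Sum>i=1..n. \<theta> i * X i \<omega>)"
    and "\<delta>\<^sub>0 = prob_space.expectation M (\<lambda>\<omega>. X 1 \<omega> * X 2 \<omega>)"
  shows "kolmogorov_dist (distr M borel (\<lambda>\<omega>. \<Sum>i=1..n. \<theta> i * X i \<omega>)) (normal_law 0 var)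
     \<le> 5 * osc M n X + 6 * \<bar>\<delta>\<^sub>0\<bar> + 4320 / real n
       + (\<bar>\<delta>\<^sub>0\<bar> + 1 / real n) * (\<Sum>i=1..n. \<theta> i)\<^sup>2
       + 4320 * prob_space.expectation M (\<lambda>\<omega>. \<bar>X 1 \<omega>\<bar> ^ 3) * (\<Sum>i=1..n. \<bar>\<theta> i\<bar> ^ 3)"
proof -
  interpret exchangeable_vector M n X \<delta>\<^sub>0
    by (intro exchangeable_vector.intro exchangeable_vector_axioms.intro assms)
  define T where "T = (\<Sum>i=1..n. \<theta> i)"
  define L where "L = (\<lambda>w. \<Sum>i=1..n. \<theta> i * X i w)"
  define R where "R = 5 * osc M n X + 6 * \<bar>\<delta>\<^sub>0\<bar> + 4320 / real n + (\<bar>\<delta>\<^sub>0\<bar> + 1 / real n) * T\<^sup>2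
    + 4320 * expectation (\<lambda>w. \<bar>X 1 w\<bar> ^ 3) * (\<Sum>i=1..n. \<bar>\<theta> i\<bar> ^ 3)"
  have Lw: "(\<Sum>i=1..n. \<theta> i * X i w) = L w" for w by (simp add: L_def)
  note L = linear_moments[of \<theta>, unfolded Lw]
  have Lm [measurable]: "L \<in> borel_measurable M" using L(1) by auto
  have var: "var = 1 + \<delta>\<^sub>0 * (T\<^sup>2 - 1)"
  proof -
    have "var = expectation (\<lambda>w. (L w - expectation L)\<^sup>2)" using assms(9) unfolding Lw .
    also have "\<dots> = (1 - \<delta>\<^sub>0) * 1 + \<delta>\<^sub>0 * T\<^sup>2" using L(3,4) assms(8) by (simp add: T_def)
    finally show ?thesis by (simp add: algebra_simps)
  qed
  have E2: "expectation (\<lambda>w. (L w)\<^sup>2) = var"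
    using L(4) assms(8) by (simp add: var T_def algebra_simps)
  have var0: "0 \<le> var" unfolding E2[symmetric] by simp
  have n0: "0 < real n" using assms(2) by simp
  have parts: "0 \<le> osc M n X" "0 \<le> 4320 / real n" "0 \<le> (\<bar>\<delta>\<^sub>0\<bar> + 1 / real n) * T\<^sup>2"
    "0 \<le> 4320 * expectation (\<lambda>w. \<bar>X 1 w\<bar> ^ 3) * (\<Sum>i=1..n. \<bar>\<theta> i\<bar> ^ 3)"
    by (auto simp: osc_def intro!: mult_nonneg_nonneg sum_nonneg)
  have split: "(\<bar>\<delta>\<^sub>0\<bar> + 1 / real n) * T\<^sup>2 = \<bar>\<delta>\<^sub>0\<bar> * T\<^sup>2 + T\<^sup>2 / n" "0 \<le> T\<^sup>2 / n" "0 \<le> \<bar>\<delta>\<^sub>0\<bar> * T\<^sup>2"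
    by (auto simp: algebra_simps)
  have dT: "\<bar>\<delta>\<^sub>0 * (T\<^sup>2 - 1)\<bar> \<le> \<bar>\<delta>\<^sub>0\<bar> * T\<^sup>2 + \<bar>\<delta>\<^sub>0\<bar>"
  proof -
    have "\<bar>\<delta>\<^sub>0\<bar> * \<bar>T\<^sup>2 - 1\<bar> \<le> \<bar>\<delta>\<^sub>0\<bar> * (T\<^sup>2 + 1)"
      by (intro mult_left_mono) (auto simp: abs_le_iff)
    thus ?thesis unfolding abs_mult by (simp add: distrib_left)
  qed
  have "\<bar>cdf (distr M borel L) z - cdf (normal_law 0 var) z\<bar> \<le> R" for z
  proof -
    have cdf_L: "cdf (distr M borel L) z = prob {w \<in> space M. L w \<le> z}"
      by (simp add: cdf_def measure_distr vimage_def Int_def conj_commute)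
    show ?thesis
    proof (cases "var = 0")
      case True
      \<comment> \<open>Zero variance forces
        \<open>\<bar>\<delta>\<^sub>0\<bar> * (T\<^sup>2 + 1)\<close> to be at least 1. So
        \<open>R\<close> is at least 1, which bounds the distance of any two distribution
        functions.\<close>
      have "\<delta>\<^sub>0 * (T\<^sup>2 - 1) = - 1" using True var by simp
      hence "1 \<le> \<bar>\<delta>\<^sub>0\<bar> * T\<^sup>2 + \<bar>\<delta>\<^sub>0\<bar>" using dT by simp
      hence "1 \<le> R" using parts split unfolding R_def by linarith
      moreover have "\<bar>cdf (distr M borel L) z - cdf (normal_law 0 var) z\<bar> \<le> 1"
      proof -
        interpret r: prob_space "return borel (0::real)" by (rule prob_space_return) simp
        have "\<bar>p - q\<bar> \<le> 1" if "0 \<le> p" "p \<le> 1" "0 \<le> q" "q \<le> 1" for p q :: real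
          using that by linarith
        thus ?thesis unfolding cdf_L using True by (simp add: normal_law_def cdf_def)
      qed
      ultimately show ?thesis by linarith
    next
      case False
      hence v0: "0 < var" using var0 by simp
      note cdf_N = cdf_normal_law[OF v0, of z]
      show ?thesis
      proof (cases "3 / 5 \<le> R")
        case True
        thus ?thesis
          unfolding cdf_L cdf_N
          using centered_Kolmogorov_bound[OF L(1,2,3) E2 v0, of z] by linarith
      next
        case False
        \<comment> \<open>All summands of \<open>R\<close> are nonnegative. Being below
          \<open>3 / 5\<close>, the first one used here gives \<open>n > 7200\<close>, and those
          with \<open>T\<close> and \<open>\<delta>\<^sub>0\<close> keep both variances at
          \<open>2 / 5\<close> or more.\<close>
        have "4320 / real n < 3 / 5"
          using False parts split unfolding R_def by linarith
        hence "1000 \<le> n" using n0 by (simp add: field_simps)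
        moreover have "2 / 5 \<le> 1 - T\<^sup>2 / n"
          using False parts split unfolding R_def by linarith
        moreover have "2 / 5 \<le> 1 + \<delta>\<^sub>0 * (T\<^sup>2 - 1)"
          using False parts split dT unfolding R_def by linarith
        ultimately show ?thesis
          unfolding cdf_L cdf_N unfolding var R_def L_def T_def
          by (intro Kolmogorov_bound_nondegenerate assms(8))
      qed
    qed
  qed
  hence "kolmogorov_dist (distr M borel L) (normal_law 0 var) \<le> R"
    unfolding kolmogorov_dist_def by (intro cSUP_least) auto
  thus ?thesis unfolding L_def R_def T_def .
qed

end
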